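(* Let $\mathfrak{T}=(\mathcal{T},l)$ be a (polytopal) tiling of $\mathbb{R}^2$ with Euclidean finite local complexity and trivial cell isotropy. Let $(E^r_{p,q})$ be the spectral sequence, of homological type, of the filtration $C_\bullet(\mathfrak{X}^0)\subseteq C_\bullet(\mathfrak{X}^1)\subseteq C_\bullet(\mathfrak{X}^2)=C_\bullet(\mathfrak{T}^{\mathrm{rot}})$, and let $\partial\colon E^2_{2,0}\to E^2_{0,1}$ be the boundary map of its $E^2$ page. Then, with respect to the isomorphism $E^2_{0,1}\cong H_0(\mathfrak{T}^0)$ induced by $F_1$, we have $\partial(\Gamma)=[\omega]$ for a generator $\Gamma$ of $E^2_{2,0}\cong\mathbb{Z}$, where $\omega\in C_0(\mathfrak{T}^0)$ is the winding-number ePE $0$-chain defined in the context.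
   Context: All (co)homology has $\mathbb{Z}$ coefficients. Tilings. A (polytopal) tiling of $\mathbb{R}^2$ is a pair $\mathfrak{T}=(\mathcal{T},l)$ with $\mathcal{T}$ a regular CW decomposition of $\mathbb{R}^2$ into polytopal cells and $l$ a map from the set of cells to a set of labels. A patch is a finite subcomplex with the restricted labelling; a tile is the patch consisting of a $2$-cell and its boundary cells. $E=\mathbb{R}^2\rtimes \mathrm{SO}(2)$ is the group of rigid motions (orientation preserving isometries), acting on patches by moving cells and preserving labels. Two patches are rigid equivalent if a rigid motion maps the cells of one bijectively to those of the other, respecting labels. $\mathfrak{T}$ has Euclidean finite local complexity (eFLC) if for every $r>0$ there are only finitely many patches of diameter at most $r$ up to rigid equivalence. The $r$-patch at a cell $c$ is the patch supported on the tiles within distance $r$ of $c$. For $k$-cells $c_1,c_2$, $E_{\mathfrak{T}}(c_1,c_2;r)$ is the set of $\phi\in E$ sending $c_1$ to $c_2$ and the $r$-patch at $c_1$ to the $r$-patch at $c_2$. $\mathfrak{T}$ has trivial cell isotropy if there is some $r>0$ such that for every cell $c$ each $\phi\in E_{\mathfrak{T}}(c,c;r)$ restricts to the identity on $c$. The star $\mathrm{St}(c)$ is the patch of tiles containing $c$. Standing convention. For eFLC tilings with trivial cell isotropy it is always assumed (which can be arranged by a local redecoration of tiles) that every $\phi\in E$ taking $c$ to $c$ and $\mathrm{St}(c)$ to $\mathrm{St}(c)$ is the identity on $c$. The cells are then oriented consistently: if $\phi\in E$ takes $c_1$ to $c_2$ and $\mathrm{St}(c_1)$ to $\mathrm{St}(c_2)$,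 it maps the orientation of $c_1$ to that of $c_2$. For each rigid equivalence class of tile a representative prototile $p$ is fixed; for each tile $t$ which is a rigid motion of $p$ there is a unique rotation $\tau_t\in S^1=\mathrm{SO}(2)$ with $\tau_t(p)$ and $t$ equal up to translation; $|\tau_t|\in[0,2\pi)$ is its angle, measured anticlockwise. ePE homology. A $k$-chain (possibly infinite integer combination of oriented $k$-cells) $\sigma$ of $\mathcal{T}$ is ePE if there is $r>0$ such that $\sigma(c_1)=\sigma(c_2)$ whenever $E_{\mathfrak{T}}(c_1,c_2;r)\neq\emptyset$. With cellular boundary maps these form the complex $C_\bullet(\mathfrak{T}^0)$, with homology $H_\bullet(\mathfrak{T}^0)$. The complex $C_\bullet(\mathfrak{T}^{\mathrm{rot}})$ and its filtration. Let $q:E\to\mathbb{R}^2$, $q(\phi)=\phi(0)$; identify $E\cong\mathbb{R}^2\times S^1$ via $\phi\mapsto(\phi(0),g)$, $g$ the rotational part of $\phi$. $E$ has a CW decomposition $\mathcal{E}$: over each open cell $c$ of $\mathcal{T}$, $q^{-1}(c)=c\times S^1$ is cut at the finitely many $g\in\{\pm\tau_t: t\text{ a tile containing }c\}$, so the cells over $c$ are $c\times\{g\}$ for these $g$ and $c\times I$ for the complementary open arcs $I$ of $S^1$. Cells of $\mathcal{E}$ carry the orientations induced from $\mathcal{T}$ and from the anticlockwise orientation of $S^1$. A $k$-chain (possibly infinite) $\psi$ of $\mathcal{E}$ is pattern-equivariant (PE) if there is $r>0$ such that for all $\phi\in E_{\mathfrak{T}}(c_1,c_2;r)$ and every $k$-cell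 $c\subset q^{-1}(c_1)$ of $\mathcal{E}$, $\psi$ agrees on $c$ and $\phi(c)=\{\phi\circ a\mid a\in c\}$. PE chains with cellular boundary form $C_\bullet(\mathfrak{T}^{\mathrm{rot}})$, with homology $H_\bullet(\mathfrak{T}^{\mathrm{rot}})$. Let $\mathcal{X}^k=q^{-1}(\mathcal{T}^k)$ be the preimage of the $k$-skeleton and $C_\bullet(\mathfrak{X}^k)$ the subcomplex of PE chains supported on $\mathcal{X}^k$. The filtration gives a spectral sequence with $E^1_{p,q}=H_{p+q}(\mathfrak{X}^p,\mathfrak{X}^{p-1})\Rightarrow H_{p+q}(\mathfrak{T}^{\mathrm{rot}})$, where $H_\bullet(\mathfrak{X}^p,\mathfrak{X}^{p-1})$ is the homology of $C_\bullet(\mathfrak{X}^p)/C_\bullet(\mathfrak{X}^{p-1})$. There is a chain isomorphism $F_1: E^1_{\bullet,1}=H_{\bullet+1}(\mathfrak{X}^\bullet,\mathfrak{X}^{\bullet-1})\to C_\bullet(\mathfrak{T}^0)$ sending the class of $\sum_{c\in\mathcal{T}^k}\sigma(c)\,\nu_c$ to $\sum_{c\in\mathcal{T}^k}\sigma(c)\,c$ (sums over $k$-cells), where $\nu_c$ is the sum of the consistently oriented $(k+1)$-cells of $q^{-1}(c)$; it induces $E^2_{0,1}\cong H_0(\mathfrak{T}^0)$. Also $E^2_{2,0}\cong\mathbb{Z}$. The chain $\omega$. For an edge ($1$-cell) $e$, let $e(\mathrm{l})$ and $e(\mathrm{r})$ be the tiles to the left and right of the oriented edge $e$. For each rigid equivalence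 class of stars of edges choose a representative $\mathrm{St}(e)$ and a real number $\rho_e$ with $\rho_e\equiv|\tau_{e(\mathrm{l})}|-|\tau_{e(\mathrm{r})}| \bmod 2\pi$, and set $\rho_{e'}=\rho_e$ for every edge $e'$ whose star is rigid equivalent to $\mathrm{St}(e)$. For a vertex $v$ with incident edges $e_1,\dots,e_k$, let $\epsilon_i=1$ if $e_i$ is oriented outwards from $v$ and $\epsilon_i=-1$ if inwards. Then $\sum_i\epsilon_i\rho_{e_i}\in2\pi\mathbb{Z}$, and $\omega(v)=\frac{1}{2\pi}\sum_{i=1}^k\epsilon_i\rho_{e_i}\in\mathbb{Z}$. This defines an ePE $0$-chain $\omega\in C_0(\mathfrak{T}^0)$.
   Formalization: Euclidean finite local complexity is taken to include that there are only finitely many tiles up to rigid equivalence; with unboundedly large tiles the boundary of an ePE chain need not be ePE, so the complex of ePE chains would not be defined. *)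

theory Defs
  imports "HOL-Analysis.Analysis" "HOL-Algebra.Elementary_Groups"
begin

section \<open>Integer chains and the spectral sequence of a filtered complex\<close>

definition int_chains :: "('c \<Rightarrow> int) monoid" where
  "int_chains = \<lparr>carrier = UNIV, monoid.mult = (\<lambda>a b x. a x + b x), one = (\<lambda>_. 0)\<rparr>"

text \<open>Chains are possibly infinite. The cellular boundary is given by incidence numbers; the sum is
  over the cells with nonzero incidence, which form a finite set in a locally finite complex.\<close>

definition cellular_boundary ::
    "(int \<Rightarrow> 'c set) \<Rightarrow> ('c \<Rightarrow> 'c \<Rightarrow> int) \<Rightarrow> int \<Rightarrow> ('c \<Rightarrow> int) \<Rightarrow> 'c \<Rightarrow> int" where
  "cellular_boundary C inc n x y =
     (if y \<in> C (n - 1) then \<Sum>z | z \<in> C n \<and> inc z y \<noteq> 0. inc z y * x z else 0)"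

definition homology_class ::
    "(int \<Rightarrow> ('c \<Rightarrow> int) set) \<Rightarrow> (int \<Rightarrow> ('c \<Rightarrow> int) \<Rightarrow> 'c \<Rightarrow> int) \<Rightarrow> int \<Rightarrow> ('c \<Rightarrow> int) \<Rightarrow> ('c \<Rightarrow> int) set" where
  "homology_class C d n x = d (n + 1) ` C (n + 1) #>\<^bsub>int_chains\<^esub> x"

definition homology ::
    "(int \<Rightarrow> ('c \<Rightarrow> int) set) \<Rightarrow> (int \<Rightarrow> ('c \<Rightarrow> int) \<Rightarrow> 'c \<Rightarrow> int) \<Rightarrow> int \<Rightarrow> ('c \<Rightarrow> int) set monoid" where
  "homology C d n =
     int_chains\<lparr>carrier := {x \<in> C n. d n x = \<one>\<^bsub>int_chains\<^esub>}\<rparr> Mod (d (n + 1) ` C (n + 1))"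

text \<open>\<open>F p n\<close> is the \<open>p\<close>-th filtration step in degree \<open>n\<close>. As usual,
  \<open>Z\<^sup>r\<^sub>p = {x \<in> F\<^sub>p. d x \<in> F\<^bsub>p-r\<^esub>}\<close> and
  \<open>E\<^sup>r\<^sub>p = Z\<^sup>r\<^sub>p / (Z\<^bsup>r-1\<^esup>\<^bsub>p-1\<^esub> + d Z\<^bsup>r-1\<^esup>\<^bsub>p+r-1\<^esub>)\<close>, with differential induced by \<open>d\<close>.
  In particular, \<open>E\<^sup>1\<^sub>p\<close> is the homology of \<open>F\<^sub>p\<close> relative to \<open>F\<^bsub>p-1\<^esub>\<close>.\<close>

context
  fixes F :: "int \<Rightarrow> int \<Rightarrow> ('c \<Rightarrow> int) set" and d :: "int \<Rightarrow> ('c \<Rightarrow> int) \<Rightarrow> 'c \<Rightarrow> int"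
begin

definition ss_Z :: "int \<Rightarrow> int \<Rightarrow> int \<Rightarrow> ('c \<Rightarrow> int) set" where
  "ss_Z r p n = {x \<in> F p n. d n x \<in> F (p - r) (n - 1)}"

definition ss_B :: "int \<Rightarrow> int \<Rightarrow> int \<Rightarrow> ('c \<Rightarrow> int) set" where
  "ss_B r p n =
     ss_Z (r - 1) (p - 1) n <#>\<^bsub>int_chains\<^esub> d (n + 1) ` ss_Z (r - 1) (p + r - 1) (n + 1)"

definition ss_class :: "int \<Rightarrow> int \<Rightarrow> int \<Rightarrow> ('c \<Rightarrow> int) \<Rightarrow> ('c \<Rightarrow> int) set" where
  "ss_class r p q x = ss_B r p (p + q) #>\<^bsub>int_chains\<^esub> x"

definition ss_page :: "int \<Rightarrow> int \<Rightarrow> int \<Rightarrow> ('c \<Rightarrow> int) set monoid" where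
  "ss_page r p q = int_chains\<lparr>carrier := ss_Z r p (p + q)\<rparr> Mod ss_B r p (p + q)"

definition ss_diff :: "int \<Rightarrow> int \<Rightarrow> int \<Rightarrow> ('c \<Rightarrow> int) set \<Rightarrow> ('c \<Rightarrow> int) set" where
  "ss_diff r p q X = the_elem ((\<lambda>x. ss_class r (p - r) (q + r - 1) (d (p + q) x)) ` X)"

end

section \<open>Rigid motions\<close>

text \<open>The plane is \<open>complex\<close> and \<open>SO(2)\<close> is its unit circle. The motion \<open>x \<mapsto> g * x + b\<close> is
  represented by \<open>(b, g)\<close>, that is, by its image under the identification of \<open>E\<close> with
  \<open>\<real>\<^sup>2 \<times> S\<^sup>1\<close>.\<close>

type_synonym motion = "complex \<times> complex"

definition rigid_motions :: "motion set" where
  "rigid_motions = UNIV \<times> sphere 0 1"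

definition move :: "motion \<Rightarrow> complex \<Rightarrow> complex" where
  "move \<phi> x = snd \<phi> * x + fst \<phi>"

section \<open>Polytopal tilings\<close>

text \<open>Cells are recorded as closed cells. Besides the CW decomposition and its labelling, a marked
  tiling carries the auxiliary choices: the edge \<open>e\<close> is oriented from \<open>tail e\<close> to \<open>head e\<close>; the
  tile \<open>t\<close> is oriented anticlockwise if \<open>turn t = 1\<close> and clockwise if \<open>turn t = - 1\<close>; vertices
  are oriented positively; \<open>proto t\<close> is the prototile of \<open>t\<close>.\<close>

record 'l tiling =
  cells :: "complex set set"
  label :: "complex set \<Rightarrow> 'l"

record 'l marked_tiling = "'l tiling" +
  tail :: "complex set \<Rightarrow> complex"
  head :: "complex set \<Rightarrow> complex"
  turn :: "complex set \<Rightarrow> int"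
  proto :: "complex set \<Rightarrow> complex set"

text \<open>Polygons need not be convex. A polytopal cell is a \<open>k\<close>-ball that spans a \<open>k\<close>-dimensional
  affine subspace and is a finite union of convex polytopes; by invariance of domain its open cell
  is its relative interior.\<close>

definition polytopal_cell :: "complex set \<Rightarrow> bool" where
  "polytopal_cell c \<longleftrightarrow>
     (\<exists>\<P>. finite \<P> \<and> (\<forall>p\<in>\<P>. polytope p) \<and> c = \<Union>\<P>) \<and>
     (\<exists>S::complex set. subspace S \<and> int (dim S) = aff_dim c \<and> c homeomorphic (cball 0 1 \<inter> S))"

text \<open>The last clause says that the plane has the weak topology of the decomposition.\<close>

definition polytopal_tiling :: "('l, 'm) tiling_scheme \<Rightarrow> bool" where
  "polytopal_tiling T \<longleftrightarrow>
     (\<forall>c\<in>cells T. polytopal_cell c) \<and>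
     (\<Union>c\<in>cells T. rel_interior c) = UNIV \<and>
     (\<forall>c\<in>cells T. \<forall>d\<in>cells T. c \<noteq> d \<longrightarrow> rel_interior c \<inter> rel_interior d = {}) \<and>
     (\<forall>c\<in>cells T. \<exists>\<F>\<subseteq>cells T. finite \<F> \<and> (\<forall>d\<in>\<F>. aff_dim d < aff_dim c) \<and> rel_frontier c = \<Union>\<F>) \<and>
     (\<forall>A. (\<forall>c\<in>cells T. closed (A \<inter> c)) \<longrightarrow> closed A)"

definition kcells :: "('l, 'm) tiling_scheme \<Rightarrow> int \<Rightarrow> complex set set" where
  "kcells T k = {c \<in> cells T. aff_dim c = k}"

abbreviation tiles :: "('l, 'm) tiling_scheme \<Rightarrow> complex set set" where
  "tiles T \<equiv> kcells T 2"

definition patch :: "('l, 'm) tiling_scheme \<Rightarrow> complex set set \<Rightarrow> bool" where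
  "patch T P \<longleftrightarrow> finite P \<and> P \<subseteq> cells T \<and> (\<forall>c\<in>P. \<forall>d\<in>cells T. d \<subseteq> c \<longrightarrow> d \<in> P)"

definition supported_on :: "('l, 'm) tiling_scheme \<Rightarrow> complex set set \<Rightarrow> complex set set" where
  "supported_on T S = {d \<in> cells T. \<exists>t\<in>S. d \<subseteq> t}"

definition tile_patch :: "('l, 'm) tiling_scheme \<Rightarrow> complex set \<Rightarrow> complex set set" where
  "tile_patch T t = supported_on T {t}"

definition r_patch :: "('l, 'm) tiling_scheme \<Rightarrow> real \<Rightarrow> complex set \<Rightarrow> complex set set" where
  "r_patch T r c = supported_on T {t \<in> tiles T. setdist t c \<le> r}"

definition star :: "('l, 'm) tiling_scheme \<Rightarrow> complex set \<Rightarrow> complex set set" where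
  "star T c = supported_on T {t \<in> tiles T. c \<subseteq> t}"

definition carries ::
    "('l, 'm) tiling_scheme \<Rightarrow> motion \<Rightarrow> complex set set \<Rightarrow> complex set set \<Rightarrow> bool" where
  "carries T \<phi> P Q \<longleftrightarrow>
     (\<lambda>c. move \<phi> ` c) ` P = Q \<and> (\<forall>c\<in>P. label T (move \<phi> ` c) = label T c)"

definition rigid_equiv :: "('l, 'm) tiling_scheme \<Rightarrow> (complex set set \<times> complex set set) set" where
  "rigid_equiv T =
     {(P, Q). patch T P \<and> patch T Q \<and> (\<exists>\<phi>\<in>rigid_motions. carries T \<phi> P Q)}"

text \<open>The first clause (finitely many prototiles) is implicit in finite local complexity. The second
  one alone does not bound the diameters of the tiles, and for unbounded tiles the boundary of a
  pattern-equivariant chain need not be pattern-equivariant.\<close>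

definition eFLC :: "('l, 'm) tiling_scheme \<Rightarrow> bool" where
  "eFLC T \<longleftrightarrow>
     finite ((tile_patch T ` tiles T) // rigid_equiv T) \<and>
     (\<forall>r>0. finite ({P. patch T P \<and> diameter (\<Union>P) \<le> r} // rigid_equiv T))"

definition transports ::
    "('l, 'm) tiling_scheme \<Rightarrow> complex set \<Rightarrow> complex set \<Rightarrow> real \<Rightarrow> motion set" where
  "transports T c1 c2 r =
     {\<phi> \<in> rigid_motions. move \<phi> ` c1 = c2 \<and> carries T \<phi> (r_patch T r c1) (r_patch T r c2)}"

definition star_transports ::
    "('l, 'm) tiling_scheme \<Rightarrow> complex set \<Rightarrow> complex set \<Rightarrow> motion set" where
  "star_transports T c1 c2 =
     {\<phi> \<in> rigid_motions. move \<phi> ` c1 = c2 \<and> carries T \<phi> (star T c1) (star T c2)}"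

definition trivial_cell_isotropy :: "('l, 'm) tiling_scheme \<Rightarrow> bool" where
  "trivial_cell_isotropy T \<longleftrightarrow>
     (\<exists>r>0. \<forall>c\<in>cells T. \<forall>\<phi>\<in>transports T c c r. \<forall>x\<in>c. move \<phi> x = x)"

definition trivial_star_isotropy :: "('l, 'm) tiling_scheme \<Rightarrow> bool" where
  "trivial_star_isotropy T \<longleftrightarrow>
     (\<forall>c\<in>cells T. \<forall>\<phi>\<in>star_transports T c c. \<forall>x\<in>c. move \<phi> x = x)"

section \<open>Orientations and prototiles\<close>

definition consistently_oriented :: "('l, 'm) marked_tiling_scheme \<Rightarrow> bool" where
  "consistently_oriented T \<longleftrightarrow>
     (\<forall>e\<in>kcells T 1. e = closed_segment (tail T e) (head T e)) \<and>
     (\<forall>t\<in>tiles T. turn T t = 1 \<or> turn T t = - 1) \<and>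
     (\<forall>e\<in>kcells T 1. \<forall>e'\<in>kcells T 1. \<forall>\<phi>\<in>star_transports T e e'.
        move \<phi> (tail T e) = tail T e' \<and> move \<phi> (head T e) = head T e') \<and>
     (\<forall>t\<in>tiles T. \<forall>t'\<in>tiles T. star_transports T t t' \<noteq> {} \<longrightarrow> turn T t = turn T t')"

definition prototiles_chosen :: "('l, 'm) marked_tiling_scheme \<Rightarrow> bool" where
  "prototiles_chosen T \<longleftrightarrow>
     (\<forall>t\<in>tiles T. proto T t \<in> tiles T \<and>
        (tile_patch T (proto T t), tile_patch T t) \<in> rigid_equiv T) \<and>
     (\<forall>t\<in>tiles T. \<forall>t'\<in>tiles T.
        (tile_patch T t, tile_patch T t') \<in> rigid_equiv T \<longrightarrow> proto T t = proto T t')"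

definition tau :: "('l, 'm) marked_tiling_scheme \<Rightarrow> complex set \<Rightarrow> complex" where
  "tau T t =
     (THE g. \<exists>b. (b, g) \<in> rigid_motions \<and>
        carries T (b, g) (tile_patch T (proto T t)) (tile_patch T t))"

definition lies_left :: "('l, 'm) marked_tiling_scheme \<Rightarrow> complex set \<Rightarrow> complex set \<Rightarrow> bool" where
  "lies_left T e t \<longleftrightarrow> t \<in> tiles T \<and> e \<subseteq> t \<and>
     (\<forall>x\<in>rel_interior e. \<exists>\<delta>>0. \<forall>s\<in>{0<..<\<delta>}.
        x + of_real s * (\<i> * (head T e - tail T e)) \<in> t)"

definition lies_right :: "('l, 'm) marked_tiling_scheme \<Rightarrow> complex set \<Rightarrow> complex set \<Rightarrow> bool" where
  "lies_right T e t \<longleftrightarrow> t \<in> tiles T \<and> e \<subseteq> t \<and>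
     (\<forall>x\<in>rel_interior e. \<exists>\<delta>>0. \<forall>s\<in>{0<..<\<delta>}.
        x - of_real s * (\<i> * (head T e - tail T e)) \<in> t)"

definition left_tile :: "('l, 'm) marked_tiling_scheme \<Rightarrow> complex set \<Rightarrow> complex set" where
  "left_tile T e = (THE t. lies_left T e t)"

definition right_tile :: "('l, 'm) marked_tiling_scheme \<Rightarrow> complex set \<Rightarrow> complex set" where
  "right_tile T e = (THE t. lies_right T e t)"

section \<open>ePE chains\<close>

text \<open>Here \<open>c\<close> is the larger cell. An anticlockwise tile induces on a boundary edge the direction
  for which the tile is on the left.\<close>

definition incidence :: "('l, 'm) marked_tiling_scheme \<Rightarrow> complex set \<Rightarrow> complex set \<Rightarrow> int" where
  "incidence T c d =
     (if c \<in> kcells T 1 \<and> d \<in> kcells T 0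
        then of_bool (head T c \<in> d) - of_bool (tail T c \<in> d)
      else if c \<in> kcells T 2 \<and> d \<in> kcells T 1
        then turn T c * (of_bool (lies_left T d c) - of_bool (lies_right T d c))
      else 0)"

definition ePE_chains :: "('l, 'm) tiling_scheme \<Rightarrow> int \<Rightarrow> (complex set \<Rightarrow> int) set" where
  "ePE_chains T k =
     {\<sigma>. (\<forall>c. c \<notin> kcells T k \<longrightarrow> \<sigma> c = 0) \<and>
         (\<exists>r>0. \<forall>c1\<in>kcells T k. \<forall>c2\<in>kcells T k. transports T c1 c2 r \<noteq> {} \<longrightarrow> \<sigma> c1 = \<sigma> c2)}"

definition ePE_boundary ::
    "('l, 'm) marked_tiling_scheme \<Rightarrow> int \<Rightarrow> (complex set \<Rightarrow> int) \<Rightarrow> complex set \<Rightarrow> int" where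
  "ePE_boundary T = cellular_boundary (kcells T) (incidence T)"

abbreviation ePE_homology ::
    "('l, 'm) marked_tiling_scheme \<Rightarrow> int \<Rightarrow> (complex set \<Rightarrow> int) set monoid" where
  "ePE_homology T \<equiv> homology (ePE_chains T) (ePE_boundary T)"

abbreviation ePE_class ::
    "('l, 'm) marked_tiling_scheme \<Rightarrow> int \<Rightarrow> (complex set \<Rightarrow> int) \<Rightarrow> (complex set \<Rightarrow> int) set" where
  "ePE_class T \<equiv> homology_class (ePE_chains T) (ePE_boundary T)"

section \<open>The CW decomposition of the group of rigid motions\<close>

text \<open>The pair \<open>(c, A)\<close> stands for the open cell \<open>rel_interior c \<times> A\<close> over the cell \<open>c\<close>, where \<open>A\<close> is
  a singleton or an open arc of the circle. In \<open>\<plusminus> \<tau>\<^sub>t\<close> the sign denotes the antipode in the circle,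
  which is what makes the decomposition equivariant.\<close>

type_synonym rot_cell = "complex set \<times> complex set"

definition cuts :: "('l, 'm) marked_tiling_scheme \<Rightarrow> complex set \<Rightarrow> complex set" where
  "cuts T c = (\<Union>t\<in>{t \<in> tiles T. c \<subseteq> t}. {tau T t, - tau T t})"

definition arcs :: "('l, 'm) marked_tiling_scheme \<Rightarrow> complex set \<Rightarrow> complex set set" where
  "arcs T c = components (sphere 0 1 - cuts T c)"

definition rot_cells :: "('l, 'm) marked_tiling_scheme \<Rightarrow> int \<Rightarrow> rot_cell set" where
  "rot_cells T n =
     {(c, {g}) |c g. c \<in> kcells T n \<and> g \<in> cuts T c} \<union>
     {(c, I) |c I. c \<in> kcells T (n - 1) \<and> I \<in> arcs T c}"

definition rot_move :: "motion \<Rightarrow> rot_cell \<Rightarrow> rot_cell" where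
  "rot_move \<phi> x = (move \<phi> ` fst x, (\<lambda>g. snd \<phi> * g) ` snd x)"

text \<open>Boundary coefficient of the anticlockwise arc \<open>I\<close> at its terminal (\<open>1\<close>) and initial
  (\<open>- 1\<close>) point.\<close>

definition arc_incidence :: "complex set \<Rightarrow> complex \<Rightarrow> int" where
  "arc_incidence I g =
     of_bool (\<exists>\<delta>>0. \<forall>s\<in>{0<..<\<delta>}. g * cis (- s) \<in> I) -
     of_bool (\<exists>\<delta>>0. \<forall>s\<in>{0<..<\<delta>}. g * cis s \<in> I)"

text \<open>Product orientation: \<open>\<partial>(c \<times> A) = \<partial>c \<times> A + (-1)\<^bsup>dim c\<^esup> c \<times> \<partial>A\<close>. The circle is cut more
  finely over a face \<open>d\<close> of \<open>c\<close> than over \<open>c\<close>, so \<open>d \<times> I\<close> is the sum of the \<open>d \<times> J\<close> for the arcs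
  \<open>J \<subseteq> I\<close> over \<open>d\<close>.\<close>

definition rot_incidence :: "('l, 'm) marked_tiling_scheme \<Rightarrow> rot_cell \<Rightarrow> rot_cell \<Rightarrow> int" where
  "rot_incidence T x y =
     (if fst x \<noteq> fst y then (if snd y \<subseteq> snd x then incidence T (fst x) (fst y) else 0)
      else if is_singleton (snd y)
        then (- 1) ^ nat (aff_dim (fst x)) * arc_incidence (snd x) (the_elem (snd y))
      else 0)"

definition PE_chains :: "('l, 'm) marked_tiling_scheme \<Rightarrow> int \<Rightarrow> (rot_cell \<Rightarrow> int) set" where
  "PE_chains T n =
     {\<psi>. (\<forall>x. x \<notin> rot_cells T n \<longrightarrow> \<psi> x = 0) \<and>
         (\<exists>r>0. \<forall>c1\<in>cells T. \<forall>c2\<in>cells T. \<forall>\<phi>\<in>transports T c1 c2 r.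
            \<forall>x\<in>rot_cells T n. fst x = c1 \<longrightarrow> \<psi> x = \<psi> (rot_move \<phi> x))}"

definition PE_boundary ::
    "('l, 'm) marked_tiling_scheme \<Rightarrow> int \<Rightarrow> (rot_cell \<Rightarrow> int) \<Rightarrow> rot_cell \<Rightarrow> int" where
  "PE_boundary T = cellular_boundary (rot_cells T) (rot_incidence T)"

definition PE_filtration :: "('l, 'm) marked_tiling_scheme \<Rightarrow> int \<Rightarrow> int \<Rightarrow> (rot_cell \<Rightarrow> int) set" where
  "PE_filtration T p n = {\<psi> \<in> PE_chains T n. \<forall>x. \<psi> x \<noteq> 0 \<longrightarrow> aff_dim (fst x) \<le> p}"

abbreviation E_page ::
    "('l, 'm) marked_tiling_scheme \<Rightarrow> int \<Rightarrow> int \<Rightarrow> int \<Rightarrow> (rot_cell \<Rightarrow> int) set monoid" where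
  "E_page T \<equiv> ss_page (PE_filtration T) (PE_boundary T)"

abbreviation E_class ::
    "('l, 'm) marked_tiling_scheme \<Rightarrow> int \<Rightarrow> int \<Rightarrow> int \<Rightarrow> (rot_cell \<Rightarrow> int) \<Rightarrow> (rot_cell \<Rightarrow> int) set" where
  "E_class T \<equiv> ss_class (PE_filtration T) (PE_boundary T)"

abbreviation E_diff ::
    "('l, 'm) marked_tiling_scheme \<Rightarrow> int \<Rightarrow> int \<Rightarrow> int \<Rightarrow> (rot_cell \<Rightarrow> int) set \<Rightarrow> (rot_cell \<Rightarrow> int) set" where
  "E_diff T \<equiv> ss_diff (PE_filtration T) (PE_boundary T)"

section \<open>The isomorphism \<open>F\<^sub>1\<close>\<close>

text \<open>\<open>nu_chain T k \<sigma>\<close> is \<open>\<Sum>\<^sub>c \<sigma>(c) \<nu>\<^sub>c\<close>, with \<open>c\<close> ranging over the \<open>k\<close>-cells.\<close>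

definition nu_chain ::
    "('l, 'm) marked_tiling_scheme \<Rightarrow> int \<Rightarrow> (complex set \<Rightarrow> int) \<Rightarrow> rot_cell \<Rightarrow> int" where
  "nu_chain T k \<sigma> x =
     (if fst x \<in> kcells T k \<and> snd x \<in> arcs T (fst x) then \<sigma> (fst x) else 0)"

definition F1 ::
    "('l, 'm) marked_tiling_scheme \<Rightarrow> int \<Rightarrow> (rot_cell \<Rightarrow> int) set \<Rightarrow> complex set \<Rightarrow> int" where
  "F1 T k X = (THE \<sigma>. \<sigma> \<in> ePE_chains T k \<and> E_class T 1 k 1 (nu_chain T k \<sigma>) = X)"

definition F1_induced ::
    "('l, 'm) marked_tiling_scheme \<Rightarrow> int \<Rightarrow> (rot_cell \<Rightarrow> int) set \<Rightarrow> (complex set \<Rightarrow> int) set" where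
  "F1_induced T k X = the_elem ((\<lambda>z. ePE_class T k (F1 T k (E_class T 1 k 1 z))) ` X)"

section \<open>The winding-number chain\<close>

text \<open>Stars of edges are compared by motions that also match the edges themselves: two tiles may
  share several edges, all with the same star.\<close>

definition edge_angles :: "('l, 'm) marked_tiling_scheme \<Rightarrow> (complex set \<Rightarrow> real) \<Rightarrow> bool" where
  "edge_angles T \<rho> \<longleftrightarrow>
     (\<forall>e\<in>kcells T 1. \<forall>e'\<in>kcells T 1. star_transports T e e' \<noteq> {} \<longrightarrow> \<rho> e' = \<rho> e) \<and>
     (\<forall>e'\<in>kcells T 1. \<exists>e\<in>kcells T 1. star_transports T e e' \<noteq> {} \<and>
        (\<exists>n::int. \<rho> e = Arg2pi (tau T (left_tile T e)) - Arg2pi (tau T (right_tile T e))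
                      + 2 * pi * of_int n))"

definition omega ::
    "('l, 'm) marked_tiling_scheme \<Rightarrow> (complex set \<Rightarrow> real) \<Rightarrow> complex set \<Rightarrow> int" where
  "omega T \<rho> v =
     (if v \<in> kcells T 0
      then THE n. of_int n =
        1 / (2 * pi) * (\<Sum>e | e \<in> kcells T 1 \<and> v \<subseteq> e. (if tail T e \<in> v then 1 else - 1) * \<rho> e)
      else 0)"

end

theory Submission
  imports Defs
begin

text \<open>
The differential is computed on an explicit chain \<open>lifted_plane\<close> that generates \<open>E\<^sup>2\<^bsub>2,0\<^esub>\<close>.

Over a tile \<open>t\<close>, a chain of degree \<open>2\<close> has coefficients at the points \<open>\<plusminus> \<tau>\<^sub>t\<close> of the fibre circle.
Boundaries in the fibre change these coefficients but not their sum, the weight of the chain at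
\<open>t\<close>. If the boundary of the chain vanishes over the edges, then the weights form a cellular
\<open>2\<close>-cycle of the plane: they agree, up to the orientation signs, on tiles that share an edge. The
plane without the vertices is connected, so the weights are an integer multiple of the fundamental
cycle (\<open>weight_constant\<close>), and a chain of weight zero is a boundary up to chains over the edges
(\<open>weightless_in_B_2_0\<close>). Hence \<open>E\<^sup>2\<^bsub>2,0\<^esub>\<close> is infinite cyclic and generated by every lift of the fundamental
cycle.

To lift the fundamental cycle, place each tile \<open>t\<close> at the rotation \<open>\<tau>\<^sub>t\<close>. The tiles to the right and
left of an edge \<open>e\<close> then lie over different points of the circle, and the gap is filled by a path
over \<open>e\<close> that turns by the angle \<open>\<rho>\<^sub>e\<close>. Its coefficient on the arc through \<open>p\<close> is the signed number
\<open>wind e p\<close> of times that the path passes \<open>p\<close>. The boundary of the lift is supported over the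
vertices. If \<open>a\<^sub>t\<close> in \<open>[0, 2\<pi>)\<close> denotes the angle from \<open>p\<close> to \<open>\<tau>\<^sub>t\<close>, then \<open>2\<pi>\<close> times \<open>wind e p\<close> is
\<open>\<rho>\<^sub>e + a\<^sub>r - a\<^sub>l\<close>, where \<open>r\<close> and \<open>l\<close> are the right and the left tile of \<open>e\<close>. In the signed sum over
the edges at a vertex \<open>v\<close> the angles telescope around \<open>v\<close>, and up to sign \<open>\<omega>(v)\<close> remains, whatever
\<open>p\<close> is (\<open>sum_wind_around_vertex\<close>). So, for the right choice of the overall sign, the boundary of the
lift is the sum of the \<open>\<omega>(v) \<nu>\<^sub>v\<close> (\<open>boundary_lifted_plane\<close>), which \<open>F\<^sub>1\<close> sends to \<open>\<omega>\<close>. That \<open>F\<^sub>1\<close> is well defined and induces an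
isomorphism is seen on chains: a chain on a fibre circle with equal coefficients on both sides of
every cut is a multiple of the circle (\<open>nu_chain_if_no_jumps\<close>), so the relevant cycles over vertices
and edges are exactly the \<open>\<nu>\<close>-chains.

Two principles carry the computations with boundaries. The jumps of a piecewise constant function
on a circle add up to zero (\<open>sum_jumps_circle\<close>); this is applied to fibre circles and to small circles
around vertices (\<open>sum_around_vertex\<close>). A motion that matches large patches at a cell matches
patches at all cells around it (\<open>transports_mono\<close>), since the finitely many prototiles have bounded
diameter; this keeps all chains pattern-equivariant. The local structure of the tiling that is used,
local finiteness and the existence of a unique tile on either side of an edge, follows from the
weak topology and from invariance of domain.
\<close>

section \<open>Piecewise constant functions on the circle\<close>

text \<open>Removing the last jump point \<open>m\<close> splits the interval at a point shortly before \<open>m\<close>, where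
  the value is the left limit at \<open>m\<close>. The differences telescope.\<close>

lemma sum_jumps_interval:
  fixes F :: "real \<Rightarrow> 'a::ab_group_add"
  assumes "finite S" and "S \<subseteq> {a<..<b}" and "a \<le> b"
    and const: "\<And>x y. a \<le> x \<Longrightarrow> x \<le> y \<Longrightarrow> y \<le> b \<Longrightarrow> {x..y} \<inter> S = {} \<Longrightarrow> F x = F y"
    and right: "\<And>s. s \<in> S \<Longrightarrow> \<forall>\<^sub>F h in at_right 0. F (s + h) = R s"
    and left: "\<And>s. s \<in> S \<Longrightarrow> \<forall>\<^sub>F h in at_right 0. F (s - h) = L s"
  shows "(\<Sum>s\<in>S. R s - L s) = F b - F a"
  using assms
proof (induction S arbitrary: b rule: finite_linorder_max_induct)
  case empty
  have "F a = F b" using empty.prems(3)[of a b] empty.prems(2) by auto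
  then show ?case by simp
next
  case (insert m S)
  have m: "a < m" "m < b" using insert.prems by auto
  have fin: "finite (insert a S)" using insert.hyps by simp
  \<comment> \<open>the last jump point before \<open>m\<close>, or the left end if there is none\<close>
  define c0 where "c0 = Max (insert a S)"
  have c0: "c0 < m" "\<And>s. s \<in> S \<Longrightarrow> s \<le> c0" "a \<le> c0"
    using fin insert.hyps m by (auto simp: c0_def)
  have "\<forall>\<^sub>F h in at_right 0. F (m - h) = L m" using insert.prems by auto
  moreover have "\<forall>\<^sub>F h in at_right 0. h < m - c0"
    using c0 by (intro eventually_at_rightI[of 0 "m - c0"]) auto
  moreover have "\<forall>\<^sub>F h in at_right 0. (h::real) > 0" by (simp add: eventually_at_right_less)
  ultimately have "\<forall>\<^sub>F h in at_right 0. F (m - h) = L m \<and> h < m - c0 \<and> h > 0"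
    by eventually_elim auto
  then obtain h where h: "F (m - h) = L m" "h < m - c0" "h > 0"
    using eventually_happens' by (metis (mono_tags, lifting) trivial_limit_at_right_real)
  define c where "c = m - h"
  have c: "c0 < c" "c < m" using h by (auto simp: c_def)
  have "\<forall>\<^sub>F h in at_right 0. F (m + h) = R m" using insert.prems by auto
  moreover have "\<forall>\<^sub>F h in at_right 0. h < b - m"
    using m by (intro eventually_at_rightI[of 0 "b - m"]) auto
  moreover have "\<forall>\<^sub>F h in at_right 0. (h::real) > 0" by (simp add: eventually_at_right_less)
  ultimately have "\<forall>\<^sub>F h in at_right 0. F (m + h) = R m \<and> h < b - m \<and> h > 0"
    by eventually_elim auto
  then obtain k where k: "F (m + k) = R m" "k < b - m" "k > 0"
    using eventually_happens' by (metis (mono_tags, lifting) trivial_limit_at_right_real)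
  have "(\<Sum>s\<in>S. R s - L s) = F c - F a"
  proof (rule insert.IH)
    show "S \<subseteq> {a<..<c}" using insert.prems(1) c0 c by fastforce
    show "a \<le> c" using c0 c by simp
    fix x y assume xy: "a \<le> x" "x \<le> y" "y \<le> c" "{x..y} \<inter> S = {}"
    then show "F x = F y" using insert.prems(3)[of x y] c m by auto
  next
    fix s assume "s \<in> S"
    then show "\<forall>\<^sub>F h in at_right 0. F (s + h) = R s" "\<forall>\<^sub>F h in at_right 0. F (s - h) = L s"
      using insert.prems by auto
  qed
  moreover have "F (m + k) = F b"
  proof (rule insert.prems(3))
    show "{m + k..b} \<inter> insert m S = {}" using c0 k by (fastforce)
  qed (use m k in auto)
  moreover have "m \<notin> S" using insert.hyps by auto
  ultimately show ?case using insert.hyps h k by (simp add: c_def)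
qed

definition arc_at :: "complex set \<Rightarrow> complex \<Rightarrow> complex set" where
  "arc_at K p = connected_component_set (sphere 0 1 - K) p"

lemma arcs_eq: "arcs T c = arc_at (cuts T c) ` (sphere 0 1 - cuts T c)"
  by (auto simp: arcs_def components_def arc_at_def)

lemma arc_at_refl: "p \<in> sphere 0 1 - K \<Longrightarrow> p \<in> arc_at K p"
  by (simp add: arc_at_def connected_component_refl)

lemma arc_at_subset: "arc_at K p \<subseteq> sphere 0 1 - K"
  unfolding arc_at_def by (rule connected_component_subset)

lemma arc_at_eq: "q \<in> arc_at K p \<Longrightarrow> arc_at K q = arc_at K p"
  unfolding arc_at_def by (metis connected_component_eq)

lemma arc_at_connected: "connected (arc_at K p)"
  unfolding arc_at_def by simp

lemma arc_at_maximal: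
  "connected S \<Longrightarrow> S \<subseteq> sphere 0 1 - K \<Longrightarrow> p \<in> S \<Longrightarrow> q \<in> S \<Longrightarrow> arc_at K p = arc_at K q"
  by (metis arc_at_def arc_at_eq connected_component_maximal subsetD)

lemma arc_at_mono: "K \<subseteq> K' \<Longrightarrow> arc_at K' p \<subseteq> arc_at K p"
  unfolding arc_at_def by (intro connected_component_mono) auto

text \<open>The circles over the faces of a cell are cut more finely. This finds the arc of the coarser
  subdivision that contains a given arc of the finer one.\<close>

lemma arc_at_superset_iff:
  assumes "K \<subseteq> K'" "p \<in> sphere 0 1 - K'" "q \<in> sphere 0 1 - K"
  shows "arc_at K' p \<subseteq> arc_at K q \<longleftrightarrow> arc_at K q = arc_at K p"
  using assms arc_at_mono[OF assms(1)] arc_at_refl[OF assms(2)] arc_at_eq by blast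

lemma arc_at_not_singleton:
  assumes "finite K" "p \<in> sphere 0 1 - K"
  shows "\<not> is_singleton (arc_at K p)"
proof
  assume "is_singleton (arc_at K p)"
  then have p: "arc_at K p = {p}" using arc_at_refl[OF assms(2)] by (metis is_singleton_def singletonD)
  have "((\<lambda>s. p * cis s) \<longlongrightarrow> p * cis 0) (at_right (0::real))"
    unfolding cis_conv_exp by (intro tendsto_intros) 
  moreover have "open (- K)" using assms by (simp add: finite_imp_closed open_Compl)
  ultimately have "\<forall>\<^sub>F s in at_right (0::real). p * cis s \<in> - K"
    using assms by (intro topological_tendstoD) auto
  then obtain d where d: "d > 0" "\<And>s. 0 < s \<Longrightarrow> s < d \<Longrightarrow> p * cis s \<notin> K"
    unfolding eventually_at_right[OF zero_less_one] by auto
  define e where "e = min d pi"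
  have e: "0 < e" "e \<le> d" "e \<le> pi" using d by (auto simp: e_def)
  define S where "S = (\<lambda>s. p * cis s) ` {0..<e}"
  have "connected S" unfolding S_def cis_conv_exp
    by (intro connected_continuous_image continuous_intros) auto
  moreover have "S \<subseteq> sphere 0 1 - K"
  proof
    fix x assume "x \<in> S"
    then obtain s where s: "x = p * cis s" "s \<in> {0..<e}" unfolding S_def by blast
    then show "x \<in> sphere 0 1 - K" using d e assms by (cases "s = 0") (auto simp: norm_mult)
  qed
  moreover have "p \<in> S" unfolding S_def using e by (intro image_eqI[of _ _ 0]) auto
  ultimately have "S \<subseteq> arc_at K p" unfolding arc_at_def by (intro connected_component_maximal)
  moreover have "p * cis (e/2) \<in> S" using e by (auto simp: S_def)
  ultimately have "p * cis (e/2) = p" using p by auto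
  then have "cis (e/2) = 1" using assms by auto
  then have "sin (e/2) = 0" by (metis Im_complex_of_real cis.sel(2) of_real_1)
  then show False using e sin_gt_zero[of "e/2"] by auto
qed

text \<open>The arc that contains the points just after \<open>g\<close> (for \<open>\<sigma> = 1\<close>) or just before \<open>g\<close> (for
  \<open>\<sigma> = - 1\<close>); \<open>g\<close> need not be a cut point.\<close>

definition arc_beside :: "real \<Rightarrow> complex set \<Rightarrow> complex \<Rightarrow> complex set" where
  "arc_beside \<sigma> K g = (THE I. \<forall>\<^sub>F s in at_right 0. arc_at K (g * cis (\<sigma> * s)) = I)"

lemma eventually_avoids:
  assumes "finite K" "g \<noteq> 0" "\<sigma> = 1 \<or> \<sigma> = - 1"
  shows "\<forall>\<^sub>F s in at_right (0::real). g * cis (\<sigma> * s) \<notin> K"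
proof -
  have "((\<lambda>s. g * cis (\<sigma> * s)) \<longlongrightarrow> g * cis (\<sigma> * 0)) (at_right (0::real))"
    unfolding cis_conv_exp by (intro tendsto_intros) 
  moreover have "open (- (K - {g}))" using assms by (metis finite_Diff finite_imp_closed open_Compl)
  ultimately have 1: "\<forall>\<^sub>F s in at_right (0::real). g * cis (\<sigma> * s) \<in> - (K - {g})"
    by (intro topological_tendstoD) auto
  have 2: "\<forall>\<^sub>F s in at_right 0. 0 < s \<and> s < pi"
    by (intro eventually_at_rightI[of 0 pi]) auto
  show ?thesis using 1 2
  proof eventually_elim
    case (elim s)
    have "g * cis (\<sigma> * s) \<noteq> g"
    proof
      assume "g * cis (\<sigma> * s) = g"
      then have "cis (\<sigma> * s) = 1" using assms by auto
      then have "sin (\<sigma> * s) = 0" by (metis Im_complex_of_real cis.sel(2) of_real_1)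
      then have "sin s = 0" using assms by auto
      then show False using elim sin_gt_zero[of s] by auto
    qed
    then show ?case using elim by auto
  qed
qed

lemma eventually_arc_beside:
  assumes "finite K" "norm g = 1" "\<sigma> = 1 \<or> \<sigma> = - 1"
  shows "\<forall>\<^sub>F s in at_right (0::real).
    g * cis (\<sigma> * s) \<in> sphere 0 1 - K \<and> arc_at K (g * cis (\<sigma> * s)) = arc_beside \<sigma> K g"
proof -
  have "g \<noteq> 0" using assms by auto
  then obtain d where d: "d > 0" "\<And>s. 0 < s \<Longrightarrow> s < d \<Longrightarrow> g * cis (\<sigma> * s) \<notin> K"
    using eventually_avoids[OF assms(1) _ assms(3)]
    unfolding eventually_at_right[OF zero_less_one] by auto
  define S where "S = (\<lambda>s. g * cis (\<sigma> * s)) ` {0<..<d}"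
  have con: "connected S" unfolding S_def cis_conv_exp
    by (intro connected_continuous_image continuous_intros) auto
  have sub: "S \<subseteq> sphere 0 1 - K"
    using d assms by (auto simp: S_def norm_mult)
  define I where "I = arc_at K (g * cis (\<sigma> * (d / 2)))"
  have "g * cis (\<sigma> * (d / 2)) \<in> S" unfolding S_def using d by (intro image_eqI[of _ _ "d / 2"]) auto
  then have I: "arc_at K q = I" if "q \<in> S" for q
    unfolding I_def using arc_at_maximal[OF con sub that] by auto
  have ev: "\<forall>\<^sub>F s in at_right 0. g * cis (\<sigma> * s) \<in> S"
    using d by (intro eventually_at_rightI[of 0 d]) (auto simp: S_def)
  then have evI: "\<forall>\<^sub>F s in at_right 0. arc_at K (g * cis (\<sigma> * s)) = I"
    by eventually_elim (rule I)
  have besI: "arc_beside \<sigma> K g = I" unfolding arc_beside_def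
  proof (rule the_equality)
    show "\<forall>\<^sub>F s in at_right 0. arc_at K (g * cis (\<sigma> * s)) = I" by (rule evI)
    fix J assume "\<forall>\<^sub>F s in at_right 0. arc_at K (g * cis (\<sigma> * s)) = J"
    with evI have "\<forall>\<^sub>F s in at_right (0::real). J = I" by eventually_elim auto
    then show "J = I" by simp
  qed
  show ?thesis using ev
  proof eventually_elim
    case (elim s)
    then show ?case using I[OF elim] sub besI by auto
  qed
qed

lemma obtain_beside:
  assumes "finite K" "norm g = 1" "\<sigma> = 1 \<or> \<sigma> = - 1" "\<forall>\<^sub>F s in at_right (0::real). P s"
  obtains s where "g * cis (\<sigma> * s) \<in> sphere 0 1 - K" "arc_at K (g * cis (\<sigma> * s)) = arc_beside \<sigma> K g"
    "s > 0" "P s"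
proof -
  have "\<forall>\<^sub>F s in at_right 0. (s::real) > 0" by (simp add: eventually_at_right_less)
  with eventually_arc_beside[OF assms(1-3)] assms(4)
  have "\<forall>\<^sub>F s in at_right 0. g * cis (\<sigma> * s) \<in> sphere 0 1 - K \<and>
      arc_at K (g * cis (\<sigma> * s)) = arc_beside \<sigma> K g \<and> s > 0 \<and> P s"
    by eventually_elim auto
  then show ?thesis using that eventually_happens' by (metis (mono_tags, lifting) trivial_limit_at_right_real)
qed

lemma arc_beside_in:
  assumes "finite K" "norm g = 1" "\<sigma> = 1 \<or> \<sigma> = - 1"
  shows "arc_beside \<sigma> K g \<in> arc_at K ` (sphere 0 1 - K)"
  using obtain_beside[OF assms, of "\<lambda>_. True"] by (metis eventually_True image_eqI)

lemma arc_beside_no_cut: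
  assumes "finite K" "norm g = 1" "\<sigma> = 1 \<or> \<sigma> = - 1" "g \<notin> K"
  shows "arc_beside \<sigma> K g = arc_at K g"
proof -
  have "g \<noteq> 0" using assms by auto
  then obtain d where d: "d > 0" "\<And>s. 0 < s \<Longrightarrow> s < d \<Longrightarrow> g * cis (\<sigma> * s) \<notin> K"
    using eventually_avoids[OF assms(1) _ assms(3)]
    unfolding eventually_at_right[OF zero_less_one] by auto
  define S where "S = (\<lambda>s. g * cis (\<sigma> * s)) ` {0..<d}"
  have con: "connected S" unfolding S_def cis_conv_exp
    by (intro connected_continuous_image continuous_intros) auto
  have sub: "S \<subseteq> sphere 0 1 - K"
  proof
    fix x assume "x \<in> S"
    then obtain s where s: "x = g * cis (\<sigma> * s)" "s \<in> {0..<d}" unfolding S_def by blast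
    then show "x \<in> sphere 0 1 - K" using d assms by (cases "s = 0") (auto simp: norm_mult)
  qed
  have "g \<in> S" unfolding S_def using d by (intro image_eqI[of _ _ 0]) auto
  then have I: "arc_at K q = arc_at K g" if "q \<in> S" for q
    using arc_at_maximal[OF con sub that] by auto
  have "\<forall>\<^sub>F s in at_right 0. g * cis (\<sigma> * s) \<in> S"
    using d by (intro eventually_at_rightI[of 0 d]) (auto simp: S_def)
  from obtain_beside[OF assms(1-3) this] I show ?thesis by metis
qed

text \<open>The boundary coefficient of an arc in terms of the two arcs that meet at \<open>g\<close>. They may coincide,
  and then both sides vanish.\<close>

lemma arc_incidence_beside:
  assumes K: "finite K" "norm g = 1" and I: "I \<in> arc_at K ` (sphere 0 1 - K)"
  shows "arc_incidence I g = of_bool (I = arc_beside (- 1) K g) - of_bool (I = arc_beside 1 K g)"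
proof -
  have "(\<exists>\<delta>>0. \<forall>s\<in>{0<..<\<delta>}. g * cis (\<sigma> * s) \<in> I) \<longleftrightarrow> I = arc_beside \<sigma> K g"
    (is "?L \<longleftrightarrow> ?R") if \<sigma>: "\<sigma> = 1 \<or> \<sigma> = - 1" for \<sigma> :: real
  proof
    assume ?L
    then have "\<forall>\<^sub>F s in at_right 0. g * cis (\<sigma> * s) \<in> I"
      unfolding eventually_at_right[OF zero_less_one] by auto
    from obtain_beside[OF K \<sigma> this] obtain s where
      "arc_at K (g * cis (\<sigma> * s)) = arc_beside \<sigma> K g" "g * cis (\<sigma> * s) \<in> I" by metis
    then show ?R using I arc_at_eq by blast
  next
    assume R: ?R
    have "\<forall>\<^sub>F s in at_right 0. g * cis (\<sigma> * s) \<in> I"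
      using eventually_arc_beside[OF K \<sigma>] by eventually_elim (use R arc_at_refl in auto)
    then show ?L unfolding eventually_at_right[OF zero_less_one] by auto
  qed
  from this[of 1] this[of "- 1"] show ?thesis unfolding arc_incidence_def by simp
qed

lemma finite_cut_points_between:
  assumes "finite K" "b \<le> a + 2 * pi"
  shows "finite {t \<in> {a<..<b}. cis t \<in> K}" and "inj_on cis {t \<in> {a<..<b}. cis t \<in> K}"
proof -
  show inj: "inj_on cis {t \<in> {a<..<b}. cis t \<in> K}"
  proof (rule inj_onI)
    fix x y assume *: "x \<in> {t \<in> {a<..<b}. cis t \<in> K}" "y \<in> {t \<in> {a<..<b}. cis t \<in> K}" "cis x = cis y"
    then have "cos x = cos y" "sin x = sin y" by (auto simp: complex_eq_iff)
    then obtain n :: int where n: "x = y + 2 * pi * of_int n" using sin_cos_eq_iff by metis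
    have "\<bar>x - y\<bar> < 2 * pi" using * assms by auto
    then have "\<bar>of_int n::real\<bar> < 1" using n by (simp add: abs_mult)
    then have "n = 0" by linarith
    then show "x = y" using n by simp
  qed
  show "finite {t \<in> {a<..<b}. cis t \<in> K}"
    by (rule inj_on_finite[OF inj _ assms(1)]) auto
qed

lemma cis_lift:
  assumes "norm q = 1" "q \<noteq> cis a"
  obtains b where "a < b" "b < a + 2 * pi" "q = cis b"
proof -
  define x where "x = Arg2pi (q / cis a)"
  have "q / cis a = cis x" using complex_norm_eq_1_exp[of "q / cis a"] assms
    by (auto simp: x_def norm_divide cis_conv_exp mult.commute)
  then have q: "q = cis (a + x)" by (simp add: field_simps cis_mult)
  have "0 \<le> x" "x < 2 * pi" using Arg2pi by (auto simp: x_def)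
  moreover have "x \<noteq> 0" using q assms by auto
  ultimately show ?thesis using that[of "a + x"] q by auto
qed

lemma sum_jumps_between:
  fixes f :: "complex \<Rightarrow> 'a::ab_group_add"
  assumes K: "finite K" and const: "\<And>p q. p \<in> sphere 0 1 - K \<Longrightarrow> q \<in> arc_at K p \<Longrightarrow> f q = f p"
    and right: "\<And>g. g \<in> K \<Longrightarrow> \<forall>\<^sub>F s in at_right 0. f (g * cis s) = R g"
    and left: "\<And>g. g \<in> K \<Longrightarrow> \<forall>\<^sub>F s in at_right 0. f (g * cis (- s)) = L g"
    and ab: "a \<le> b" "b \<le> a + 2 * pi" "cis a \<notin> K" "cis b \<notin> K"
  shows "(\<Sum>g\<in>cis ` {t \<in> {a<..<b}. cis t \<in> K}. R g - L g) = f (cis b) - f (cis a)"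
proof -
  define S where "S = {t \<in> {a<..<b}. cis t \<in> K}"
  have S: "finite S" "inj_on cis S" using finite_cut_points_between[OF K ab(2)] by (auto simp: S_def)
  have "(\<Sum>g\<in>cis ` S. R g - L g) = (\<Sum>t\<in>S. R (cis t) - L (cis t))"
    using S by (simp add: sum.reindex)
  also have "\<dots> = f (cis b) - f (cis a)"
  proof (rule sum_jumps_interval[OF S(1) _ ab(1), where F = "\<lambda>t. f (cis t)"])
    show "S \<subseteq> {a<..<b}" by (auto simp: S_def)
  next
    fix x y assume xy: "a \<le> x" "x \<le> y" "y \<le> b" "{x..y} \<inter> S = {}"
    have sub: "cis ` {x..y} \<subseteq> sphere 0 1 - K"
    proof
      fix z assume "z \<in> cis ` {x..y}"
      then obtain t where t: "z = cis t" "x \<le> t" "t \<le> y" by auto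
      then have "t \<notin> S" using xy by auto
      then have "cis t \<notin> K" using t xy ab by (cases "t = a \<or> t = b") (auto simp: S_def)
      then show "z \<in> sphere 0 1 - K" using t by simp
    qed
    have con: "connected (cis ` {x..y})"
      unfolding cis_conv_exp by (intro connected_continuous_image continuous_intros) auto
    have "arc_at K (cis x) = arc_at K (cis y)"
      by (rule arc_at_maximal[OF con sub]) (use xy in auto)
    moreover have p: "cis x \<in> sphere 0 1 - K" "cis y \<in> sphere 0 1 - K" using sub xy unfolding image_subset_iff by auto
    ultimately have "cis x \<in> arc_at K (cis y)" using arc_at_refl by metis
    from const[OF p(2) this] show "f (cis x) = f (cis y)" .
  next
    fix s assume s: "s \<in> S"
    then show "\<forall>\<^sub>F h in at_right 0. f (cis (s + h)) = R (cis s)"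
      using right[of "cis s"] by (simp add: S_def cis_mult)
    show "\<forall>\<^sub>F h in at_right 0. f (cis (s - h)) = L (cis s)"
      using left[of "cis s"] s by (simp add: S_def cis_mult del: cis_cnj)
  qed
  finally show ?thesis by (simp add: S_def)
qed

text \<open>Walking once around the circle, the jumps of a piecewise constant function cancel. This one
  fact shows that the boundary of a chain on a fibre circle has total weight zero and, applied to a
  small circle around a vertex, that the cellular boundary of the tiling squares to zero.\<close>

lemma sum_jumps_circle:
  fixes f :: "complex \<Rightarrow> 'a::ab_group_add"
  assumes K: "finite K" "K \<subseteq> sphere 0 1"
    and const: "\<And>p q. p \<in> sphere 0 1 - K \<Longrightarrow> q \<in> arc_at K p \<Longrightarrow> f q = f p"
    and right: "\<And>g. g \<in> K \<Longrightarrow> \<forall>\<^sub>F s in at_right 0. f (g * cis s) = R g"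
    and left: "\<And>g. g \<in> K \<Longrightarrow> \<forall>\<^sub>F s in at_right 0. f (g * cis (- s)) = L g"
  shows "(\<Sum>g\<in>K. R g - L g) = 0"
proof -
  obtain s where "1 * cis (1 * s) \<in> sphere 0 1 - K"
    using obtain_beside[OF K(1), of 1 1 "\<lambda>_. True"] by auto
  then have s: "cis s \<notin> K" by auto
  have "K \<subseteq> cis ` {t \<in> {s<..<s + 2 * pi}. cis t \<in> K}"
  proof
    fix g assume g: "g \<in> K"
    then have "norm g = 1" "g \<noteq> cis s" using s K by auto
    then obtain b where "s < b" "b < s + 2 * pi" "g = cis b" by (rule cis_lift)
    then show "g \<in> cis ` {t \<in> {s<..<s + 2 * pi}. cis t \<in> K}" using g by auto
  qed
  then have "K = cis ` {t \<in> {s<..<s + 2 * pi}. cis t \<in> K}" by auto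
  moreover have "cis (s + 2 * pi) = cis s" by (simp flip: cis_mult)
  ultimately show ?thesis
    using sum_jumps_between[OF K(1) const right left, of s "s + 2 * pi"] s by simp
qed

text \<open>Here the jumps telescope along the arc from \<open>p\<close> to \<open>q\<close>.\<close>

lemma constant_if_no_jumps:
  fixes f :: "complex \<Rightarrow> 'a::ab_group_add"
  assumes K: "finite K"
    and const: "\<And>p q. p \<in> sphere 0 1 - K \<Longrightarrow> q \<in> arc_at K p \<Longrightarrow> f q = f p"
    and right: "\<And>g. g \<in> K \<Longrightarrow> \<forall>\<^sub>F s in at_right 0. f (g * cis s) = R g"
    and left: "\<And>g. g \<in> K \<Longrightarrow> \<forall>\<^sub>F s in at_right 0. f (g * cis (- s)) = R g"
    and pq: "p \<in> sphere 0 1 - K" "q \<in> sphere 0 1 - K"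
  shows "f p = f q"
proof (cases "p = q")
  case False
  define a where "a = Arg2pi p"
  have a: "p = cis a" using pq(1) complex_norm_eq_1_exp[of p] by (auto simp: a_def cis_conv_exp)
  obtain b where "a < b" "b < a + 2 * pi" "q = cis b" using cis_lift[of q a] pq False a by auto
  then show ?thesis
    using sum_jumps_between[OF K const right left, of a b] a pq by simp
qed simp

lemma arc_at_rotate:
  assumes "norm (g::complex) = 1" "p \<in> sphere 0 1 - K"
  shows "arc_at ((*) g ` K) (g * p) = (*) g ` arc_at K p"
proof -
  have g0: "g \<noteq> 0" using assms by auto
  have sub: "(*) g ` arc_at K p \<subseteq> arc_at ((*) g ` K) (g * p)" if "norm g = 1" "p \<in> sphere 0 1 - K" for g K p
  proof -
    have "g \<noteq> 0" using that by auto
    then show ?thesis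
    unfolding arc_at_def
    by (intro connected_component_maximal connected_continuous_image continuous_intros)
       (use that arc_at_subset[of K p] arc_at_refl[of p K] in \<open>auto simp: arc_at_def norm_mult\<close>)
  qed
  have "(*) (1/g) ` arc_at ((*) g ` K) (g * p) \<subseteq> arc_at ((*) (1/g) ` (*) g ` K) (1/g * (g * p))"
    by (rule sub) (use assms g0 in \<open>auto simp: norm_divide norm_mult\<close>)
  then have "(*) (1/g) ` arc_at ((*) g ` K) (g * p) \<subseteq> arc_at K p"
    using g0 by (simp add: image_image)
  then have "(*) g ` (*) (1/g) ` arc_at ((*) g ` K) (g * p) \<subseteq> (*) g ` arc_at K p" by (rule image_mono)
  then have "arc_at ((*) g ` K) (g * p) \<subseteq> (*) g ` arc_at K p" using g0 by (simp add: image_image)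
  with sub[OF assms] show ?thesis by auto
qed

lemma arc_beside_rotate:
  assumes "norm g = 1" "finite K" "norm h = 1" "\<sigma> = 1 \<or> \<sigma> = - 1"
  shows "arc_beside \<sigma> ((*) g ` K) (g * h) = (*) g ` arc_beside \<sigma> K h"
proof -
  have "norm (g * h) = 1" using assms by (simp add: norm_mult)
  from obtain_beside[OF finite_imageI[OF assms(2)] this assms(4) eventually_arc_beside[OF assms(2-4)]]
  obtain s where "arc_at ((*) g ` K) (g * h * cis (\<sigma> * s)) = arc_beside \<sigma> ((*) g ` K) (g * h)"
    "h * cis (\<sigma> * s) \<in> sphere 0 1 - K \<and> arc_at K (h * cis (\<sigma> * s)) = arc_beside \<sigma> K h" by metis
  then show ?thesis using arc_at_rotate[OF assms(1), of "h * cis (\<sigma> * s)" K] by (simp add: mult.assoc)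
qed

text \<open>Chains on a fibre circle are written down as functions of a point that are constant on arcs.
  This is the value of such a function on an arc.\<close>

definition on_arc :: "(complex \<Rightarrow> 'a) \<Rightarrow> complex set \<Rightarrow> 'a" where
  "on_arc h I = h (SOME p. p \<in> I)"

lemma on_arc_eq:
  assumes "p \<in> I" "\<And>p q. p \<in> I \<Longrightarrow> q \<in> I \<Longrightarrow> h p = h q"
  shows "on_arc h I = h p"
  unfolding on_arc_def by (metis assms someI_ex)

section \<open>Local structure of a tiling\<close>

locale oriented_tiling =
  fixes T :: "'l marked_tiling"
  assumes tiling: "polytopal_tiling T" and oriented: "consistently_oriented T"
begin

lemmas tiling_parts = tiling[unfolded polytopal_tiling_def]

lemma cell_polytopal: "c \<in> cells T \<Longrightarrow> polytopal_cell c"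
  by (rule bspec[OF conjunct1[OF tiling_parts]])

lemma cell_faces:
  "c \<in> cells T \<Longrightarrow> \<exists>F\<subseteq>cells T. finite F \<and> (\<forall>d\<in>F. aff_dim d < aff_dim c) \<and> rel_frontier c = \<Union>F"
  by (rule bspec[OF conjunct1[OF conjunct2[OF conjunct2[OF conjunct2[OF tiling_parts]]]]])

lemma weak_topology: "(\<And>c. c \<in> cells T \<Longrightarrow> closed (A \<inter> c)) \<Longrightarrow> closed A"
  by (rule spec[OF conjunct2[OF conjunct2[OF conjunct2[OF conjunct2[OF tiling_parts]]]], THEN mp]) (rule ballI)

lemma cell_compact:
  assumes "c \<in> cells T" shows "compact c"
proof -
  have "polytopal_cell c" by (rule cell_polytopal[OF assms])
  then obtain P where "finite P" "\<forall>p\<in>P. polytope p" "c = \<Union>P" unfolding polytopal_cell_def by blast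
  then show ?thesis by (metis compact_Union polytope_imp_compact)
qed

lemma cell_closed: "c \<in> cells T \<Longrightarrow> closed c"
  by (simp add: cell_compact compact_imp_closed)

lemma cell_dim_cases:
  assumes "c \<in> cells T"
  obtains "c \<in> kcells T 0" | "c \<in> kcells T 1" | "c \<in> tiles T"
proof -
  have "polytopal_cell c" by (rule cell_polytopal[OF assms])
  then obtain S :: "complex set" where "int (dim S) = aff_dim c" unfolding polytopal_cell_def by blast
  moreover have "dim S \<le> 2" using dim_subset_UNIV[of S] by simp
  ultimately have "aff_dim c = 0 \<or> aff_dim c = 1 \<or> aff_dim c = 2" by linarith
  then show ?thesis using that assms by (auto simp: kcells_def)
qed

lemma kcells_cells: "c \<in> kcells T k \<Longrightarrow> c \<in> cells T"
  by (simp add: kcells_def)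

lemma vertex_point:
  assumes "v \<in> kcells T 0" obtains w where "v = {w}"
  using assms aff_dim_eq_0[of v] by (auto simp: kcells_def)

lemma edge_segment:
  assumes "e \<in> kcells T 1"
  shows "e = closed_segment (tail T e) (head T e)" "tail T e \<noteq> head T e"
    "rel_interior e = open_segment (tail T e) (head T e)"
proof -
  show 1: "e = closed_segment (tail T e) (head T e)"
    using oriented unfolding consistently_oriented_def by (elim conjE) (erule bspec[OF _ assms])
  have "aff_dim e = 1" using assms by (simp add: kcells_def)
  then have "aff_dim (closed_segment (tail T e) (head T e)) = 1" by (rule trans[OF arg_cong[OF 1[symmetric]]])
  then show 2: "tail T e \<noteq> head T e" by auto
  have "rel_interior (closed_segment (tail T e) (head T e)) = open_segment (tail T e) (head T e)"
    using 2 rel_interior_closed_segment[of "tail T e" "head T e"] by simp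
  then show "rel_interior e = open_segment (tail T e) (head T e)"
    by (rule trans[OF arg_cong[OF 1]])
qed

lemma in_edge_iff: "e \<in> kcells T 1 \<Longrightarrow> x \<in> e \<longleftrightarrow> x \<in> closed_segment (tail T e) (head T e)"
  by (rule arg_cong[OF edge_segment(1)])

text \<open>A homeomorphism from the disc onto a tile maps the open disc to an open set by invariance of
  domain. So a tile has no dangling parts.\<close>

lemma tile_closure_interior:
  assumes "t \<in> tiles T"
  shows "closure (interior t) = t" "rel_interior t = interior t" "interior t \<noteq> {}"
proof -
  have t: "t \<in> cells T" "aff_dim t = 2" using assms by (auto simp: kcells_def)
  then have "polytopal_cell t" by (intro cell_polytopal)
  then obtain S :: "complex set" where S: "subspace S" "int (dim S) = 2" "t homeomorphic (cball 0 1 \<inter> S)"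
    unfolding polytopal_cell_def t(2) by (elim conjE exE)
  then have "S = UNIV" using dim_eq_full[of S] span_eq_iff[of S] by simp
  then have "cball (0::complex) 1 homeomorphic t" using S(3) homeomorphic_sym[of t] by (metis inf_top_right)
  then obtain h k where h: "homeomorphism (cball (0::complex) 1) t h k" unfolding homeomorphic_def by blast
  have cont: "continuous_on (cball 0 1) h" and im: "h ` cball 0 1 = t" and inj: "inj_on h (cball 0 1)"
    using h by (auto simp: homeomorphism_def intro: inj_on_inverseI)
  have op: "open (h ` ball 0 1)"
    by (rule invariance_of_domain)
       (use cont inj in \<open>auto intro: continuous_on_subset inj_on_subset[OF _ ball_subset_cball]\<close>)
  have "h ` ball 0 1 \<subseteq> t" using im by auto
  then have "h ` ball 0 1 \<subseteq> interior t" using op by (simp add: interior_maximal)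
  moreover have "t \<subseteq> closure (h ` ball 0 1)"
    using continuous_image_closure_subset[OF cont, of "ball 0 1"] im by simp
  ultimately have "t \<subseteq> closure (interior t)" using closure_mono by blast
  moreover have "closure (interior t) \<subseteq> t"
    using cell_closed[OF t(1)] by (simp add: closure_minimal interior_subset)
  ultimately show cl: "closure (interior t) = t" by blast
  have "affine hull t = UNIV" using t aff_dim_eq_full[of t] by simp
  then show "rel_interior t = interior t" by (rule rel_interior_interior)
  show "interior t \<noteq> {}" using cl t aff_dim_empty by fastforce
qed

lemma cell_subset_closure:
  assumes "c \<in> cells T" shows "c \<subseteq> closure (rel_interior c)"
  using assms
proof (cases rule: cell_dim_cases)
  case 1
  then show ?thesis by (metis vertex_point closure_subset rel_interior_sing)
next
  case 2
  have "convex e" if "e = closed_segment a b" for e and a b :: complex using that by simp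
  then have "convex c" using edge_segment(1)[OF 2] .
  then show ?thesis using convex_closure_rel_interior closure_subset by blast
next
  case 3
  then show ?thesis using tile_closure_interior by simp
qed

lemma open_cell_nonempty:
  assumes "c \<in> cells T" shows "rel_interior c \<noteq> {}"
proof
  assume "rel_interior c = {}"
  then have "c = {}" using cell_subset_closure[OF assms] by simp
  then have "aff_dim c = - 1" by simp
  with assms show False by (auto elim!: cell_dim_cases simp: kcells_def)
qed

lemma obtain_open_cell: obtains c where "c \<in> cells T" "x \<in> rel_interior c"
proof -
  have "(\<Union>c\<in>cells T. rel_interior c) = UNIV" by (rule conjunct1[OF conjunct2[OF tiling_parts]])
  then show ?thesis using that by blast
qed

lemma open_cells_disjoint:
  assumes "c \<in> cells T" "d \<in> cells T" "x \<in> rel_interior c" "x \<in> rel_interior d"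
  shows "c = d"
proof -
  have "\<forall>c\<in>cells T. \<forall>d\<in>cells T. c \<noteq> d \<longrightarrow> rel_interior c \<inter> rel_interior d = {}"
    by (rule conjunct1[OF conjunct2[OF conjunct2[OF tiling_parts]]])
  then show ?thesis using assms by blast
qed

lemma faces:
  assumes "c \<in> cells T"
  obtains F where "F \<subseteq> cells T" "finite F" "\<forall>d\<in>F. aff_dim d < aff_dim c \<and> d \<subseteq> c"
    "c - rel_interior c = \<Union>F"
proof -
  obtain F where F: "F \<subseteq> cells T" "finite F" "\<forall>d\<in>F. aff_dim d < aff_dim c" "rel_frontier c = \<Union>F"
    using cell_faces[OF assms] by metis
  have "rel_frontier c = c - rel_interior c"
    using cell_closed[OF assms] by (simp add: rel_frontier_def closure_closed)
  then show ?thesis using that F by (metis Diff_subset Union_upper subset_trans)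
qed

text \<open>A point of \<open>d\<close> outside its open cell lies in a proper face of \<open>d\<close>, so descending through the
  faces ends at the cell whose open cell contains the point. Hence closed cells are unions of open
  cells.\<close>

lemma open_cell_meets:
  assumes "c \<in> cells T" "d \<in> cells T" "x \<in> rel_interior c" "x \<in> d"
  shows "c = d \<or> c \<subseteq> d \<and> aff_dim c < aff_dim d"
  using assms
proof (induction "nat (aff_dim d + 1)" arbitrary: d rule: less_induct)
  case less
  show ?case
  proof (cases "x \<in> rel_interior d")
    case True
    then show ?thesis using open_cells_disjoint less.prems by blast
  next
    case False
    obtain F where F: "F \<subseteq> cells T" "\<forall>d'\<in>F. aff_dim d' < aff_dim d \<and> d' \<subseteq> d"
      "d - rel_interior d = \<Union>F" using faces[OF less.prems(2)] by metis
    have "x \<in> d - rel_interior d" using False less.prems by simp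
    then have "x \<in> \<Union>F" unfolding F(3) .
    then obtain d' where d': "d' \<in> F" "x \<in> d'" by blast
    have "nat (aff_dim d' + 1) < nat (aff_dim d + 1)"
      using F d' aff_dim_geq[of d'] by fastforce
    then have "c = d' \<or> c \<subseteq> d' \<and> aff_dim c < aff_dim d'"
      using less.hyps[of d'] less.prems F d' by blast
    then show ?thesis using F d' by fastforce
  qed
qed

lemma finite_subcells:
  assumes "d \<in> cells T" shows "finite {c \<in> cells T. c \<subseteq> d}"
  using assms
proof (induction "nat (aff_dim d + 1)" arbitrary: d rule: less_induct)
  case less
  obtain F where F: "F \<subseteq> cells T" "finite F" "\<forall>d'\<in>F. aff_dim d' < aff_dim d \<and> d' \<subseteq> d"
    "d - rel_interior d = \<Union>F" using faces[OF less.prems] by metis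
  have "{c \<in> cells T. c \<subseteq> d} \<subseteq> insert d (\<Union>d'\<in>F. {c \<in> cells T. c \<subseteq> d'})"
  proof
    fix c assume c: "c \<in> {c \<in> cells T. c \<subseteq> d}"
    then obtain x where x: "x \<in> rel_interior c" using open_cell_nonempty by blast
    then have "x \<in> d" using c rel_interior_subset by blast
    show "c \<in> insert d (\<Union>d'\<in>F. {c \<in> cells T. c \<subseteq> d'})"
    proof (cases "x \<in> rel_interior d")
      case True
      then show ?thesis using open_cells_disjoint c x less.prems by blast
    next
      case False
      then have "x \<in> d - rel_interior d" using \<open>x \<in> d\<close> by simp
      then have "x \<in> \<Union>F" unfolding F(4) .
      then obtain d' where "d' \<in> F" "x \<in> d'" by blast
      then show ?thesis using open_cell_meets[of c d' x] c x F by blast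
    qed
  qed
  moreover have "finite {c \<in> cells T. c \<subseteq> d'}" if "d' \<in> F" for d'
    using that F aff_dim_geq[of d'] less.prems by (intro less.hyps) (fastforce simp: subset_iff)+
  ultimately show ?case using F by (meson finite_UN_I finite_insert finite_subset)
qed

text \<open>Choose a point in every open cell that meets a compact set. By the weak topology every set of
  chosen points is closed, so they cannot accumulate.\<close>

lemma finite_open_cells_meeting_compact:
  assumes K: "compact K" shows "finite {c \<in> cells T. rel_interior c \<inter> K \<noteq> {}}"
proof (rule ccontr)
  let ?C = "{c \<in> cells T. rel_interior c \<inter> K \<noteq> {}}"
  assume inf: "infinite ?C"
  define x where "x c = (SOME x. x \<in> rel_interior c \<inter> K)" for c
  have x: "x c \<in> rel_interior c" "x c \<in> K" if "c \<in> ?C" for c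
  proof -
    have "\<exists>y. y \<in> rel_interior c \<inter> K" using that by blast
    then have "x c \<in> rel_interior c \<inter> K" unfolding x_def by (rule someI_ex)
    then show "x c \<in> rel_interior c" "x c \<in> K" by auto
  qed
  have inj: "inj_on x ?C" by (rule inj_onI) (metis (lifting) x(1) mem_Collect_eq open_cells_disjoint)
  have closed: "closed B" if B: "B \<subseteq> x ` ?C" for B
  proof -
    have fin: "finite (B \<inter> d)" if "d \<in> cells T" for d
    proof -
      have "B \<inter> d \<subseteq> x ` {c \<in> cells T. c \<subseteq> d}"
      proof
        fix y assume y: "y \<in> B \<inter> d"
        then have "y \<in> x ` ?C" using B by blast
        then obtain c where "c \<in> ?C" "y = x c" by blast
        then show "y \<in> x ` {c \<in> cells T. c \<subseteq> d}"
          using open_cell_meets[of c d y] x(1)[of c] y that by blast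
      qed
      then show ?thesis using finite_subcells[OF that] finite_surj by blast
    qed
    show ?thesis by (rule weak_topology, rule finite_imp_closed, rule fin)
  qed
  have "infinite (x ` ?C)" using inf inj by (simp add: finite_image_iff)
  then obtain l where "l islimpt x ` ?C"
    using Heine_Borel_imp_Bolzano_Weierstrass[OF K] x by (metis (no_types, lifting) image_subsetI)
  then have "l \<in> closure (x ` ?C - {l})" by (simp add: islimpt_in_closure)
  moreover have "closed (x ` ?C - {l})" by (rule closed) auto
  ultimately show False by (simp add: closure_closed)
qed

lemma finite_cells_meeting_cball: "finite {c \<in> cells T. c \<inter> cball x r \<noteq> {}}"
proof (rule finite_subset)
  show "{c \<in> cells T. c \<inter> cball x r \<noteq> {}} \<subseteq> {c \<in> cells T. rel_interior c \<inter> cball x (r + 1) \<noteq> {}}"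
  proof
    fix c assume "c \<in> {c \<in> cells T. c \<inter> cball x r \<noteq> {}}"
    then obtain y where c: "c \<in> cells T" and y: "y \<in> c" "y \<in> cball x r" by blast
    have "y \<in> closure (rel_interior c)" using c y cell_subset_closure by blast
    then obtain z where "z \<in> rel_interior c" "dist z y < 1"
      using closure_approachable[of y "rel_interior c"] by (metis zero_less_one)
    moreover then have "dist x z \<le> r + 1" using y dist_triangle[of x z y] by (simp add: dist_commute)
    ultimately show "c \<in> {c \<in> cells T. rel_interior c \<inter> cball x (r + 1) \<noteq> {}}" using c by auto
  qed
qed (rule finite_open_cells_meeting_compact, simp)

lemma finite_cells_at: "finite {c \<in> cells T. x \<in> c}"
  by (rule finite_subset[OF _ finite_cells_meeting_cball[of x 0]]) auto

text \<open>Finitely many closed cells come close to \<open>x\<close>, and a small disc avoids those that do not contain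
  it.\<close>

lemma near_cells_contain:
  obtains r where "r > 0" "\<And>c. c \<in> cells T \<Longrightarrow> c \<inter> ball x r \<noteq> {} \<Longrightarrow> x \<in> c"
proof -
  define A where "A = {c \<in> cells T. c \<inter> cball x 1 \<noteq> {} \<and> x \<notin> c}"
  have "finite A" by (rule finite_subset[OF _ finite_cells_meeting_cball[of x 1]]) (auto simp: A_def)
  then have "closed (\<Union>A)" by (intro closed_Union) (auto simp: A_def cell_closed)
  moreover have "x \<in> - \<Union>A" by (auto simp: A_def)
  ultimately obtain r where r: "r > 0" "ball x r \<subseteq> - \<Union>A"
    by (metis open_Compl open_contains_ball)
  show ?thesis
  proof (rule that[of "min r 1"])
    show "min r 1 > 0" using r by simp
    fix c assume c: "c \<in> cells T" "c \<inter> ball x (min r 1) \<noteq> {}"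
    then obtain y where y: "y \<in> c" "y \<in> ball x (min r 1)" by blast
    then have "y \<in> cball x 1" "y \<in> ball x r" by auto
    then show "x \<in> c" using y c r unfolding A_def by blast
  qed
qed

lemma lower_cell_no_interior:
  assumes "c \<in> cells T" "c \<notin> tiles T" shows "interior c = {}"
proof -
  have "aff_dim c \<le> 1" using assms by (elim cell_dim_cases) (auto simp: kcells_def)
  then show ?thesis using interior_rel_interior_gen[of c] aff_dim_eq_full[of c] by fastforce
qed

text \<open>Finitely many edges and vertices have no interior points, so the closed union of the tiles near
  \<open>x\<close> already fills a disc around \<open>x\<close>.\<close>

lemma tile_at: obtains t where "t \<in> tiles T" "x \<in> t"
proof -
  define C where "C = {c \<in> cells T. c \<inter> cball x 1 \<noteq> {}}"
  have C: "finite C" unfolding C_def by (rule finite_cells_meeting_cball)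
  have cov: "cball x 1 \<subseteq> \<Union>(C \<inter> tiles T) \<union> \<Union>(C - tiles T)"
  proof
    fix y assume y: "y \<in> cball x 1"
    obtain c where "c \<in> cells T" "y \<in> rel_interior c" using obtain_open_cell[of y] by metis
    then show "y \<in> \<Union>(C \<inter> tiles T) \<union> \<Union>(C - tiles T)" using y rel_interior_subset[of c] C_def by blast
  qed
  have "interior (\<Union>F) = {}" if "finite F" "F \<subseteq> C - tiles T" for F
    using that
  proof (induction F)
    case (insert d F)
    then have d: "closed d" "interior d = {}"
      using cell_closed lower_cell_no_interior by (auto simp: C_def)
    then have "interior (d \<union> \<Union>F) = {}" using insert by (simp add: interior_closed_Un_empty_interior)
    then show ?case by simp
  qed simp
  then have e: "interior (\<Union>(C - tiles T)) = {}" using C by simp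
  have cl: "closed (\<Union>(C \<inter> tiles T))" using C by (intro closed_Union) (auto simp: kcells_def cell_closed)
  have "ball x 1 \<subseteq> interior (\<Union>(C \<inter> tiles T) \<union> \<Union>(C - tiles T))"
    by (intro interior_maximal subset_trans[OF ball_subset_cball cov]) simp
  also have "\<dots> = interior (\<Union>(C \<inter> tiles T))" by (rule interior_closed_Un_empty_interior[OF cl e])
  finally have "ball x 1 \<subseteq> \<Union>(C \<inter> tiles T)" using interior_subset by blast
  then have "x \<in> \<Union>(C \<inter> tiles T)" by (rule subsetD) simp
  then show ?thesis using that by blast
qed

lemma cell_in_tile:
  assumes "c \<in> cells T" obtains t where "t \<in> tiles T" "c \<subseteq> t"
proof -
  obtain x where x: "x \<in> rel_interior c" using open_cell_nonempty[OF assms] by blast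
  obtain t where "t \<in> tiles T" "x \<in> t" using tile_at[of x] by metis
  then show ?thesis using that open_cell_meets[OF assms _ x, of t] by (auto simp: kcells_def)
qed

lemma tiles_meet_interior:
  assumes "t \<in> tiles T" "c \<in> cells T" "x \<in> interior t" "x \<in> c" shows "c = t"
proof -
  have "x \<in> rel_interior t" "t \<in> cells T" "aff_dim t = 2"
    using assms tile_closure_interior(2) by (auto simp: kcells_def)
  moreover have "aff_dim c \<le> 2" using aff_dim_le_DIM[of c] by simp
  ultimately show ?thesis using open_cell_meets[of t c x] assms by auto
qed

lemma tile_subset_eq: "t \<in> tiles T \<Longrightarrow> t' \<in> tiles T \<Longrightarrow> t \<subseteq> t' \<Longrightarrow> t = t'"
  by (metis tile_closure_interior(3) tiles_meet_interior kcells_cells ex_in_conv interior_subset subsetD)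

subsection \<open>The two sides of an edge\<close>

text \<open>The open half-plane to the left (\<open>\<sigma> = 1\<close>) or to the right (\<open>\<sigma> = - 1\<close>) of the line through the
  oriented edge \<open>e\<close>.\<close>

definition half_plane :: "real \<Rightarrow> complex set \<Rightarrow> complex set" where
  "half_plane \<sigma> e = {y. 0 < \<sigma> * Im ((y - tail T e) / (head T e - tail T e))}"

lemma half_plane_convex: "convex (half_plane \<sigma> e)"
proof (rule convexI)
  fix x y :: complex and s t :: real
  assume *: "x \<in> half_plane \<sigma> e" "y \<in> half_plane \<sigma> e" "0 \<le> s" "0 \<le> t" "s + t = 1"
  define a u where "a = tail T e" and "u = head T e - tail T e"
  have "s *\<^sub>R x + t *\<^sub>R y - a = s *\<^sub>R (x - a) + t *\<^sub>R (y - a)"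
    using *(5) by (simp add: algebra_simps scaleR_left_distrib[symmetric])
  then have "(s *\<^sub>R x + t *\<^sub>R y - a) / u = s *\<^sub>R ((x - a) / u) + t *\<^sub>R ((y - a) / u)"
    by (simp add: add_divide_distrib scaleR_conv_of_real)
  then have "\<sigma> * Im ((s *\<^sub>R x + t *\<^sub>R y - a) / u) = s * (\<sigma> * Im ((x - a) / u)) + t * (\<sigma> * Im ((y - a) / u))"
    by (simp add: algebra_simps)
  moreover have "0 < s * (\<sigma> * Im ((x - a) / u)) + t * (\<sigma> * Im ((y - a) / u))"
    using * by (cases "s = 0") (auto simp: half_plane_def a_def u_def intro!: add_pos_nonneg)
  ultimately show "s *\<^sub>R x + t *\<^sub>R y \<in> half_plane \<sigma> e" by (simp add: half_plane_def a_def u_def)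
qed

lemma edge_not_half_plane:
  assumes "e \<in> kcells T 1" "y \<in> e" shows "y \<notin> half_plane \<sigma> e"
proof -
  obtain u where "y = (1 - u) *\<^sub>R tail T e + u *\<^sub>R head T e"
    using assms in_edge_iff[OF assms(1)] by (auto simp: in_segment)
  then have "y - tail T e = u *\<^sub>R (head T e - tail T e)" by (simp add: algebra_simps)
  then have "(y - tail T e) / (head T e - tail T e) = of_real u"
    using edge_segment(2)[OF assms(1)] by (simp add: scaleR_conv_of_real)
  then show ?thesis by (simp add: half_plane_def)
qed

lemma shift_in_half_plane:
  assumes "e \<in> kcells T 1" "x \<in> e" "\<sigma> * s > 0"
  shows "x + of_real s * (\<i> * (head T e - tail T e)) \<in> half_plane \<sigma> e"
proof -
  obtain u where "x = (1 - u) *\<^sub>R tail T e + u *\<^sub>R head T e"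
    using assms in_edge_iff[OF assms(1)] by (auto simp: in_segment)
  then have "x + of_real s * (\<i> * (head T e - tail T e)) - tail T e
      = (of_real u + of_real s * \<i>) * (head T e - tail T e)" by (simp add: algebra_simps scaleR_conv_of_real)
  then have "(x + of_real s * (\<i> * (head T e - tail T e)) - tail T e) / (head T e - tail T e)
      = of_real u + of_real s * \<i>"
    using edge_segment(2)[OF assms(1)] by simp
  then show ?thesis using assms by (simp add: half_plane_def)
qed

text \<open>Close to an interior point of an edge, each open half-disc is convex and avoids all edges and
  vertices, so it lies in a single tile.\<close>

lemma half_disc_in_tile:
  assumes e: "e \<in> kcells T 1" and x: "x \<in> rel_interior e" and \<sigma>: "\<sigma> \<noteq> 0"
  shows "\<exists>t\<in>tiles T. e \<subseteq> t \<and> (\<exists>r>0. ball x r \<inter> half_plane \<sigma> e \<subseteq> interior t)"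
proof -
  obtain r where r: "r > 0" "\<And>c. c \<in> cells T \<Longrightarrow> c \<inter> ball x r \<noteq> {} \<Longrightarrow> x \<in> c"
    using near_cells_contain[of x] by metis
  define H where "H = ball x r \<inter> half_plane \<sigma> e"
  have e': "e \<in> cells T" "aff_dim e = 1" using e by (auto simp: kcells_def)
  have xe: "x \<in> e" using x rel_interior_subset by blast
  have ex: "\<exists>t. t \<in> tiles T \<and> e \<subseteq> t \<and> y \<in> interior t" if y: "y \<in> H" for y
  proof -
    obtain c where c: "c \<in> cells T" "y \<in> rel_interior c" using obtain_open_cell[of y] by metis
    then have yc: "y \<in> c" using rel_interior_subset by blast
    then have "y \<in> c \<inter> ball x r" using y by (simp add: H_def)
    then have "x \<in> c" using r(2)[OF c(1)] by blast
    then have "e = c \<or> e \<subseteq> c \<and> aff_dim e < aff_dim c" using open_cell_meets[OF e'(1) c(1) x] by simp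
    moreover have "e \<noteq> c" using edge_not_half_plane[OF e] yc y by (auto simp: H_def)
    ultimately have "e \<subseteq> c" "c \<in> tiles T" using e' c by (auto elim!: cell_dim_cases[of c] simp: kcells_def)
    then show ?thesis using c tile_closure_interior(2) by auto
  qed
  define f where "f y = (SOME t. t \<in> tiles T \<and> e \<subseteq> t \<and> y \<in> interior t)" for y
  have f: "f y \<in> tiles T \<and> e \<subseteq> f y \<and> y \<in> interior (f y)" if "y \<in> H" for y
    unfolding f_def by (rule someI_ex[OF ex[OF that]])
  have con: "connected H" unfolding H_def
    by (intro convex_connected convex_Int half_plane_convex) auto
  have loc: "\<forall>y\<in>H. eventually (\<lambda>z. f y = f z) (at y within H)"
  proof
    fix y assume y: "y \<in> H"
    have 1: "eventually (\<lambda>z. z \<in> interior (f y)) (at y within H)"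
      using f[OF y] by (auto simp: eventually_at_topological intro!: exI[of _ "interior (f y)"])
    have 2: "eventually (\<lambda>z. z \<in> H) (at y within H)" by (simp add: eventually_at_filter)
    show "eventually (\<lambda>z. f y = f z) (at y within H)" using 1 2
    proof eventually_elim
      case (elim z)
      then have "z \<in> f y" using interior_subset by blast
      then show ?case using tiles_meet_interior[of "f z" "f y" z] f[OF y] f[of z] elim kcells_cells by blast
    qed
  qed
  \<comment> \<open>a point of the half-disc, found at a right angle to the edge\<close>
  obtain s where s: "\<sigma> * s > 0" "\<bar>s\<bar> * norm (head T e - tail T e) < r"
  proof
    define k where "k = sgn \<sigma> * (r / (2 * norm (head T e - tail T e)))"
    have n: "norm (head T e - tail T e) > 0" using edge_segment(2)[OF e] by simp
    show "\<sigma> * k > 0" using \<sigma> r n by (auto simp: k_def sgn_if zero_less_mult_iff)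
    show "\<bar>k\<bar> * norm (head T e - tail T e) < r" using \<sigma> r n by (auto simp: k_def sgn_if abs_mult)
  qed
  have p: "x + of_real s * (\<i> * (head T e - tail T e)) \<in> H" (is "?p \<in> H")
    using shift_in_half_plane[OF e xe s(1)] s(2) by (auto simp: H_def dist_norm norm_mult)
  have "f y = f ?p" if "y \<in> H" for y by (rule connected_local_const[OF con that p loc])
  then have "H \<subseteq> interior (f ?p)" using f by fastforce
  then show ?thesis using f[OF p] r(1) unfolding H_def by blast
qed

text \<open>A tile entered when leaving the edge at a right angle is the tile that fills the half-disc.\<close>

lemma half_disc_meets_tile:
  assumes e: "e \<in> kcells T 1" and x: "x \<in> rel_interior e" and \<sigma>: "\<sigma> \<noteq> 0"
    and t: "t \<in> tiles T" "r > 0" "ball x r \<inter> half_plane \<sigma> e \<subseteq> interior t"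
    and t': "t' \<in> tiles T" "\<forall>\<^sub>F s in at_right 0. x + of_real (sgn \<sigma> * s) * (\<i> * (head T e - tail T e)) \<in> t'"
  shows "t = t'"
proof -
  have xe: "x \<in> e" using x rel_interior_subset by blast
  have "\<forall>\<^sub>F s in at_right 0. 0 < s \<and> s < r / norm (head T e - tail T e)"
    using t edge_segment(2)[OF e]
    by (intro eventually_at_rightI[of 0 "r / norm (head T e - tail T e)"]) auto
  with t'(2) have "\<forall>\<^sub>F s in at_right 0. x + of_real (sgn \<sigma> * s) * (\<i> * (head T e - tail T e)) \<in> t' \<and>
     0 < s \<and> s < r / norm (head T e - tail T e)" by eventually_elim auto
  then obtain s where s: "x + of_real (sgn \<sigma> * s) * (\<i> * (head T e - tail T e)) \<in> t'"
     "0 < s" "s < r / norm (head T e - tail T e)"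
    using eventually_happens' by (metis (mono_tags, lifting) trivial_limit_at_right_real)
  have "s * norm (head T e - tail T e) < r" using s edge_segment(2)[OF e] by (simp add: field_simps)
  moreover have "\<sigma> * (sgn \<sigma> * s) > 0" using s \<sigma> by (auto simp: sgn_if mult_neg_pos)
  ultimately have "x + of_real (sgn \<sigma> * s) * (\<i> * (head T e - tail T e)) \<in> interior t"
    using shift_in_half_plane[OF e xe, of \<sigma> "sgn \<sigma> * s"] s \<sigma> t(3)
    by (auto simp: subset_iff dist_norm norm_mult abs_mult abs_sgn_eq)
  then show ?thesis using tiles_meet_interior[of t t'] t t' s kcells_cells by blast
qed

lemma eventually_shift_in_ball_half_plane:
  assumes e: "e \<in> kcells T 1" and x: "x \<in> rel_interior e" and \<sigma>: "\<sigma> = 1 \<or> \<sigma> = - 1"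
    and r: "r > 0" "ball x r \<inter> half_plane \<sigma> e \<subseteq> t"
  shows "\<forall>\<^sub>F s in at_right 0. x + of_real (\<sigma> * s) * (\<i> * (head T e - tail T e)) \<in> t"
proof -
  have xe: "x \<in> e" using x rel_interior_subset by blast
  have n: "norm (head T e - tail T e) > 0" using edge_segment(2)[OF e] by simp
  show ?thesis
  proof (rule eventually_at_rightI[of 0 "r / norm (head T e - tail T e)"])
    fix s assume s: "s \<in> {0<..<r / norm (head T e - tail T e)}"
    then have "s * norm (head T e - tail T e) < r" "s > 0" using n by (auto simp: field_simps)
    moreover then have "\<sigma> * (\<sigma> * s) > 0" using \<sigma> by auto
    ultimately show "x + of_real (\<sigma> * s) * (\<i> * (head T e - tail T e)) \<in> t"
      using r(2) shift_in_half_plane[OF e xe, of \<sigma> "\<sigma> * s"] \<sigma>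
      by (auto simp: subset_iff dist_norm norm_mult abs_mult)
  qed (use r n in simp)
qed

text \<open>The tile on one side does not change along the edge: the half-disc at \<open>x\<close> contains smaller
  half-discs at all nearby points, and the open edge is connected.\<close>

lemma side_tile_exists:
  assumes e: "e \<in> kcells T 1" and \<sigma>: "\<sigma> = 1 \<or> \<sigma> = - 1"
  shows "\<exists>t\<in>tiles T. e \<subseteq> t \<and> (\<forall>x\<in>rel_interior e. \<exists>r>0. ball x r \<inter> half_plane \<sigma> e \<subseteq> interior t)"
proof -
  let ?P = "\<lambda>x t. t \<in> tiles T \<and> e \<subseteq> t \<and> (\<exists>r>0. ball x r \<inter> half_plane \<sigma> e \<subseteq> interior t)"
  have \<sigma>0: "\<sigma> \<noteq> 0" "sgn \<sigma> = \<sigma>" using \<sigma> by auto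
  define f where "f x = (SOME t. ?P x t)" for x
  have f: "?P x (f x)" if "x \<in> rel_interior e" for x
    unfolding f_def by (rule someI_ex) (use half_disc_in_tile[OF e that \<sigma>0(1)] in blast)
  have uniq: "t = t'" if x: "x \<in> rel_interior e" and t: "?P x t" "?P x t'" for x t t'
  proof -
    obtain r where r: "r > 0" "ball x r \<inter> half_plane \<sigma> e \<subseteq> interior t" using t by blast
    obtain r' where r': "r' > 0" "ball x r' \<inter> half_plane \<sigma> e \<subseteq> interior t'" using t by blast
    have "ball x r' \<inter> half_plane \<sigma> e \<subseteq> t'" using r' interior_subset by blast
    then have "\<forall>\<^sub>F s in at_right 0. x + of_real (sgn \<sigma> * s) * (\<i> * (head T e - tail T e)) \<in> t'"
      using eventually_shift_in_ball_half_plane[OF e x \<sigma> r'(1)] \<sigma>0 by simp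
    then show ?thesis using half_disc_meets_tile[OF e x \<sigma>0(1)] t r by blast
  qed
  have loc: "\<forall>x\<in>rel_interior e. eventually (\<lambda>y. f x = f y) (at x within rel_interior e)"
  proof
    fix x assume x: "x \<in> rel_interior e"
    obtain r where r: "r > 0" "ball x r \<inter> half_plane \<sigma> e \<subseteq> interior (f x)" using f[OF x] by blast
    have 1: "eventually (\<lambda>y. y \<in> ball x r) (at x within rel_interior e)"
      using eventually_at_ball[OF r(1), of x "rel_interior e"] by (auto elim: eventually_mono)
    have 2: "eventually (\<lambda>y. y \<in> rel_interior e) (at x within rel_interior e)"
      by (simp add: eventually_at_filter)
    show "eventually (\<lambda>y. f x = f y) (at x within rel_interior e)" using 1 2
    proof eventually_elim
      case (elim y)
      then obtain s where s: "s > 0" "ball y s \<subseteq> ball x r" by (meson open_ball open_contains_ball)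
      then have "ball y s \<inter> half_plane \<sigma> e \<subseteq> interior (f x)" using r by blast
      then have "?P y (f x)" using f[OF x] s by blast
      then show ?case using uniq[OF elim(2)] f[OF elim(2)] by blast
    qed
  qed
  have con: "connected (rel_interior e)"
    using edge_segment(3)[OF e] by (simp add: convex_connected)
  obtain x0 where x0: "x0 \<in> rel_interior e" using open_cell_nonempty e kcells_cells by blast
  have "f x = f x0" if "x \<in> rel_interior e" for x by (rule connected_local_const[OF con that x0 loc])
  then show ?thesis using f x0 by metis
qed

lemma lies_iff:
  assumes \<sigma>: "\<sigma> = 1 \<or> \<sigma> = - 1"
  shows "(if \<sigma> = 1 then lies_left T e t else lies_right T e t) \<longleftrightarrow> t \<in> tiles T \<and> e \<subseteq> t \<and>
     (\<forall>x\<in>rel_interior e. \<forall>\<^sub>F s in at_right 0. x + of_real (\<sigma> * s) * (\<i> * (head T e - tail T e)) \<in> t)"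
proof -
  have "(\<exists>\<delta>>0. \<forall>s\<in>{0<..<\<delta>}. P s) \<longleftrightarrow> eventually P (at_right (0::real))" for P
    unfolding eventually_at_right[OF zero_less_one] by (simp add: Ball_def imp_conjL)
  then show ?thesis using \<sigma> unfolding lies_left_def lies_right_def by auto
qed

lemma side_tile_unique:
  assumes e: "e \<in> kcells T 1" and \<sigma>: "\<sigma> = 1 \<or> \<sigma> = - 1"
    and t: "t \<in> tiles T" "e \<subseteq> t" "\<forall>x\<in>rel_interior e. \<exists>r>0. ball x r \<inter> half_plane \<sigma> e \<subseteq> interior t"
  shows "t' = t \<longleftrightarrow> t' \<in> tiles T \<and> e \<subseteq> t' \<and>
    (\<forall>x\<in>rel_interior e. \<forall>\<^sub>F s in at_right 0. x + of_real (\<sigma> * s) * (\<i> * (head T e - tail T e)) \<in> t')"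
    (is "_ \<longleftrightarrow> ?R")
proof
  assume eq: "t' = t"
  have "\<forall>\<^sub>F s in at_right 0. x + of_real (\<sigma> * s) * (\<i> * (head T e - tail T e)) \<in> t"
    if x: "x \<in> rel_interior e" for x
  proof -
    obtain r where "r > 0" "ball x r \<inter> half_plane \<sigma> e \<subseteq> t" using t(3) x interior_subset by blast
    then show ?thesis by (rule eventually_shift_in_ball_half_plane[OF e x \<sigma>])
  qed
  then show ?R using t eq by blast
next
  assume R: ?R
  obtain x where x: "x \<in> rel_interior e" using open_cell_nonempty e kcells_cells by blast
  then obtain r where r: "r > 0" "ball x r \<inter> half_plane \<sigma> e \<subseteq> interior t" using t by blast
  have "sgn \<sigma> = \<sigma>" "\<sigma> \<noteq> 0" using \<sigma> by auto
  then show "t' = t" using half_disc_meets_tile[OF e x _ t(1) r, of t'] R x by auto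
qed

definition side_tile :: "real \<Rightarrow> complex set \<Rightarrow> complex set" where
  "side_tile \<sigma> e = (if \<sigma> = 1 then left_tile T e else right_tile T e)"

lemma side_tile:
  assumes e: "e \<in> kcells T 1" and \<sigma>: "\<sigma> = 1 \<or> \<sigma> = - 1"
  shows "(if \<sigma> = 1 then lies_left T e t else lies_right T e t) \<longleftrightarrow> t = side_tile \<sigma> e"
    "side_tile \<sigma> e \<in> tiles T" "e \<subseteq> side_tile \<sigma> e"
    "x \<in> rel_interior e \<Longrightarrow> \<exists>r>0. ball x r \<inter> half_plane \<sigma> e \<subseteq> interior (side_tile \<sigma> e)"
proof -
  obtain t0 where t0: "t0 \<in> tiles T" "e \<subseteq> t0" "\<forall>x\<in>rel_interior e. \<exists>r>0. ball x r \<inter> half_plane \<sigma> e \<subseteq> interior t0"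
    using side_tile_exists[OF e \<sigma>] by auto
  have iff: "(if \<sigma> = 1 then lies_left T e t else lies_right T e t) \<longleftrightarrow> t = t0" for t
    unfolding lies_iff[OF \<sigma>] using side_tile_unique[OF e \<sigma> t0, of t] by simp
  have "side_tile \<sigma> e = (THE t. if \<sigma> = 1 then lies_left T e t else lies_right T e t)"
    by (simp add: side_tile_def left_tile_def right_tile_def)
  also have "\<dots> = t0" unfolding iff by simp
  finally have eq: "side_tile \<sigma> e = t0" .
  show "(if \<sigma> = 1 then lies_left T e t else lies_right T e t) \<longleftrightarrow> t = side_tile \<sigma> e"
    unfolding eq by (rule iff)
  show "side_tile \<sigma> e \<in> tiles T" "e \<subseteq> side_tile \<sigma> e"
    "x \<in> rel_interior e \<Longrightarrow> \<exists>r>0. ball x r \<inter> half_plane \<sigma> e \<subseteq> interior (side_tile \<sigma> e)"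
    using t0 by (auto simp: eq)
qed

lemma lies_left_iff: "e \<in> kcells T 1 \<Longrightarrow> lies_left T e t \<longleftrightarrow> t = left_tile T e"
  using side_tile(1)[of e 1 t] by (simp add: side_tile_def)

lemma lies_right_iff: "e \<in> kcells T 1 \<Longrightarrow> lies_right T e t \<longleftrightarrow> t = right_tile T e"
  using side_tile(1)[of e "- 1" t] by (simp add: side_tile_def)

lemma left_tile_side: "e \<in> kcells T 1 \<Longrightarrow> left_tile T e \<in> tiles T" "e \<in> kcells T 1 \<Longrightarrow> e \<subseteq> left_tile T e"
  using side_tile(2,3)[of e 1] by (simp_all add: side_tile_def)

lemma right_tile_side: "e \<in> kcells T 1 \<Longrightarrow> right_tile T e \<in> tiles T" "e \<in> kcells T 1 \<Longrightarrow> e \<subseteq> right_tile T e"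
  using side_tile(2,3)[of e "- 1"] by (simp_all add: side_tile_def)

text \<open>A tile is the closure of its interior, so it has interior points arbitrarily close to \<open>x\<close>. Some of
  them lie off the line of the edge, and those belong to one of the two half-discs.\<close>

lemma tile_at_edge:
  assumes e: "e \<in> kcells T 1" and t: "t \<in> tiles T" and x: "x \<in> rel_interior e" "x \<in> t"
  shows "t = left_tile T e \<or> t = right_tile T e"
proof -
  obtain r1 where r1: "r1 > 0" "ball x r1 \<inter> half_plane 1 e \<subseteq> interior (side_tile 1 e)"
    using side_tile(4)[OF e _ x(1), of 1] by blast
  obtain r2 where r2: "r2 > 0" "ball x r2 \<inter> half_plane (- 1) e \<subseteq> interior (side_tile (- 1) e)"
    using side_tile(4)[OF e _ x(1), of "- 1"] by blast
  define r where "r = min r1 r2"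
  have r: "r > 0" using r1 r2 by (simp add: r_def)
  have "x \<in> closure (interior t)" using x tile_closure_interior[OF t] by simp
  then obtain y where y: "y \<in> interior t" "dist y x < r" using closure_approachable r by metis
  \<comment> \<open>the line through the edge\<close>
  define l where "l = {y. Im ((y - tail T e) / (head T e - tail T e)) = 0}"
  have "interior l = {}"
  proof (rule ccontr)
    assume "interior l \<noteq> {}"
    then obtain z k where z: "k > 0" "ball z k \<subseteq> l" by (meson ex_in_conv mem_interior)
    define u where "u = head T e - tail T e"
    have u: "norm u > 0" using edge_segment(2)[OF e] by (simp add: u_def)
    define q where "q = z + of_real (k / (2 * norm u)) * (\<i> * u)"
    have "dist z q = k / 2" unfolding q_def dist_norm using z u by (simp add: norm_mult norm_divide)
    then have "q \<in> ball z k" "z \<in> ball z k" using z by auto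
    then have "q \<in> l" "z \<in> l" using z by auto
    moreover have "(q - tail T e) / u = (z - tail T e) / u + of_real (k / (2 * norm u)) * \<i>"
      using u by (simp add: q_def field_simps)
    ultimately show False using z u by (simp add: l_def u_def[symmetric])
  qed
  moreover have "open (interior t \<inter> ball x r)" by auto
  moreover have "y \<in> interior t \<inter> ball x r" using y by (simp add: dist_commute)
  ultimately obtain z where z: "z \<in> interior t \<inter> ball x r" "z \<notin> l"
    by (metis empty_iff interior_maximal subsetD subsetI)
  then obtain \<sigma> :: real where \<sigma>: "\<sigma> = 1 \<or> \<sigma> = - 1" "z \<in> half_plane \<sigma> e"
    by (cases "Im ((z - tail T e) / (head T e - tail T e)) > 0") (force simp: l_def half_plane_def)+
  then have "z \<in> interior (side_tile \<sigma> e)" using z(1) r1 r2 by (auto simp: r_def)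
  moreover have "z \<in> t" using z interior_subset by blast
  ultimately have "t = side_tile \<sigma> e"
    using tiles_meet_interior[OF side_tile(2)[OF e \<sigma>(1)]] kcells_cells[OF t] by blast
  then show ?thesis by (simp add: side_tile_def)
qed

end

section \<open>Dual connectedness and the circle around a vertex\<close>

context oriented_tiling
begin

lemma countable_vertices: "countable (\<Union>(kcells T 0))"
proof -
  have "kcells T 0 \<subseteq> (\<Union>n. {c \<in> cells T. c \<inter> cball 0 (real n) \<noteq> {}})"
  proof
    fix v assume v: "v \<in> kcells T 0"
    then obtain w where w: "v = {w}" by (rule vertex_point)
    obtain n where "norm w \<le> real n" using real_arch_simple by blast
    then have "v \<inter> cball 0 (real n) \<noteq> {}" using w by simp
    then show "v \<in> (\<Union>n. {c \<in> cells T. c \<inter> cball 0 (real n) \<noteq> {}})"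
      using kcells_cells[OF v] by blast
  qed
  moreover have "countable (\<Union>n. {c \<in> cells T. c \<inter> cball 0 (real n) \<noteq> {}})"
    using countable_finite[OF finite_cells_meeting_cball] by (intro countable_UN) auto
  ultimately have "countable (kcells T 0)" by (rule countable_subset)
  moreover have "countable v" if "v \<in> kcells T 0" for v
    using that by (rule vertex_point) simp
  ultimately show ?thesis using countable_UN[of "kcells T 0" "\<lambda>v. v"] by simp
qed

lemma vertex_not_in_tile_interior:
  assumes "v \<in> kcells T 0" "t \<in> tiles T" "x \<in> interior t" shows "x \<notin> v"
  using tiles_meet_interior[of t v x] assms by (auto simp: kcells_def)

text \<open>The plane stays connected when the vertices are removed, so any two tiles are joined by a
  chain of tiles in which consecutive ones share an edge.\<close>

lemma constant_across_edges:
  assumes A: "\<And>e. e \<in> kcells T 1 \<Longrightarrow> A (left_tile T e) = A (right_tile T e)"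
    and t: "t \<in> tiles T" "t' \<in> tiles T"
  shows "A t = A t'"
proof -
  define V where "V = \<Union>(kcells T 0)"
  have con: "connected (- V)"
    unfolding V_def
    by (intro path_connected_imp_connected path_connected_complement_countable countable_vertices) simp
  define g where "g x = A (SOME t. t \<in> tiles T \<and> x \<in> t)" for x
  have some: "(SOME t. t \<in> tiles T \<and> x \<in> t) \<in> tiles T \<and> x \<in> (SOME t. t \<in> tiles T \<and> x \<in> t)" for x
    by (rule someI_ex) (metis tile_at)
  have loc: "\<forall>x\<in>- V. eventually (\<lambda>y. g x = g y) (at x within - V)"
  proof
    fix x assume x: "x \<in> - V"
    obtain r where r: "r > 0" "\<And>c. c \<in> cells T \<Longrightarrow> c \<inter> ball x r \<noteq> {} \<Longrightarrow> x \<in> c"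
      using near_cells_contain[of x] by metis
    obtain c where c: "c \<in> cells T" "x \<in> rel_interior c" using obtain_open_cell[of x] by metis
    then have xc: "x \<in> c" using rel_interior_subset by blast
    have eq: "A t1 = A t2" if "t1 \<in> tiles T" "t2 \<in> tiles T" "x \<in> t1" "x \<in> t2" for t1 t2
      using c(1)
    proof (cases rule: cell_dim_cases)
      case 1
      then show ?thesis using x xc by (auto simp: V_def)
    next
      case 2
      then show ?thesis using tile_at_edge[OF 2 _ c(2)] that A[OF 2] by metis
    next
      case 3
      then have "x \<in> interior c" using tile_closure_interior(2) c by simp
      then show ?thesis using tiles_meet_interior[OF 3] that kcells_cells by metis
    qed
    have "eventually (\<lambda>y. y \<in> ball x r) (at x within - V)"
      using eventually_at_ball[OF r(1), of x "- V"] by (auto elim: eventually_mono)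
    then show "eventually (\<lambda>y. g x = g y) (at x within - V)"
    proof eventually_elim
      case (elim y)
      have "x \<in> (SOME t. t \<in> tiles T \<and> y \<in> t)"
        using some[of y] elim by (intro r(2)) (auto simp: kcells_def)
      then show ?case unfolding g_def using eq some by blast
    qed
  qed
  have g: "g x = A t \<and> x \<in> - V" if t: "t \<in> tiles T" and x: "x \<in> interior t" for t x
  proof
    have "(SOME t. t \<in> tiles T \<and> x \<in> t) = t"
      using tiles_meet_interior[OF t _ x] some[of x] kcells_cells by blast
    then show "g x = A t" by (simp add: g_def)
    show "x \<in> - V" using vertex_not_in_tile_interior[OF _ t x] by (auto simp: V_def)
  qed
  obtain x where x: "x \<in> interior t" using tile_closure_interior(3)[OF t(1)] by blast
  obtain x' where x': "x' \<in> interior t'" using tile_closure_interior(3)[OF t(2)] by blast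
  have "g x = g x'"
    using connected_local_const[OF con _ _ loc] g[OF t(1) x] g[OF t(2) x'] by blast
  then show ?thesis using g[OF t(1) x] g[OF t(2) x'] by simp
qed

lemma edge_at_vertex:
  assumes e: "e \<in> kcells T 1" and v: "{w} \<in> kcells T 0" and w: "w \<in> e"
  shows "tail T e = w \<or> head T e = w"
proof -
  have "w \<notin> rel_interior e"
  proof
    assume "w \<in> rel_interior e"
    then have "{w} = e" using open_cells_disjoint[of "{w}" e w] e v by (auto simp: kcells_def)
    then show False using e v by (auto simp: kcells_def)
  qed
  then show ?thesis using w in_edge_iff[OF e] edge_segment(3)[OF e] by (auto simp: open_segment_def)
qed

lemma endpoint_vertex:
  assumes e: "e \<in> kcells T 1" and w: "w = tail T e \<or> w = head T e"
  shows "{w} \<in> kcells T 0"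
proof -
  have ec: "e \<in> cells T" using e by (rule kcells_cells)
  obtain F where F: "F \<subseteq> cells T" "\<forall>d\<in>F. aff_dim d < aff_dim e \<and> d \<subseteq> e" "e - rel_interior e = \<Union>F"
    using faces[OF ec] by metis
  have "w \<in> e - rel_interior e" using w in_edge_iff[OF e] edge_segment(3)[OF e] by (auto simp: open_segment_def)
  then have "w \<in> \<Union>F" unfolding F(3) .
  then obtain d where d: "d \<in> F" "w \<in> d" by blast
  then have "d \<in> cells T" "aff_dim d < 1" using F e by (auto simp: kcells_def)
  then have "d \<in> kcells T 0" by (auto elim!: cell_dim_cases simp: kcells_def)
  then show ?thesis using d(2) by (metis vertex_point singletonD)
qed

lemma incidence_edge:
  "e \<in> kcells T 1 \<Longrightarrow> v \<in> kcells T 0 \<Longrightarrow>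
   incidence T e v = of_bool (head T e \<in> v) - of_bool (tail T e \<in> v)"
  by (simp add: incidence_def)

lemma incidence_tile:
  "t \<in> tiles T \<Longrightarrow> e \<in> kcells T 1 \<Longrightarrow>
   incidence T t e = turn T t * (of_bool (t = left_tile T e) - of_bool (t = right_tile T e))"
  by (simp add: incidence_def lies_left_iff lies_right_iff) (auto simp: kcells_def)

text \<open>Walk around a vertex \<open>v\<close> on a small circle. The tile met by the walker changes exactly at the
  edges at \<open>v\<close>, from right to left for an outgoing edge and from left to right for an incoming
  one; a function of the tile returns to its initial value. Applied to
  \<open>A t = turn t * [t = t\<^sub>0]\<close> this is \<open>\<partial>\<partial>t\<^sub>0 = 0\<close>.\<close>

lemma sum_around_vertex:
  fixes A :: "complex set \<Rightarrow> 'a::comm_ring_1"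
  assumes v: "v \<in> kcells T 0"
  shows "(\<Sum>e | e \<in> kcells T 1 \<and> v \<subseteq> e.
            of_int (incidence T e v) * (A (left_tile T e) - A (right_tile T e))) = 0"
proof -
  obtain w where w: "v = {w}" using v by (rule vertex_point)
  obtain r where r: "r > 0" "\<And>c. c \<in> cells T \<Longrightarrow> c \<inter> ball w r \<noteq> {} \<Longrightarrow> w \<in> c"
    using near_cells_contain[of w] by metis
  define \<epsilon> where "\<epsilon> = r / 2"
  have \<epsilon>: "0 < \<epsilon>" "\<epsilon> < r" using r by (auto simp: \<epsilon>_def)
  define E where "E = {e \<in> kcells T 1. v \<subseteq> e}"
  have E: "e \<in> kcells T 1" "w \<in> e" "tail T e \<noteq> head T e" "tail T e = w \<or> head T e = w" if "e \<in> E" for e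
    using that edge_at_vertex[of e w] v edge_segment(2)[of e] by (auto simp: E_def w)
  have finE: "finite E"
    by (rule finite_subset[OF _ finite_cells_at[of w]]) (auto simp: E_def w kcells_def)
  \<comment> \<open>\<open>1\<close> for an outgoing edge and \<open>- 1\<close> for an incoming one; \<open>w + u e\<close> is the other end of \<open>e\<close>\<close>
  define sg :: "complex set \<Rightarrow> real" where "sg e = (if tail T e = w then 1 else - 1)" for e
  have sg: "sg e = 1 \<or> sg e = - 1" for e by (simp add: sg_def)
  define u where "u e = of_real (sg e) * (head T e - tail T e)" for e
  have seg: "rel_interior e = open_segment w (w + u e)" if "e \<in> E" for e
    using E[OF that] edge_segment(3)[of e] by (auto simp: u_def sg_def open_segment_commute)
  have ur: "norm (u e) \<ge> r" if e: "e \<in> E" for e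
  proof -
    have "w + u e = tail T e \<or> w + u e = head T e" using E[OF e] by (auto simp: u_def sg_def)
    then have "{w + u e} \<in> cells T" using endpoint_vertex[OF E(1)[OF e]] kcells_cells by blast
    moreover have "u e \<noteq> 0" using E[OF e] by (auto simp: u_def sg_def)
    ultimately show ?thesis using r(2)[of "{w + u e}"] by (force simp: dist_norm)
  qed
  have u0: "norm (u e) > 0" if "e \<in> E" for e using ur[OF that] r(1) by linarith
  define dir where "dir e = sgn (u e)" for e
  have dir: "norm (dir e) = 1" if "e \<in> E" for e using u0[OF that] by (simp add: dir_def norm_sgn)
  have dir_eq: "of_real \<epsilon> * dir e = of_real (\<epsilon> / norm (u e)) * u e" for e
    by (simp add: dir_def sgn_eq)
  have pt: "w + of_real \<epsilon> * dir e \<in> rel_interior e" if e: "e \<in> E" for e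
    unfolding seg[OF e] in_segment dir_eq
    using ur[OF e] u0[OF e] \<epsilon> by (intro conjI exI[of _ "\<epsilon> / norm (u e)"]) (auto simp: scaleR_conv_of_real algebra_simps add_divide_distrib)
  have inj: "inj_on dir E"
    by (rule inj_onI) (metis pt E(1) kcells_cells open_cells_disjoint)
  define K where "K = dir ` E"
  have K: "finite K" "K \<subseteq> sphere 0 1" using finE dir by (auto simp: K_def)
  \<comment> \<open>the circle of radius \<open>\<epsilon>\<close> meets edges in the directions \<open>K\<close> only\<close>
  have tile: "\<exists>t\<in>tiles T. w + of_real \<epsilon> * p \<in> interior t" if p: "p \<in> sphere 0 1 - K" for p
  proof -
    let ?y = "w + of_real \<epsilon> * p"
    obtain c where c: "c \<in> cells T" "?y \<in> rel_interior c" using obtain_open_cell[of ?y] by metis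
    have "?y \<in> c" using c rel_interior_subset by blast
    moreover have "?y \<in> ball w r" using p \<epsilon> by (simp add: dist_norm norm_mult)
    ultimately have wc: "w \<in> c" using r(2)[OF c(1)] by blast
    show ?thesis using c(1)
    proof (cases rule: cell_dim_cases)
      case 1
      then obtain z where "c = {z}" by (rule vertex_point)
      then have "?y = w" using wc \<open>?y \<in> c\<close> by auto
      then show ?thesis using p \<epsilon> by auto
    next
      case 2
      then have e: "c \<in> E" using wc by (auto simp: E_def w)
      then obtain k where k: "0 < k" "?y = (1 - k) *\<^sub>R w + k *\<^sub>R (w + u c)"
        using c(2) seg[OF e] by (auto simp: in_segment)
      then have "of_real \<epsilon> * p = of_real k * u c" by (simp add: scaleR_conv_of_real algebra_simps)
      then have "sgn (of_real \<epsilon> * p) = sgn (of_real k * u c)" by simp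
      then have "p = dir c" using \<epsilon> k p by (simp add: sgn_mult sgn_of_real dir_def sgn_eq[of p])
      then show ?thesis using p e by (auto simp: K_def)
    next
      case 3
      then show ?thesis using c tile_closure_interior(2) by auto
    qed
  qed
  define f where "f p = A (SOME t. t \<in> tiles T \<and> w + of_real \<epsilon> * p \<in> interior t)" for p
  have f: "f p = A t" if t: "t \<in> tiles T" "w + of_real \<epsilon> * p \<in> interior t" for p t
  proof -
    have "(SOME t. t \<in> tiles T \<and> w + of_real \<epsilon> * p \<in> interior t) = t"
    proof (rule some_equality)
      fix t' assume t': "t' \<in> tiles T \<and> w + of_real \<epsilon> * p \<in> interior t'"
      then have "w + of_real \<epsilon> * p \<in> t'" using interior_subset by blast
      then show "t' = t" using tiles_meet_interior[OF t(1) _ t(2)] t' kcells_cells by blast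
    qed (use t in blast)
    then show ?thesis by (simp add: f_def)
  qed
  have const: "f q = f p" if p: "p \<in> sphere 0 1 - K" and q: "q \<in> arc_at K p" for p q
  proof (rule connected_local_const[OF arc_at_connected q arc_at_refl[OF p]])
    show "\<forall>a\<in>arc_at K p. eventually (\<lambda>b. f a = f b) (at a within arc_at K p)"
    proof
      fix a assume "a \<in> arc_at K p"
      then have "a \<in> sphere 0 1 - K" using arc_at_subset by blast
      then obtain t where t: "t \<in> tiles T" "w + of_real \<epsilon> * a \<in> interior t" using tile by blast
      have "((\<lambda>b. w + of_real \<epsilon> * b) \<longlongrightarrow> w + of_real \<epsilon> * a) (at a within arc_at K p)"
        by (intro tendsto_intros)
      then have "eventually (\<lambda>b. w + of_real \<epsilon> * b \<in> interior t) (at a within arc_at K p)"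
        by (rule topological_tendstoD) (use t in auto)
      then show "eventually (\<lambda>b. f a = f b) (at a within arc_at K p)"
        by eventually_elim (use f t in auto)
    qed
  qed
  \<comment> \<open>leaving an outgoing edge anticlockwise leads to its left, an incoming one to its right\<close>
  have sides: "\<forall>\<^sub>F s in at_right 0. f (dir e * cis (\<sigma> * s)) = A (side_tile (\<sigma> * sg e) e)"
    if e: "e \<in> E" and \<sigma>: "\<sigma> = 1 \<or> \<sigma> = - 1" for e \<sigma>
  proof -
    define x where "x = w + of_real \<epsilon> * dir e"
    have \<tau>: "\<sigma> * sg e = 1 \<or> \<sigma> * sg e = - 1" using \<sigma> sg[of e] by auto
    obtain r1 where r1: "r1 > 0" "ball x r1 \<inter> half_plane (\<sigma> * sg e) e \<subseteq> interior (side_tile (\<sigma> * sg e) e)"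
      using side_tile(4)[OF E(1)[OF e] \<tau> pt[OF e]] unfolding x_def by blast
    have "((\<lambda>s. w + of_real \<epsilon> * (dir e * cis (\<sigma> * s))) \<longlongrightarrow> w + of_real \<epsilon> * (dir e * cis (\<sigma> * 0))) (at_right (0::real))"
      unfolding cis_conv_exp by (intro tendsto_intros)
    then have 1: "\<forall>\<^sub>F s in at_right 0. w + of_real \<epsilon> * (dir e * cis (\<sigma> * s)) \<in> ball x r1"
      by (rule topological_tendstoD) (use r1 in \<open>auto simp: x_def\<close>)
    have 2: "\<forall>\<^sub>F s in at_right 0. 0 < s \<and> s < pi"
      by (intro eventually_at_rightI[of 0 pi]) auto
    show ?thesis using 1 2
    proof eventually_elim
      case (elim s)
      let ?y = "w + of_real \<epsilon> * (dir e * cis (\<sigma> * s))"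
      define k where "k = \<epsilon> / norm (u e)"
      have k: "k > 0" using \<epsilon> u0[OF e] by (simp add: k_def)
      have ht: "head T e - tail T e \<noteq> 0" using E[OF e] by simp
      have y: "?y = w + of_real k * u e * cis (\<sigma> * s)"
        using dir_eq[of e] by (simp add: k_def mult.assoc[symmetric])
      have "(?y - tail T e) / (head T e - tail T e) = of_real (of_bool (tail T e \<noteq> w)) + of_real (k * sg e) * cis (\<sigma> * s)"
      proof (cases "tail T e = w")
        case True
        then show ?thesis using ht by (simp add: y u_def sg_def)
      next
        case False
        then have "head T e = w" using E(4)[OF e] by blast
        then show ?thesis using ht False by (simp add: y u_def sg_def field_simps)
      qed
      then have "Im ((?y - tail T e) / (head T e - tail T e)) = k * sg e * sin (\<sigma> * s)" by simp
      then have "(\<sigma> * sg e) * Im ((?y - tail T e) / (head T e - tail T e)) = k * sin s"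
        using \<sigma> sg[of e] by auto
      then have "?y \<in> half_plane (\<sigma> * sg e) e"
        using k sin_gt_zero[of s] elim by (simp add: half_plane_def)
      then show ?case using f[OF side_tile(2)[OF E(1)[OF e] \<tau>]] r1 elim by blast
    qed
  qed
  \<comment> \<open>the one-sided limits of \<open>f\<close> at the direction \<open>g\<close> of an edge\<close>
  define R where "R \<sigma> g = A (side_tile (\<sigma> * sg (the_inv_into E dir g)) (the_inv_into E dir g))" for \<sigma> g
  have R: "R \<sigma> (dir e) = A (side_tile (\<sigma> * sg e) e)" if "e \<in> E" for \<sigma> e
    using the_inv_into_f_f[OF inj that] by (simp add: R_def)
  have "(\<Sum>g\<in>K. R 1 g - R (- 1) g) = 0"
  proof (rule sum_jumps_circle[OF K const])
    fix g assume "g \<in> K"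
    then obtain e where e: "e \<in> E" "g = dir e" by (auto simp: K_def)
    show "\<forall>\<^sub>F s in at_right 0. f (g * cis s) = R 1 g"
      using sides[OF e(1), of 1] R[OF e(1), of 1] e by simp
    show "\<forall>\<^sub>F s in at_right 0. f (g * cis (- s)) = R (- 1) g"
      using sides[OF e(1), of "- 1"] R[OF e(1), of "- 1"] e by (simp del: cis_cnj)
  qed
  then have "0 = (\<Sum>e\<in>E. R 1 (dir e) - R (- 1) (dir e))"
    unfolding K_def using inj by (simp add: sum.reindex)
  also have "\<dots> = (\<Sum>e\<in>E. - (of_int (incidence T e v) * (A (left_tile T e) - A (right_tile T e))))"
  proof (rule sum.cong[OF refl])
    fix e assume e: "e \<in> E"
    have "incidence T e v = (if tail T e = w then - 1 else 1)"
      using incidence_edge[OF E(1)[OF e] v] E[OF e] by (auto simp: w)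
    then show "R 1 (dir e) - R (- 1) (dir e) = - (of_int (incidence T e v) * (A (left_tile T e) - A (right_tile T e)))"
      using R[OF e, of 1] R[OF e, of "- 1"] by (auto simp: side_tile_def sg_def)
  qed
  finally show ?thesis by (simp add: sum_negf E_def)
qed

end

section \<open>Rigid motions of patches\<close>

lemma move_dist: "\<phi> \<in> rigid_motions \<Longrightarrow> dist (move \<phi> x) (move \<phi> y) = dist x y"
proof -
  assume "\<phi> \<in> rigid_motions"
  then have "norm (snd \<phi>) = 1" by (auto simp: rigid_motions_def)
  moreover have "move \<phi> x - move \<phi> y = snd \<phi> * (x - y)" by (simp add: move_def algebra_simps)
  ultimately show ?thesis by (simp add: dist_norm norm_mult)
qed

lemma rot_part_norm: "\<phi> \<in> rigid_motions \<Longrightarrow> norm (snd \<phi>) = 1"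
  by (auto simp: rigid_motions_def)

definition inverse_motion :: "motion \<Rightarrow> motion" where
  "inverse_motion \<phi> = (- fst \<phi> / snd \<phi>, 1 / snd \<phi>)"

definition compose_motion :: "motion \<Rightarrow> motion \<Rightarrow> motion" where
  "compose_motion \<psi> \<phi> = (snd \<psi> * fst \<phi> + fst \<psi>, snd \<psi> * snd \<phi>)"

lemma inverse_motion:
  assumes "\<phi> \<in> rigid_motions"
  shows "inverse_motion \<phi> \<in> rigid_motions" "move (inverse_motion \<phi>) (move \<phi> x) = x"
    "move \<phi> (move (inverse_motion \<phi>) x) = x" "move (inverse_motion \<phi>) ` move \<phi> ` A = A"
    "move \<phi> ` move (inverse_motion \<phi>) ` A = A"
proof -
  have "norm (snd \<phi>) = 1" using rot_part_norm[OF assms] .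
  then have "snd \<phi> \<noteq> 0" by auto
  then show 1: "move (inverse_motion \<phi>) (move \<phi> x) = x" "move \<phi> (move (inverse_motion \<phi>) x) = x" for x
    by (simp_all add: move_def inverse_motion_def field_simps)
  show "move (inverse_motion \<phi>) ` move \<phi> ` A = A" "move \<phi> ` move (inverse_motion \<phi>) ` A = A"
    by (simp_all add: image_image 1)
  show "inverse_motion \<phi> \<in> rigid_motions"
    using \<open>norm (snd \<phi>) = 1\<close> by (simp add: rigid_motions_def inverse_motion_def norm_divide)
qed

lemma compose_motion:
  "\<phi> \<in> rigid_motions \<Longrightarrow> \<psi> \<in> rigid_motions \<Longrightarrow> compose_motion \<psi> \<phi> \<in> rigid_motions"
  "move (compose_motion \<psi> \<phi>) x = move \<psi> (move \<phi> x)"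
  "move (compose_motion \<psi> \<phi>) ` A = move \<psi> ` move \<phi> ` A"
proof -
  show "\<phi> \<in> rigid_motions \<Longrightarrow> \<psi> \<in> rigid_motions \<Longrightarrow> compose_motion \<psi> \<phi> \<in> rigid_motions"
    by (auto simp: rigid_motions_def compose_motion_def norm_mult)
  show 1: "move (compose_motion \<psi> \<phi>) x = move \<psi> (move \<phi> x)" for x
    by (simp add: move_def compose_motion_def algebra_simps)
  show "move (compose_motion \<psi> \<phi>) ` A = move \<psi> ` move \<phi> ` A" by (simp add: image_image 1)
qed

lemma move_inj: "\<phi> \<in> rigid_motions \<Longrightarrow> inj (move \<phi>)"
  by (rule inj_on_inverseI[where g = "move (inverse_motion \<phi>)"]) (simp add: inverse_motion)

lemma move_subset_iff: "\<phi> \<in> rigid_motions \<Longrightarrow> move \<phi> ` A \<subseteq> move \<phi> ` B \<longleftrightarrow> A \<subseteq> B"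
  using move_inj inj_image_subset_iff by blast

lemma move_aff_dim:
  assumes "\<phi> \<in> rigid_motions" shows "aff_dim (move \<phi> ` A) = aff_dim A"
proof -
  have "snd \<phi> \<noteq> 0" using rot_part_norm[OF assms] by auto
  then have "inj ((*) (snd \<phi>))" by (auto simp: inj_def)
  moreover have "linear ((*) (snd \<phi>))" by (simp add: linear_conv_bounded_linear bounded_linear_mult_right)
  ultimately have "aff_dim ((*) (snd \<phi>) ` A) = aff_dim A" by (simp add: aff_dim_injective_linear_image)
  moreover have "move \<phi> ` A = (+) (fst \<phi>) ` (*) (snd \<phi>) ` A"
    by (auto simp: move_def image_image add.commute)
  ultimately show ?thesis by (simp add: aff_dim_translation_eq)
qed

lemma move_setdist:
  assumes "\<phi> \<in> rigid_motions" shows "setdist (move \<phi> ` A) (move \<phi> ` B) = setdist A B"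
proof -
  have "{dist x y |x y. x \<in> move \<phi> ` A \<and> y \<in> move \<phi> ` B} = {dist x y |x y. x \<in> A \<and> y \<in> B}"
  proof (intro equalityI subsetI)
    fix d assume "d \<in> {dist x y |x y. x \<in> A \<and> y \<in> B}"
    then obtain x y where "d = dist (move \<phi> x) (move \<phi> y)" "x \<in> A" "y \<in> B"
      by (auto simp: move_dist[OF assms])
    then show "d \<in> {dist x y |x y. x \<in> move \<phi> ` A \<and> y \<in> move \<phi> ` B}" by blast
  next
    fix d assume "d \<in> {dist x y |x y. x \<in> move \<phi> ` A \<and> y \<in> move \<phi> ` B}"
    then obtain x y where "d = dist (move \<phi> x) (move \<phi> y)" "x \<in> A" "y \<in> B" by blast
    then show "d \<in> {dist x y |x y. x \<in> A \<and> y \<in> B}" by (auto simp: move_dist[OF assms])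
  qed
  then show ?thesis by (simp add: setdist_def)
qed

lemma move_diameter:
  assumes "\<phi> \<in> rigid_motions" shows "diameter (move \<phi> ` A) = diameter A"
proof -
  have "(\<lambda>(x, y). dist x y) ` (move \<phi> ` A \<times> move \<phi> ` A) = (\<lambda>(x, y). dist x y) ` (A \<times> A)"
    using move_dist[OF assms] by (force simp: image_iff)
  then show ?thesis by (simp add: diameter_def)
qed

lemma move_segment:
  "move \<phi> ` closed_segment a b = closed_segment (move \<phi> a) (move \<phi> b)"
proof -
  have "move \<phi> ((1 - u) *\<^sub>R a + u *\<^sub>R b) = (1 - u) *\<^sub>R move \<phi> a + u *\<^sub>R move \<phi> b" for u
    by (simp add: move_def scaleR_conv_of_real algebra_simps)
  then show ?thesis unfolding closed_segment_def by (force simp: image_iff)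
qed

lemma carries_inverse:
  assumes "\<phi> \<in> rigid_motions" "carries T \<phi> P Q"
  shows "carries T (inverse_motion \<phi>) Q P"
proof -
  have Q: "Q = (\<lambda>c. move \<phi> ` c) ` P" and l: "\<forall>c\<in>P. label T (move \<phi> ` c) = label T c"
    using assms by (auto simp: carries_def)
  show ?thesis unfolding carries_def Q
    using l by (auto simp: image_image inverse_motion(2)[OF assms(1)])
qed

lemma carries_compose:
  assumes "carries T \<phi> P Q" "carries T \<psi> Q R"
  shows "carries T (compose_motion \<psi> \<phi>) P R"
  using assms unfolding carries_def by (auto simp: compose_motion(3))

text \<open>A motion between patches maps tiles to tiles. So it also carries the part that is cut out by a
  condition on tiles invariant under the motion, such as containing a cell or lying within a given
  distance of it.\<close>

lemma carries_part:
  assumes \<phi>: "\<phi> \<in> rigid_motions" "carries T \<phi> (supported_on T S) (supported_on T S')"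
    and A: "\<And>t. t \<in> tiles T \<Longrightarrow> A t \<Longrightarrow> t \<in> S" and B: "\<And>t. t \<in> tiles T \<Longrightarrow> B t \<Longrightarrow> t \<in> S'"
    and AB: "\<And>t. t \<in> tiles T \<Longrightarrow> t \<in> supported_on T S \<Longrightarrow> A t \<longleftrightarrow> B (move \<phi> ` t)"
  shows "carries T \<phi> (supported_on T {t \<in> tiles T. A t}) (supported_on T {t \<in> tiles T. B t})"
proof -
  let ?P = "supported_on T S" and ?Q = "supported_on T S'"
  have im: "(\<lambda>c. move \<phi> ` c) ` ?P = ?Q" using \<phi>(2) unfolding carries_def by (rule conjunct1)
  have l: "\<forall>c\<in>?P. label T (move \<phi> ` c) = label T c" using \<phi>(2) unfolding carries_def by (rule conjunct2)
  have Q: "move \<phi> ` c \<in> ?Q" if "c \<in> ?P" for c unfolding im[symmetric] using that by (rule imageI)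
  have Q': "\<exists>c\<in>?P. d = move \<phi> ` c" if "d \<in> ?Q" for d using that unfolding im[symmetric] by blast
  have tile: "move \<phi> ` t \<in> tiles T \<longleftrightarrow> t \<in> tiles T" if "t \<in> ?P" for t
  proof -
    have "move \<phi> ` t \<in> ?Q" by (rule Q[OF that])
    then have "move \<phi> ` t \<in> cells T" "t \<in> cells T" using that by (auto simp: supported_on_def)
    then show ?thesis by (simp add: kcells_def move_aff_dim[OF \<phi>(1)])
  qed
  have "(\<lambda>c. move \<phi> ` c) ` supported_on T {t \<in> tiles T. A t} = supported_on T {t \<in> tiles T. B t}"
  proof (intro equalityI subsetI)
    fix d assume "d \<in> (\<lambda>c. move \<phi> ` c) ` supported_on T {t \<in> tiles T. A t}"
    then obtain c t where c: "d = move \<phi> ` c" "c \<in> cells T" "c \<subseteq> t" "t \<in> tiles T" "A t"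
      by (auto simp: supported_on_def)
    then have P: "c \<in> ?P" "t \<in> ?P" using A by (auto simp: supported_on_def kcells_def)
    have "d \<in> ?Q" using Q[OF P(1)] c by simp
    moreover have "move \<phi> ` t \<in> tiles T" "B (move \<phi> ` t)" using tile AB P c by auto
    ultimately show "d \<in> supported_on T {t \<in> tiles T. B t}" using c by (auto simp: supported_on_def)
  next
    fix d assume "d \<in> supported_on T {t \<in> tiles T. B t}"
    then obtain t' where d: "d \<in> cells T" "d \<subseteq> t'" "t' \<in> tiles T" "B t'" by (auto simp: supported_on_def)
    then have "d \<in> ?Q" "t' \<in> ?Q" using B by (auto simp: supported_on_def kcells_def)
    then obtain c t where c: "c \<in> ?P" "d = move \<phi> ` c" "t \<in> ?P" "t' = move \<phi> ` t" by (metis Q')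
    then have "t \<in> tiles T" using tile[of t] d by simp
    moreover then have "A t" using AB[of t] c d by simp
    moreover have "c \<subseteq> t" using d(2) c move_subset_iff[OF \<phi>(1), of c t] by simp
    ultimately have "c \<in> supported_on T {t \<in> tiles T. A t}" using c(1) by (auto simp: supported_on_def)
    then show "d \<in> (\<lambda>c. move \<phi> ` c) ` supported_on T {t \<in> tiles T. A t}" using c by blast
  qed
  moreover have "supported_on T {t \<in> tiles T. A t} \<subseteq> ?P" using A by (auto simp: supported_on_def)
  ultimately show ?thesis using l unfolding carries_def by blast
qed

locale marked_tiling = oriented_tiling T for T :: "'l marked_tiling" +
  assumes flc: "eFLC T" and star_isotropy: "trivial_star_isotropy T" and protos: "prototiles_chosen T"
begin

lemma star_tile: "t \<in> tiles T \<Longrightarrow> star T t = tile_patch T t"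
  using tile_subset_eq[of t] by (auto simp: star_def tile_patch_def supported_on_def)

lemma cell_subset_in_star: "c \<subseteq> d \<Longrightarrow> d \<in> cells T \<Longrightarrow> d \<in> star T c"
  by (rule cell_in_tile[of d]) (auto simp: star_def supported_on_def)

lemma cell_nonempty: "c \<in> cells T \<Longrightarrow> c \<noteq> {}"
  using open_cell_nonempty[of c] rel_interior_subset[of c] by auto

lemma star_transports_rigid: "\<phi> \<in> star_transports T c c' \<Longrightarrow> \<phi> \<in> rigid_motions"
  by (simp add: star_transports_def)

lemma star_transports_image: "\<phi> \<in> star_transports T c c' \<Longrightarrow> move \<phi> ` c = c'"
  by (simp add: star_transports_def)

lemma star_transports_cell:
  assumes "\<phi> \<in> star_transports T c c'" "d \<in> kcells T k" "c \<subseteq> d"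
  shows "move \<phi> ` d \<in> kcells T k" "c' \<subseteq> move \<phi> ` d"
proof -
  have \<phi>: "\<phi> \<in> rigid_motions" "move \<phi> ` c = c'" "carries T \<phi> (star T c) (star T c')"
    using assms by (auto simp: star_transports_def)
  have "d \<in> star T c" using assms by (intro cell_subset_in_star) (auto simp: kcells_def)
  then have "move \<phi> ` d \<in> star T c'" using \<phi>(3) by (auto simp: carries_def)
  then show "move \<phi> ` d \<in> kcells T k"
    using assms by (simp add: kcells_def move_aff_dim[OF \<phi>(1)] star_def supported_on_def)
  show "c' \<subseteq> move \<phi> ` d" using assms \<phi>(2) by blast
qed

lemma star_transports_inverse:
  "\<phi> \<in> star_transports T c c' \<Longrightarrow> inverse_motion \<phi> \<in> star_transports T c' c"
  unfolding star_transports_def by (auto simp: inverse_motion carries_inverse)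

text \<open>This reindexes sums over the cells around \<open>c\<close>; the inverse motion gives the inverse map.\<close>

lemma star_transports_bij:
  assumes "\<phi> \<in> star_transports T c c'"
  shows "bij_betw ((`) (move \<phi>)) {d \<in> kcells T k. c \<subseteq> d} {d \<in> kcells T k. c' \<subseteq> d}"
proof (rule bij_betw_byWitness[where f' = "(`) (move (inverse_motion \<phi>))"])
  note inv = inverse_motion(4,5)[OF star_transports_rigid[OF assms]]
  show "\<forall>d\<in>{d \<in> kcells T k. c \<subseteq> d}. move (inverse_motion \<phi>) ` move \<phi> ` d = d"
    "\<forall>d\<in>{d \<in> kcells T k. c' \<subseteq> d}. move \<phi> ` move (inverse_motion \<phi>) ` d = d"
    by (simp_all add: inv)
  show "(`) (move \<phi>) ` {d \<in> kcells T k. c \<subseteq> d} \<subseteq> {d \<in> kcells T k. c' \<subseteq> d}"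
    using star_transports_cell[OF assms] by blast
  show "(`) (move (inverse_motion \<phi>)) ` {d \<in> kcells T k. c' \<subseteq> d} \<subseteq> {d \<in> kcells T k. c \<subseteq> d}"
    using star_transports_cell[OF star_transports_inverse[OF assms]] by blast
qed

lemma star_transports_mono:
  assumes \<phi>: "\<phi> \<in> star_transports T c c'" and d: "d \<in> cells T" "c \<subseteq> d"
  shows "\<phi> \<in> star_transports T d (move \<phi> ` d)"
proof -
  have r: "\<phi> \<in> rigid_motions" by (rule star_transports_rigid[OF \<phi>])
  have "carries T \<phi> (supported_on T {t \<in> tiles T. c \<subseteq> t}) (supported_on T {t \<in> tiles T. c' \<subseteq> t})"
    using \<phi> by (simp add: star_transports_def star_def)
  then have "carries T \<phi> (supported_on T {t \<in> tiles T. d \<subseteq> t}) (supported_on T {t \<in> tiles T. move \<phi> ` d \<subseteq> t})"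
    by (rule carries_part[OF r])
       (use d star_transports_image[OF \<phi>] in \<open>auto simp: move_subset_iff[OF r]\<close>)
  then show ?thesis using r by (simp add: star_transports_def star_def)
qed

lemma transports_rigid: "\<phi> \<in> transports T c c' r \<Longrightarrow> \<phi> \<in> rigid_motions"
  by (simp add: transports_def)

lemma transports_star:
  assumes \<phi>: "\<phi> \<in> transports T c c' r" and c: "c \<in> cells T" and r: "r > 0"
  shows "\<phi> \<in> star_transports T c c'"
proof -
  have rig: "\<phi> \<in> rigid_motions" by (rule transports_rigid[OF \<phi>])
  have im: "move \<phi> ` c = c'" using \<phi> by (simp add: transports_def)
  have ne: "c \<noteq> {}" "c' \<noteq> {}" using cell_nonempty[OF c] im by auto
  have 0: "setdist t c \<le> r" if "c \<subseteq> t" "c \<noteq> {}" for t c :: "complex set"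
    using that r setdist_eq_0I[of _ t c] by (metis ex_in_conv less_imp_le subsetD)
  have "carries T \<phi> (supported_on T {t \<in> tiles T. setdist t c \<le> r}) (supported_on T {t \<in> tiles T. setdist t c' \<le> r})"
    using \<phi> by (simp add: transports_def r_patch_def)
  then have "carries T \<phi> (supported_on T {t \<in> tiles T. c \<subseteq> t}) (supported_on T {t \<in> tiles T. c' \<subseteq> t})"
    by (rule carries_part[OF rig]) (use 0 ne im in \<open>auto simp: move_subset_iff[OF rig]\<close>)
  then show ?thesis using rig im by (simp add: star_transports_def star_def)
qed

lemma tile_patch_patch: "t \<in> tiles T \<Longrightarrow> patch T (tile_patch T t)"
  using finite_subcells[of t] by (auto simp: patch_def tile_patch_def supported_on_def kcells_def)

lemma tile_in_tile_patch: "t \<in> tiles T \<Longrightarrow> t \<in> tile_patch T t"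
  by (auto simp: tile_patch_def supported_on_def kcells_def)

lemma tile_in_tile_patch_unique: "t \<in> tiles T \<Longrightarrow> t' \<in> tiles T \<Longrightarrow> t' \<in> tile_patch T t \<Longrightarrow> t' = t"
  using tile_subset_eq[of t' t] by (auto simp: tile_patch_def supported_on_def)

text \<open>Tiles with rigidly equivalent patches have the same diameter, and there are finitely many
  equivalence classes.\<close>

lemma cell_diameter_bound: obtains D where "D > 0" "\<And>c. c \<in> cells T \<Longrightarrow> diameter c \<le> D"
proof -
  let ?Q = "(tile_patch T ` tiles T) // rigid_equiv T"
  have fin: "finite ?Q" using flc by (simp add: eFLC_def)
  define \<delta> where "\<delta> X = diameter (\<Union>(SOME P. P \<in> X))" for X :: "complex set set set"
  have "diameter t \<in> \<delta> ` ?Q" if t: "t \<in> tiles T" for t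
  proof -
    define X where "X = rigid_equiv T `` {tile_patch T t}"
    have "(0, 1) \<in> rigid_motions" "move (0, 1) = id" by (auto simp: rigid_motions_def move_def)
    then have "(tile_patch T t, tile_patch T t) \<in> rigid_equiv T"
      using tile_patch_patch[OF t] by (auto simp: rigid_equiv_def carries_def intro!: bexI[of _ "(0, 1)"])
    then have "\<exists>P. P \<in> X" by (auto simp: X_def)
    then have "(SOME P. P \<in> X) \<in> X" by (rule someI_ex)
    then obtain \<phi> where \<phi>: "\<phi> \<in> rigid_motions" "carries T \<phi> (tile_patch T t) (SOME P. P \<in> X)"
      by (auto simp: X_def rigid_equiv_def)
    have "\<Union>(tile_patch T t) = t" using t by (auto simp: tile_patch_def supported_on_def kcells_def)
    moreover have Y: "(\<lambda>c. move \<phi> ` c) ` tile_patch T t = (SOME P. P \<in> X)"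
      using \<phi>(2) unfolding carries_def by (rule conjunct1)
    have "\<Union>(SOME P. P \<in> X) = move \<phi> ` \<Union>(tile_patch T t)"
      unfolding Y[symmetric] by (simp only: image_Union)
    ultimately have "\<delta> X = diameter t" using move_diameter[OF \<phi>(1)] by (simp add: \<delta>_def)
    moreover have "X \<in> ?Q" using t by (auto simp: X_def quotient_def)
    ultimately show ?thesis by (metis image_eqI)
  qed
  then have fin: "finite (diameter ` tiles T)" using fin by (meson finite_imageI finite_subset image_subsetI)
  define D where "D = Max (insert 1 (diameter ` tiles T))"
  have "diameter c \<le> D" if c: "c \<in> cells T" for c
  proof -
    obtain t where t: "t \<in> tiles T" "c \<subseteq> t" by (rule cell_in_tile[OF c])
    then have "bounded t" using cell_compact compact_imp_bounded kcells_cells by blast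
    then have "diameter c \<le> diameter t" using t by (intro diameter_subset)
    also have "\<dots> \<le> D" using fin t by (auto simp: D_def intro: Max_ge)
    finally show ?thesis .
  qed
  moreover have "D \<ge> 1" using fin by (simp add: D_def)
  ultimately show ?thesis using that[of D] by simp
qed

text \<open>A tile within distance \<open>r\<close> of \<open>d\<close> is within distance \<open>r + diameter d\<close> of the smaller cell \<open>c\<close>. So
  large patches at \<open>c\<close> determine patches at all cells around \<open>c\<close>. As diameters are bounded, this
  is why boundaries of pattern-equivariant chains are pattern-equivariant.\<close>

lemma transports_mono:
  assumes \<phi>: "\<phi> \<in> transports T c c' R" and c: "c \<in> cells T" and d: "d \<in> cells T" "c \<subseteq> d"
    and R: "r > 0" "diameter d + r \<le> R"
  shows "\<phi> \<in> transports T d (move \<phi> ` d) r"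
proof -
  have rig: "\<phi> \<in> rigid_motions" by (rule transports_rigid[OF \<phi>])
  have im: "move \<phi> ` c = c'" using \<phi> by (simp add: transports_def)
  have ne: "c \<noteq> {}" using cell_nonempty[OF c] .
  have cpt: "compact d" by (rule cell_compact[OF d(1)])
  have far: "setdist t c \<le> R"
    if "setdist t d \<le> r" "c \<noteq> {}" "c \<subseteq> d" "t \<noteq> {}" "closed t" "compact d" "diameter d + r \<le> R" for t c d :: "complex set"
  proof -
    have "\<exists>x\<in>d. \<exists>y\<in>t. dist x y = setdist d t"
      using that by (intro setdist_compact_closed) auto
    then obtain x y where xy: "x \<in> d" "y \<in> t" "dist x y = setdist d t" by blast
    from \<open>c \<noteq> {}\<close> obtain z where z: "z \<in> c" by blast
    have "setdist t c \<le> dist y z" using xy z by (intro setdist_le_dist)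
    also have "\<dots> \<le> dist x y + dist x z" by (simp add: dist_triangle3)
    also have "dist x z \<le> diameter d"
      using xy z that by (intro diameter_bounded_bound compact_imp_bounded) auto
    finally show ?thesis using xy that by (simp add: setdist_sym)
  qed
  have "carries T \<phi> (supported_on T {t \<in> tiles T. setdist t c \<le> R}) (supported_on T {t \<in> tiles T. setdist t c' \<le> R})"
    using \<phi> by (simp add: transports_def r_patch_def)
  then have "carries T \<phi> (supported_on T {t \<in> tiles T. setdist t d \<le> r})
      (supported_on T {t \<in> tiles T. setdist t (move \<phi> ` d) \<le> r})"
  proof (rule carries_part[OF rig])
    fix t assume t: "t \<in> tiles T"
    have t': "closed t" "t \<noteq> {}" using cell_closed cell_nonempty kcells_cells[OF t] by auto
    show "setdist t d \<le> r \<Longrightarrow> t \<in> {t \<in> tiles T. setdist t c \<le> R}"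
      using far[of t d c] ne t t' cpt d R by blast
    have "continuous_on d (move \<phi>)" unfolding move_def by (intro continuous_intros)
    then have "compact (move \<phi> ` d)" using cpt by (rule compact_continuous_image)
    moreover have "c' \<subseteq> move \<phi> ` d" "c' \<noteq> {}" "diameter (move \<phi> ` d) + r \<le> R"
      using d im ne R move_diameter[OF rig] by auto
    ultimately show "setdist t (move \<phi> ` d) \<le> r \<Longrightarrow> t \<in> {t \<in> tiles T. setdist t c' \<le> R}"
      using far[of t "move \<phi> ` d" c'] t t' by blast
    show "setdist t d \<le> r \<longleftrightarrow> setdist (move \<phi> ` t) (move \<phi> ` d) \<le> r"
      by (simp add: move_setdist[OF rig])
  qed
  then show ?thesis using rig by (simp add: transports_def r_patch_def)
qed

lemma transports_antimono:
  assumes \<phi>: "\<phi> \<in> transports T c c' R" and r: "r \<le> R"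
  shows "\<phi> \<in> transports T c c' r"
proof -
  have rig: "\<phi> \<in> rigid_motions" by (rule transports_rigid[OF \<phi>])
  have im: "move \<phi> ` c = c'" using \<phi> by (simp add: transports_def)
  have "carries T \<phi> (supported_on T {t \<in> tiles T. setdist t c \<le> R}) (supported_on T {t \<in> tiles T. setdist t c' \<le> R})"
    using \<phi> by (simp add: transports_def r_patch_def)
  then have "carries T \<phi> (supported_on T {t \<in> tiles T. setdist t c \<le> r}) (supported_on T {t \<in> tiles T. setdist t c' \<le> r})"
    by (rule carries_part[OF rig]) (use r in \<open>auto simp: im[symmetric] move_setdist[OF rig]\<close>)
  then show ?thesis using rig im by (simp add: transports_def r_patch_def)
qed

subsection \<open>Rotation angles of tiles\<close>

lemma proto: "t \<in> tiles T \<Longrightarrow> proto T t \<in> tiles T"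
  using protos by (simp add: prototiles_chosen_def)

text \<open>Two motions from the prototile to \<open>t\<close> differ by a symmetry of the prototile. It fixes the
  prototile pointwise, hence it is the identity.\<close>

lemma tau_ex1:
  assumes t: "t \<in> tiles T"
  shows "\<exists>!g. \<exists>b. (b, g) \<in> rigid_motions \<and> carries T (b, g) (tile_patch T (proto T t)) (tile_patch T t)"
proof -
  define p where "p = proto T t"
  have p: "p \<in> tiles T" unfolding p_def by (rule proto[OF t])
  have "(tile_patch T p, tile_patch T t) \<in> rigid_equiv T"
    using protos t by (simp add: prototiles_chosen_def p_def)
  then obtain \<phi> where \<phi>: "\<phi> \<in> rigid_motions" "carries T \<phi> (tile_patch T p) (tile_patch T t)"
    by (auto simp: rigid_equiv_def)
  have uniq: "g = g'" if g: "(b, g) \<in> rigid_motions" "carries T (b, g) (tile_patch T p) (tile_patch T t)"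
    and g': "(b', g') \<in> rigid_motions" "carries T (b', g') (tile_patch T p) (tile_patch T t)" for b g b' g'
  proof -
    define \<psi> where "\<psi> = compose_motion (inverse_motion (b', g')) (b, g)"
    have \<psi>: "\<psi> \<in> rigid_motions" "carries T \<psi> (tile_patch T p) (tile_patch T p)"
      unfolding \<psi>_def using compose_motion(1)[OF g(1) inverse_motion(1)[OF g'(1)]]
        carries_compose[OF g(2) carries_inverse[OF g']] by auto
    have "move \<psi> ` p \<in> tile_patch T p" using \<psi>(2) tile_in_tile_patch[OF p] by (auto simp: carries_def)
    moreover then have "move \<psi> ` p \<in> tiles T"
      using p by (simp add: kcells_def move_aff_dim[OF \<psi>(1)] tile_patch_def supported_on_def)
    ultimately have "move \<psi> ` p = p" using tile_in_tile_patch_unique[OF p] by blast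
    then have "\<psi> \<in> star_transports T p p" using \<psi> by (simp add: star_transports_def star_tile[OF p])
    then have fx: "move \<psi> x = x" if "x \<in> p" for x
      using star_isotropy p that kcells_cells unfolding trivial_star_isotropy_def by blast
    have "interior p \<noteq> {}" by (rule tile_closure_interior(3)[OF p])
    then have "infinite p" using finite_imp_closed[of p] interior_subset[of p]
      by (metis empty_interior_finite)
    then obtain x y where xy: "x \<in> p" "y \<in> p" "x \<noteq> y" by (metis finite.simps insertCI insertI1 is_singletonI' is_singleton_def finite.emptyI)
    have "snd \<psi> * (x - y) = move \<psi> x - move \<psi> y" by (simp add: move_def algebra_simps)
    also have "\<dots> = x - y" by (simp only: fx[OF xy(1)] fx[OF xy(2)])
    finally have "snd \<psi> * (x - y) = x - y" .
    then have "snd \<psi> = 1" using xy by simp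
    moreover have "g' \<noteq> 0" using g'(1) by (auto simp: rigid_motions_def)
    ultimately show ?thesis by (simp add: \<psi>_def compose_motion_def inverse_motion_def)
  qed
  show ?thesis unfolding p_def[symmetric]
  proof (rule ex1I[of _ "snd \<phi>"])
    show "\<exists>b. (b, snd \<phi>) \<in> rigid_motions \<and> carries T (b, snd \<phi>) (tile_patch T p) (tile_patch T t)"
      using \<phi> by (intro exI[of _ "fst \<phi>"]) simp
    fix g assume "\<exists>b. (b, g) \<in> rigid_motions \<and> carries T (b, g) (tile_patch T p) (tile_patch T t)"
    then show "g = snd \<phi>" using uniq \<phi> by (metis prod.collapse)
  qed
qed

lemma tau_spec:
  assumes "t \<in> tiles T"
  obtains b where "(b, tau T t) \<in> rigid_motions" "carries T (b, tau T t) (tile_patch T (proto T t)) (tile_patch T t)"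
  using theI'[OF tau_ex1[OF assms]] that unfolding tau_def by blast

lemma tau_norm: "t \<in> tiles T \<Longrightarrow> norm (tau T t) = 1"
  by (rule tau_spec[of t]) (auto simp: rigid_motions_def)

lemma tau_move_patch:
  assumes t: "t \<in> tiles T" "t' \<in> tiles T"
    and \<phi>: "\<phi> \<in> rigid_motions" "carries T \<phi> (tile_patch T t) (tile_patch T t')"
  shows "tau T t' = snd \<phi> * tau T t"
proof -
  have "(tile_patch T t, tile_patch T t') \<in> rigid_equiv T"
    using \<phi> tile_patch_patch t by (auto simp: rigid_equiv_def)
  then have p: "proto T t = proto T t'" using protos t by (simp add: prototiles_chosen_def)
  obtain b where b: "(b, tau T t) \<in> rigid_motions" "carries T (b, tau T t) (tile_patch T (proto T t)) (tile_patch T t)"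
    using tau_spec[OF t(1)] by blast
  have "compose_motion \<phi> (b, tau T t) \<in> rigid_motions"
    "carries T (compose_motion \<phi> (b, tau T t)) (tile_patch T (proto T t')) (tile_patch T t')"
    using compose_motion(1)[OF b(1) \<phi>(1)] carries_compose[OF b(2) \<phi>(2)] p by auto
  then have "\<exists>b'. (b', snd \<phi> * tau T t) \<in> rigid_motions \<and>
      carries T (b', snd \<phi> * tau T t) (tile_patch T (proto T t')) (tile_patch T t')"
    unfolding compose_motion_def by auto
  then show ?thesis using the1_equality[OF tau_ex1[OF t(2)]] unfolding tau_def by blast
qed

lemma tau_move:
  assumes \<phi>: "\<phi> \<in> star_transports T c c'" and t: "t \<in> tiles T" "c \<subseteq> t"
  shows "tau T (move \<phi> ` t) = snd \<phi> * tau T t"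
proof -
  have "\<phi> \<in> star_transports T t (move \<phi> ` t)" by (rule star_transports_mono[OF \<phi> kcells_cells[OF t(1)] t(2)])
  moreover have t': "move \<phi> ` t \<in> tiles T" by (rule star_transports_cell[OF \<phi> t])
  ultimately show ?thesis
    using t star_tile star_transports_rigid[OF \<phi>]
    by (intro tau_move_patch) (auto simp: star_transports_def)
qed

lemma finite_cofaces: "d \<in> cells T \<Longrightarrow> finite {c \<in> kcells T k. d \<subseteq> c}"
proof -
  assume d: "d \<in> cells T"
  then obtain x where "x \<in> d" using cell_nonempty by blast
  then show ?thesis by (intro finite_subset[OF _ finite_cells_at[of x]]) (auto simp: kcells_def)
qed

lemma cuts_finite: "c \<in> cells T \<Longrightarrow> finite (cuts T c)"
  using finite_cofaces[of c 2] by (simp add: cuts_def)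

lemma cuts_sphere: "cuts T c \<subseteq> sphere 0 1"
  using tau_norm by (auto simp: cuts_def)

lemma cuts_mono: "c \<subseteq> d \<Longrightarrow> cuts T d \<subseteq> cuts T c"
  by (auto simp: cuts_def)

lemma cuts_tile: "t \<in> tiles T \<Longrightarrow> cuts T t = {tau T t, - tau T t}"
  using tile_subset_eq[of t] by (auto simp: cuts_def)

lemma tiles_of_edge:
  assumes e: "e \<in> kcells T 1" shows "{t \<in> tiles T. e \<subseteq> t} = {left_tile T e, right_tile T e}"
proof -
  obtain x where x: "x \<in> rel_interior e" using open_cell_nonempty kcells_cells[OF e] by blast
  then have "x \<in> e" using rel_interior_subset by blast
  then show ?thesis using tile_at_edge[OF e _ x] left_tile_side[OF e] right_tile_side[OF e] by blast
qed

lemma cuts_edge: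
  "e \<in> kcells T 1 \<Longrightarrow>
    cuts T e = {tau T (left_tile T e), - tau T (left_tile T e), tau T (right_tile T e), - tau T (right_tile T e)}"
  by (simp add: cuts_def tiles_of_edge insert_commute)

lemma cuts_move:
  assumes \<phi>: "\<phi> \<in> star_transports T c c'"
  shows "cuts T c' = (*) (snd \<phi>) ` cuts T c"
proof -
  have "{t \<in> tiles T. c' \<subseteq> t} = (`) (move \<phi>) ` {t \<in> tiles T. c \<subseteq> t}"
    using star_transports_bij[OF \<phi>, of 2] by (simp add: bij_betw_def)
  then have "cuts T c' = (\<Union>t\<in>{t \<in> tiles T. c \<subseteq> t}. {tau T (move \<phi> ` t), - tau T (move \<phi> ` t)})"
    unfolding cuts_def by simp
  also have "\<dots> = (\<Union>t\<in>{t \<in> tiles T. c \<subseteq> t}. (*) (snd \<phi>) ` {tau T t, - tau T t})"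
    using tau_move[OF \<phi>] by (intro SUP_cong) auto
  finally show ?thesis by (simp add: cuts_def image_UN)
qed

subsection \<open>Equivariance of the two sides of an edge\<close>

text \<open>The sides of an edge are defined by its direction and the tiles at it, and a motion of stars
  preserves both.\<close>

lemma edge_move:
  assumes \<phi>: "\<phi> \<in> star_transports T e e'" and e: "e \<in> kcells T 1" "e' \<in> kcells T 1"
  shows "tail T e' = move \<phi> (tail T e)" "head T e' = move \<phi> (head T e)"
    "left_tile T e' = move \<phi> ` left_tile T e" "right_tile T e' = move \<phi> ` right_tile T e"
proof -
  have r: "\<phi> \<in> rigid_motions" by (rule star_transports_rigid[OF \<phi>])
  have "\<forall>e\<in>kcells T 1. \<forall>e'\<in>kcells T 1. \<forall>\<phi>\<in>star_transports T e e'.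
        move \<phi> (tail T e) = tail T e' \<and> move \<phi> (head T e) = head T e'"
    using oriented unfolding consistently_oriented_def by (elim conjE) assumption
  then show th: "tail T e' = move \<phi> (tail T e)" "head T e' = move \<phi> (head T e)" using \<phi> e by metis+
  have ri: "\<exists>y\<in>rel_interior e. x = move \<phi> y" if "x \<in> rel_interior e'" for x
  proof -
    have "x \<in> closed_segment (move \<phi> (tail T e)) (move \<phi> (head T e))" "x \<noteq> move \<phi> (tail T e)" "x \<noteq> move \<phi> (head T e)"
      using that unfolding edge_segment(3)[OF e(2)] th by (auto simp: open_segment_def)
    then obtain y where "y \<in> closed_segment (tail T e) (head T e)" "x = move \<phi> y"
      unfolding move_segment[symmetric] by blast
    then show ?thesis using \<open>x \<noteq> move \<phi> (tail T e)\<close> \<open>x \<noteq> move \<phi> (head T e)\<close>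
      unfolding edge_segment(3)[OF e(1)] by (auto simp: open_segment_def)
  qed
  have mv: "move \<phi> y + s * (\<i> * (head T e' - tail T e')) = move \<phi> (y + s * (\<i> * (head T e - tail T e)))" for y s
    unfolding th by (simp add: move_def algebra_simps)
  have side: "side_tile \<sigma> e' = move \<phi> ` side_tile \<sigma> e" if \<sigma>: "\<sigma> = 1 \<or> \<sigma> = - 1" for \<sigma>
  proof -
    have near: "\<forall>x\<in>rel_interior e. \<forall>\<^sub>F s in at_right 0. x + of_real (\<sigma> * s) * (\<i> * (head T e - tail T e)) \<in> side_tile \<sigma> e"
      using lies_iff[OF \<sigma>, of e "side_tile \<sigma> e"] side_tile(1)[OF e(1) \<sigma>, of "side_tile \<sigma> e"] by blast
    have "\<forall>\<^sub>F s in at_right 0. x + of_real (\<sigma> * s) * (\<i> * (head T e' - tail T e')) \<in> move \<phi> ` side_tile \<sigma> e"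
      if x: "x \<in> rel_interior e'" for x
    proof -
      obtain y where y: "y \<in> rel_interior e" "x = move \<phi> y" using ri[OF x] by blast
      show ?thesis unfolding y(2) mv using near y(1) by (auto elim!: eventually_mono)
    qed
    then show ?thesis
      using lies_iff[OF \<sigma>, of e' "move \<phi> ` side_tile \<sigma> e"] side_tile(1)[OF e(2) \<sigma>, of "move \<phi> ` side_tile \<sigma> e"]
        star_transports_cell[OF \<phi> side_tile(2,3)[OF e(1) \<sigma>]] by blast
  qed
  show "left_tile T e' = move \<phi> ` left_tile T e" "right_tile T e' = move \<phi> ` right_tile T e"
    using side[of 1] side[of "- 1"] by (simp_all add: side_tile_def)
qed

lemma turn_sign: "t \<in> tiles T \<Longrightarrow> turn T t = 1 \<or> turn T t = - 1"
  using oriented unfolding consistently_oriented_def by (elim conjE) (erule (1) bspec)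

lemma turn_move:
  assumes \<phi>: "\<phi> \<in> star_transports T c c'" and t: "t \<in> tiles T" "c \<subseteq> t"
  shows "turn T (move \<phi> ` t) = turn T t"
proof -
  have "\<phi> \<in> star_transports T t (move \<phi> ` t)" by (rule star_transports_mono[OF \<phi> kcells_cells[OF t(1)] t(2)])
  moreover have t': "move \<phi> ` t \<in> tiles T" by (rule star_transports_cell[OF \<phi> t])
  moreover have "\<forall>t\<in>tiles T. \<forall>t'\<in>tiles T. star_transports T t t' \<noteq> {} \<longrightarrow> turn T t = turn T t'"
    using oriented unfolding consistently_oriented_def by (elim conjE) assumption
  ultimately show ?thesis using t by (metis empty_iff)
qed

lemma incidence_move:
  assumes \<phi>: "\<phi> \<in> star_transports T v v'" and v: "v \<in> kcells T 0" "v' \<in> kcells T 0"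
    and e: "e \<in> kcells T 1" "v \<subseteq> e"
  shows "incidence T (move \<phi> ` e) v' = incidence T e v"
proof -
  have e': "move \<phi> ` e \<in> kcells T 1" by (rule star_transports_cell[OF \<phi> e])
  have "\<phi> \<in> star_transports T e (move \<phi> ` e)" by (rule star_transports_mono[OF \<phi> kcells_cells[OF e(1)] e(2)])
  note th = edge_move[OF this e(1) e']
  have "v' = move \<phi> ` v" using star_transports_image[OF \<phi>] by simp
  then have "move \<phi> x \<in> v' \<longleftrightarrow> x \<in> v" for x
    using inj_image_mem_iff[OF move_inj[OF star_transports_rigid[OF \<phi>]]] by simp
  then show ?thesis using incidence_edge[OF e(1) v(1)] incidence_edge[OF e' v(2)] th by simp
qed

end

section \<open>Boundaries of chains on the group of rigid motions\<close>

lemma cellular_boundary_sum: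
  assumes "y \<in> C (n - 1)" and S: "finite S" "\<And>z. z \<in> C n \<Longrightarrow> inc z y \<noteq> 0 \<Longrightarrow> z \<in> S"
    and x: "\<forall>z. z \<notin> C n \<longrightarrow> x z = 0"
  shows "cellular_boundary C inc n x y = (\<Sum>z\<in>S. inc z y * x z)"
proof -
  have "(\<Sum>z | z \<in> C n \<and> inc z y \<noteq> 0. inc z y * x z) = (\<Sum>z\<in>S. inc z y * x z)"
    using S x by (intro sum.mono_neutral_left) auto
  then show ?thesis using assms(1) by (simp add: cellular_boundary_def)
qed

lemma cellular_boundary_outside: "y \<notin> C (n - 1) \<Longrightarrow> cellular_boundary C inc n x y = 0"
  by (simp add: cellular_boundary_def)

lemma cellular_boundary_diff:
  "cellular_boundary C inc n (\<lambda>c. a c - b c) = (\<lambda>c. cellular_boundary C inc n a c - cellular_boundary C inc n b c)"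
  by (rule ext) (simp add: cellular_boundary_def sum_subtractf right_diff_distrib)

lemma sum_doubleton_diff:
  fixes f :: "'b \<Rightarrow> int"
  shows "(\<Sum>z\<in>{a, b}. k * (of_bool (z = a) - of_bool (z = b)) * f z) = k * (f a - f b)"
  by (cases "a = b") (auto simp: algebra_simps)

context marked_tiling
begin

abbreviation arc :: "complex set \<Rightarrow> complex \<Rightarrow> complex set" where
  "arc c p \<equiv> arc_at (cuts T c) p"

abbreviation arc_before :: "complex set \<Rightarrow> complex \<Rightarrow> complex set" where
  "arc_before c g \<equiv> arc_beside (- 1) (cuts T c) g"

abbreviation arc_after :: "complex set \<Rightarrow> complex \<Rightarrow> complex set" where
  "arc_after c g \<equiv> arc_beside 1 (cuts T c) g"

abbreviation off_cuts :: "complex set \<Rightarrow> complex set" where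
  "off_cuts c \<equiv> sphere 0 1 - cuts T c"

abbreviation edges_at :: "complex set \<Rightarrow> complex set set" where
  "edges_at v \<equiv> {e \<in> kcells T 1. v \<subseteq> e}"

lemma arc_in_arcs: "p \<in> off_cuts c \<Longrightarrow> arc c p \<in> arcs T c"
  by (simp add: arcs_eq)

lemma arcsE: "I \<in> arcs T c \<Longrightarrow> (\<And>p. p \<in> off_cuts c \<Longrightarrow> I = arc c p \<Longrightarrow> thesis) \<Longrightarrow> thesis"
  by (auto simp: arcs_eq)

lemma beside_in_arcs:
  "c \<in> cells T \<Longrightarrow> norm g = 1 \<Longrightarrow> \<sigma> = 1 \<or> \<sigma> = - 1 \<Longrightarrow> arc_beside \<sigma> (cuts T c) g \<in> arcs T c"
  by (simp add: arcs_eq arc_beside_in cuts_finite)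

lemma obtain_off_cuts:
  assumes "c \<in> cells T" obtains p where "p \<in> off_cuts c"
proof -
  obtain s where "1 * cis (1 * s) \<in> off_cuts c"
    by (rule obtain_beside[OF cuts_finite[OF assms], of 1 1 "\<lambda>_. True"]) auto
  then show ?thesis using that by blast
qed

lemma arcs_not_singleton: "c \<in> cells T \<Longrightarrow> I \<in> arcs T c \<Longrightarrow> \<not> is_singleton I"
  by (erule arcsE) (simp add: arc_at_not_singleton cuts_finite)

lemma kcells_eq: "c \<in> kcells T j \<Longrightarrow> c \<in> kcells T k \<Longrightarrow> j = k"
  by (simp add: kcells_def)

lemma kcells_range:
  assumes "c \<in> kcells T k" shows "k = 0 \<or> k = 1 \<or> k = 2"
proof -
  have "c \<in> cells T" using assms by (rule kcells_cells)
  then show ?thesis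
  proof (cases rule: cell_dim_cases)
    case 1 show ?thesis using kcells_eq[OF assms 1] by simp
  next
    case 2 show ?thesis using kcells_eq[OF assms 2] by simp
  next
    case 3 show ?thesis using kcells_eq[OF assms 3] by simp
  qed
qed

lemma rot_cells_iff:
  "(c, A) \<in> rot_cells T n \<longleftrightarrow>
    (c \<in> kcells T n \<and> (\<exists>g\<in>cuts T c. A = {g})) \<or> (c \<in> kcells T (n - 1) \<and> A \<in> arcs T c)"
  by (auto simp: rot_cells_def)

lemma rot_cell_arc_iff:
  assumes "c \<in> cells T" "I \<in> arcs T c"
  shows "(c, I) \<in> rot_cells T n \<longleftrightarrow> c \<in> kcells T (n - 1)"
  using arcs_not_singleton[OF assms] assms by (auto simp: rot_cells_iff)

lemma rot_cell_point_iff: "(c, {g}) \<in> rot_cells T n \<longleftrightarrow> c \<in> kcells T n \<and> g \<in> cuts T c"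
  using arcs_not_singleton[of c "{g}"] kcells_cells[of c] by (auto simp: rot_cells_iff)

lemma vertex_subset_iff:
  assumes "v \<in> kcells T 0" "x \<in> v" shows "v \<subseteq> c \<longleftrightarrow> x \<in> c"
proof -
  obtain w where "v = {w}" using assms(1) by (rule vertex_point)
  then show ?thesis using assms(2) by simp
qed

lemma edge_ends: "e \<in> kcells T 1 \<Longrightarrow> tail T e \<in> e \<and> head T e \<in> e"
  using in_edge_iff[of e] by simp

lemma incidence_coface:
  assumes d: "d \<in> kcells T k" and c: "c \<in> cells T" "incidence T c d \<noteq> 0"
  shows "c \<in> kcells T (k + 1)" "d \<subseteq> c"
proof -
  have "c \<in> kcells T (k + 1) \<and> d \<subseteq> c"
  proof (cases "c \<in> kcells T 1 \<and> d \<in> kcells T 0")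
    case True
    then have "head T c \<in> d \<or> tail T c \<in> d" using c incidence_edge[of c d] by auto
    then show ?thesis using True vertex_subset_iff[of d] edge_ends[of c] kcells_eq[OF d, of 0] by auto
  next
    case False
    then have t: "c \<in> tiles T" "d \<in> kcells T 1" using c by (auto simp: incidence_def split: if_splits)
    then have "c = left_tile T d \<or> c = right_tile T d"
      using c(2) incidence_tile[OF t] by (cases "c = left_tile T d"; cases "c = right_tile T d") simp_all
    then show ?thesis using t left_tile_side(2)[OF t(2)] right_tile_side(2)[OF t(2)] kcells_eq[OF d t(2)] by auto
  qed
  then show "c \<in> kcells T (k + 1)" "d \<subseteq> c" by auto
qed

lemma sum_tiles_of_edge:
  assumes e: "e \<in> kcells T 1"
  shows "(\<Sum>t | t \<in> tiles T \<and> e \<subseteq> t. incidence T t e * f t) =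
    turn T (left_tile T e) * f (left_tile T e) - turn T (right_tile T e) * f (right_tile T e)"
  unfolding tiles_of_edge[OF e]
  using incidence_tile[OF left_tile_side(1)[OF e] e] incidence_tile[OF right_tile_side(1)[OF e] e]
  by (cases "left_tile T e = right_tile T e") simp_all

text \<open>The part of the boundary inside a fibre circle. The sign comes from the product orientation.\<close>

lemma sum_fibre:
  assumes c: "c \<in> kcells T k" and g: "g \<in> cuts T c"
  shows "(\<Sum>z\<in>{(c, arc_before c g), (c, arc_after c g)}. rot_incidence T z (c, {g}) * x z) =
    (- 1) ^ nat k * (x (c, arc_before c g) - x (c, arc_after c g))"
proof -
  have cc: "c \<in> cells T" using c by (rule kcells_cells)
  have ng: "norm g = 1" using g cuts_sphere by fastforce
  have inc: "rot_incidence T (c, I) (c, {g}) = (- 1) ^ nat k * (of_bool (I = arc_before c g) - of_bool (I = arc_after c g))"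
    if "I \<in> arcs T c" for I
    using that arc_incidence_beside[OF cuts_finite[OF cc] ng, of I] c
    by (simp add: rot_incidence_def arcs_eq kcells_def)
  have "(\<Sum>z\<in>{(c, arc_before c g), (c, arc_after c g)}. rot_incidence T z (c, {g}) * x z) =
    (\<Sum>z\<in>{(c, arc_before c g), (c, arc_after c g)}.
      (- 1) ^ nat k * (of_bool (z = (c, arc_before c g)) - of_bool (z = (c, arc_after c g))) * x z)"
    by (rule sum.cong) (use inc beside_in_arcs[OF cc ng] in auto)
  then show ?thesis by (simp only: sum_doubleton_diff)
qed

lemma fibre_support:
  assumes c: "c \<in> kcells T k" and g: "g \<in> cuts T c"
    and z: "(c, A) \<in> rot_cells T (k + 1)" "rot_incidence T (c, A) (c, {g}) \<noteq> 0"
  shows "A = arc_before c g \<or> A = arc_after c g"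
proof -
  have cc: "c \<in> cells T" using c by (rule kcells_cells)
  have ng: "norm g = 1" using g cuts_sphere by fastforce
  have "c \<notin> kcells T (k + 1)" using kcells_eq[OF c, of "k + 1"] by auto
  then have "A \<in> arcs T c" using z(1) by (auto simp: rot_cells_iff)
  then have "arc_incidence A g = of_bool (A = arc_before c g) - of_bool (A = arc_after c g)"
    using arc_incidence_beside[OF cuts_finite[OF cc] ng, of A] by (simp add: arcs_eq)
  moreover have "arc_incidence A g \<noteq> 0" using z(2) by (simp add: rot_incidence_def)
  ultimately show ?thesis by (cases "A = arc_before c g"; cases "A = arc_after c g") simp_all
qed

text \<open>The circle over \<open>d\<close> is cut at least as finely as the circle over a cell \<open>c\<close> that contains
  \<open>d\<close>. So an arc over \<open>d\<close> lies in exactly one arc over \<open>c\<close>, the one through the same points.\<close>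

lemma boundary_at_arc:
  assumes x: "\<forall>z. z \<notin> rot_cells T (k + 2) \<longrightarrow> x z = 0" and d: "d \<in> kcells T k" and p: "p \<in> off_cuts d"
  shows "PE_boundary T (k + 2) x (d, arc d p) =
    (\<Sum>c | c \<in> kcells T (k + 1) \<and> d \<subseteq> c. incidence T c d * x (c, arc c p))"
proof -
  let ?y = "(d, arc d p)" and ?C = "{c \<in> kcells T (k + 1). d \<subseteq> c}"
  have dc: "d \<in> cells T" using d by (rule kcells_cells)
  have "PE_boundary T (k + 2) x ?y = (\<Sum>z\<in>(\<lambda>c. (c, arc c p)) ` ?C. rot_incidence T z ?y * x z)"
    unfolding PE_boundary_def
  proof (rule cellular_boundary_sum)
    show "?y \<in> rot_cells T (k + 2 - 1)" using rot_cell_arc_iff[OF dc arc_in_arcs[OF p]] d by simp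
    show "\<forall>z. z \<notin> rot_cells T (k + 2) \<longrightarrow> x z = 0" by (rule x)
    show "finite ((\<lambda>c. (c, arc c p)) ` ?C)" using finite_cofaces[OF dc] by simp
    fix z assume z: "z \<in> rot_cells T (k + 2)" "rot_incidence T z ?y \<noteq> 0"
    obtain c A where cA: "z = (c, A)" by (cases z)
    have c: "c \<in> cells T" using z cA by (auto simp: rot_cells_iff kcells_def)
    have z': "c \<in> kcells T (k + 2) \<or> c \<in> kcells T (k + 1) \<and> A \<in> arcs T c"
      using z(1) by (auto simp: cA rot_cells_iff add.commute)
    then have "c \<noteq> d" using kcells_eq[OF d, of "k + 2"] kcells_eq[OF d, of "k + 1"] by auto
    then have sub: "arc d p \<subseteq> A" "incidence T c d \<noteq> 0"
      using z(2) cA by (auto simp: rot_incidence_def split: if_splits)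
    note cf = incidence_coface[OF d c sub(2)]
    then have "A \<in> arcs T c" using z' kcells_eq[OF cf(1), of "k + 2"] by auto
    then obtain q where q: "q \<in> off_cuts c" "A = arc c q" by (rule arcsE)
    then have "A = arc c p" using arc_at_superset_iff[OF cuts_mono[OF cf(2)] p q(1)] sub(1) by simp
    then show "z \<in> (\<lambda>c. (c, arc c p)) ` ?C" using cf cA by blast
  qed
  also have "\<dots> = (\<Sum>c\<in>?C. rot_incidence T (c, arc c p) ?y * x (c, arc c p))"
    by (subst sum.reindex) (auto simp: inj_on_def)
  also have "\<dots> = (\<Sum>c\<in>?C. incidence T c d * x (c, arc c p))"
  proof (rule sum.cong[OF refl])
    fix c assume c: "c \<in> ?C"
    then have "c \<noteq> d" using kcells_eq[OF d, of "k + 1"] by auto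
    moreover have "arc d p \<subseteq> arc c p" using c cuts_mono[of d c] by (intro arc_at_mono) auto
    ultimately show "rot_incidence T (c, arc c p) ?y * x (c, arc c p) = incidence T c d * x (c, arc c p)"
      by (simp add: rot_incidence_def)
  qed
  finally show ?thesis .
qed

lemma boundary_at_point:
  assumes x: "\<forall>z. z \<notin> rot_cells T (k + 1) \<longrightarrow> x z = 0" and d: "d \<in> kcells T k" and g: "g \<in> cuts T d"
  shows "PE_boundary T (k + 1) x (d, {g}) =
    (\<Sum>c | c \<in> kcells T (k + 1) \<and> d \<subseteq> c. incidence T c d * x (c, {g}))
    + (- 1) ^ nat k * (x (d, arc_before d g) - x (d, arc_after d g))"
proof -
  let ?y = "(d, {g})" and ?C = "{c \<in> kcells T (k + 1). d \<subseteq> c}"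
  let ?S = "(\<lambda>c. (c, {g})) ` ?C" and ?S' = "{(d, arc_before d g), (d, arc_after d g)}"
  have fin: "finite ?C" by (rule finite_cofaces[OF kcells_cells[OF d]])
  have ne: "c \<noteq> d" if "c \<in> ?C" for c using that kcells_eq[OF d, of "k + 1"] by auto
  have "PE_boundary T (k + 1) x ?y = (\<Sum>z\<in>?S \<union> ?S'. rot_incidence T z ?y * x z)"
    unfolding PE_boundary_def
  proof (rule cellular_boundary_sum)
    show "?y \<in> rot_cells T (k + 1 - 1)" using d g by (simp add: rot_cell_point_iff)
    show "\<forall>z. z \<notin> rot_cells T (k + 1) \<longrightarrow> x z = 0" by (rule x)
    show "finite (?S \<union> ?S')" using fin by simp
    fix z assume z: "z \<in> rot_cells T (k + 1)" "rot_incidence T z ?y \<noteq> 0"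
    obtain c A where cA: "z = (c, A)" by (cases z)
    have c: "c \<in> cells T" using z cA by (auto simp: rot_cells_iff kcells_def)
    show "z \<in> ?S \<union> ?S'"
    proof (cases "c = d")
      case True
      then show ?thesis using fibre_support[OF d g] z cA by auto
    next
      case False
      then have sub: "g \<in> A" "incidence T c d \<noteq> 0"
        using z(2) cA by (auto simp: rot_incidence_def split: if_splits)
      note cf = incidence_coface[OF d c sub(2)]
      then have "c \<notin> kcells T k" using kcells_eq[OF cf(1), of k] by auto
      then have "A = {g}" using z(1) cA sub(1) by (auto simp: rot_cells_iff)
      then show ?thesis using cf cA by blast
    qed
  qed
  also have "\<dots> = (\<Sum>z\<in>?S. rot_incidence T z ?y * x z) + (\<Sum>z\<in>?S'. rot_incidence T z ?y * x z)"
    by (rule sum.union_disjoint) (use fin ne in auto)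
  also have "(\<Sum>z\<in>?S. rot_incidence T z ?y * x z) = (\<Sum>c\<in>?C. rot_incidence T (c, {g}) ?y * x (c, {g}))"
    by (subst sum.reindex) (auto simp: inj_on_def)
  also have "\<dots> = (\<Sum>c\<in>?C. incidence T c d * x (c, {g}))"
  proof (rule sum.cong[OF refl])
    fix c assume "c \<in> ?C"
    then show "rot_incidence T (c, {g}) ?y * x (c, {g}) = incidence T c d * x (c, {g})"
      using ne[of c] by (simp add: rot_incidence_def)
  qed
  finally show ?thesis using sum_fibre[OF d g, of x] by simp
qed

lemma boundary_at_vertex_arc:
  "\<forall>z. z \<notin> rot_cells T 2 \<longrightarrow> x z = 0 \<Longrightarrow> v \<in> kcells T 0 \<Longrightarrow> p \<in> off_cuts v \<Longrightarrow>
    PE_boundary T 2 x (v, arc v p) = (\<Sum>e\<in>edges_at v. incidence T e v * x (e, arc e p))"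
  using boundary_at_arc[of 0 x v p] by simp

lemma boundary_at_edge_point:
  "\<forall>z. z \<notin> rot_cells T 2 \<longrightarrow> x z = 0 \<Longrightarrow> e \<in> kcells T 1 \<Longrightarrow> g \<in> cuts T e \<Longrightarrow>
    PE_boundary T 2 x (e, {g}) =
      turn T (left_tile T e) * x (left_tile T e, {g}) - turn T (right_tile T e) * x (right_tile T e, {g})
      - (x (e, arc_before e g) - x (e, arc_after e g))"
  using boundary_at_point[of 1 x e g] sum_tiles_of_edge[of e "\<lambda>t. x (t, {g})"] by simp

lemma boundary_at_edge_arc:
  "\<forall>z. z \<notin> rot_cells T 3 \<longrightarrow> x z = 0 \<Longrightarrow> e \<in> kcells T 1 \<Longrightarrow> p \<in> off_cuts e \<Longrightarrow>
    PE_boundary T 3 x (e, arc e p) =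
      turn T (left_tile T e) * x (left_tile T e, arc (left_tile T e) p)
      - turn T (right_tile T e) * x (right_tile T e, arc (right_tile T e) p)"
  using boundary_at_arc[of 1 x e p] sum_tiles_of_edge[of e "\<lambda>t. x (t, arc t p)"] by simp

lemma boundary_at_tile_point:
  assumes x: "\<forall>z. z \<notin> rot_cells T 3 \<longrightarrow> x z = 0" and t: "t \<in> tiles T" and g: "g \<in> cuts T t"
  shows "PE_boundary T 3 x (t, {g}) = x (t, arc_before t g) - x (t, arc_after t g)"
proof -
  have "kcells T 3 = {}" using kcells_range[of _ 3] by fastforce
  then show ?thesis using boundary_at_point[of 2 x t g] x t g by simp
qed

lemma boundary_at_vertex_point:
  assumes x: "\<forall>z. z \<notin> rot_cells T 1 \<longrightarrow> x z = 0" and xe: "\<And>e. e \<in> kcells T 1 \<Longrightarrow> x (e, {g}) = 0"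
    and v: "v \<in> kcells T 0" and g: "g \<in> cuts T v"
  shows "PE_boundary T 1 x (v, {g}) = x (v, arc_before v g) - x (v, arc_after v g)"
  using boundary_at_point[of 0 x v g] x v g xe by simp

lemma PE_boundary_outside: "z \<notin> rot_cells T (n - 1) \<Longrightarrow> PE_boundary T n x z = 0"
  by (simp add: PE_boundary_def cellular_boundary_outside)

lemma PE_boundary_diff:
  "PE_boundary T n (\<lambda>c. a c - b c) = (\<lambda>c. PE_boundary T n a c - PE_boundary T n b c)"
  by (simp add: PE_boundary_def cellular_boundary_diff)

lemma rot_cells_1_cases:
  assumes "z \<in> rot_cells T 1"
  obtains v p where "z = (v, arc v p)" "v \<in> kcells T 0" "p \<in> off_cuts v"
  | e g where "z = (e, {g})" "e \<in> kcells T 1" "g \<in> cuts T e"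
proof -
  obtain c A where "z = (c, A)" by (cases z)
  then show ?thesis using assms that by (auto simp: rot_cells_iff elim!: arcsE)
qed

lemma rot_cells_2_cases:
  assumes "z \<in> rot_cells T 2"
  obtains e p where "z = (e, arc e p)" "e \<in> kcells T 1" "p \<in> off_cuts e"
  | t g where "z = (t, {g})" "t \<in> tiles T" "g \<in> cuts T t"
proof -
  obtain c A where "z = (c, A)" by (cases z)
  then show ?thesis using assms that by (auto simp: rot_cells_iff elim!: arcsE)
qed

text \<open>Over a tile, the arcs before and after a point that is not a cut coincide, so the formula
  for the fibre part of the boundary extends to all points of the circle.\<close>

lemma boundary_at_tile_point_any:
  assumes x: "\<forall>z. z \<notin> rot_cells T 3 \<longrightarrow> x z = 0" and t: "t \<in> tiles T" and g: "norm g = 1"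
  shows "PE_boundary T 3 x (t, {g}) = x (t, arc_before t g) - x (t, arc_after t g)"
proof (cases "g \<in> cuts T t")
  case True
  then show ?thesis by (rule boundary_at_tile_point[OF x t])
next
  case False
  then have "(t, {g}) \<notin> rot_cells T (3 - 1)" by (simp add: rot_cell_point_iff)
  then have "PE_boundary T 3 x (t, {g}) = 0" by (rule PE_boundary_outside)
  moreover have "arc_beside \<sigma> (cuts T t) g = arc t g" if "\<sigma> = 1 \<or> \<sigma> = - 1" for \<sigma> :: real
    by (rule arc_beside_no_cut[OF cuts_finite[OF kcells_cells[OF t]] g that False])
  ultimately show ?thesis by simp
qed

lemma boundary_at_edge_beside:
  assumes x: "\<forall>z. z \<notin> rot_cells T 3 \<longrightarrow> x z = 0" and e: "e \<in> kcells T 1" and g: "norm g = 1"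
    and \<sigma>: "\<sigma> = 1 \<or> \<sigma> = - 1"
  shows "PE_boundary T 3 x (e, arc_beside \<sigma> (cuts T e) g) =
    turn T (left_tile T e) * x (left_tile T e, arc_beside \<sigma> (cuts T (left_tile T e)) g)
    - turn T (right_tile T e) * x (right_tile T e, arc_beside \<sigma> (cuts T (right_tile T e)) g)"
proof -
  let ?l = "left_tile T e" and ?r = "right_tile T e"
  have "\<forall>\<^sub>F s in at_right 0. arc ?l (g * cis (\<sigma> * s)) = arc_beside \<sigma> (cuts T ?l) g \<and>
      arc ?r (g * cis (\<sigma> * s)) = arc_beside \<sigma> (cuts T ?r) g"
    using eventually_arc_beside[OF cuts_finite[OF kcells_cells[OF left_tile_side(1)[OF e]]] g \<sigma>]
      eventually_arc_beside[OF cuts_finite[OF kcells_cells[OF right_tile_side(1)[OF e]]] g \<sigma>]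
    by eventually_elim auto
  from obtain_beside[OF cuts_finite[OF kcells_cells[OF e]] g \<sigma> this]
  obtain s where "g * cis (\<sigma> * s) \<in> off_cuts e" "arc e (g * cis (\<sigma> * s)) = arc_beside \<sigma> (cuts T e) g"
    "arc ?l (g * cis (\<sigma> * s)) = arc_beside \<sigma> (cuts T ?l) g" "arc ?r (g * cis (\<sigma> * s)) = arc_beside \<sigma> (cuts T ?r) g"
    by metis
  then show ?thesis using boundary_at_edge_arc[OF x e, where p = "g * cis (\<sigma> * s)"] by simp
qed

text \<open>At a cell over an edge, the boundary of the product orientation cancels in pairs. At a cell
  \<open>v \<times> J\<close> over a vertex, the coefficients of the arcs through a point \<open>p\<close> of \<open>J\<close> define a cellular
  \<open>2\<close>-chain of the plane, and its boundary has no boundary at \<open>v\<close>.\<close>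

lemma boundary_boundary_3:
  assumes x: "\<forall>z. z \<notin> rot_cells T 3 \<longrightarrow> x z = 0"
  shows "PE_boundary T 2 (PE_boundary T 3 x) = (\<lambda>_. 0)"
proof
  fix z
  have out: "\<forall>z. z \<notin> rot_cells T 2 \<longrightarrow> PE_boundary T 3 x z = 0"
    using PE_boundary_outside[of _ 3] by simp
  show "PE_boundary T 2 (PE_boundary T 3 x) z = 0"
  proof (cases "z \<in> rot_cells T 1")
    case False
    then show ?thesis using PE_boundary_outside[of z 2] by simp
  next
    case True
    then show ?thesis
    proof (cases rule: rot_cells_1_cases)
      case (1 v p)
      have "PE_boundary T 3 x (e, arc e p) = turn T (left_tile T e) * x (left_tile T e, arc (left_tile T e) p)
          - turn T (right_tile T e) * x (right_tile T e, arc (right_tile T e) p)" if "e \<in> edges_at v" for e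
        using that 1(3) cuts_mono[of v e] by (intro boundary_at_edge_arc[OF x]) auto
      then have "PE_boundary T 2 (PE_boundary T 3 x) z =
          (\<Sum>e\<in>edges_at v. of_int (incidence T e v) * (turn T (left_tile T e) * x (left_tile T e, arc (left_tile T e) p)
          - turn T (right_tile T e) * x (right_tile T e, arc (right_tile T e) p)))"
        using boundary_at_vertex_arc[OF out 1(2,3)] 1(1) by simp
      also have "\<dots> = 0" by (rule sum_around_vertex[OF 1(2), of "\<lambda>t. turn T t * x (t, arc t p)"])
      finally show ?thesis .
    next
      case (2 e g)
      have g: "norm g = 1" using 2(3) cuts_sphere by fastforce
      show ?thesis unfolding 2(1) boundary_at_edge_point[OF out 2(2,3)]
        boundary_at_tile_point_any[OF x left_tile_side(1)[OF 2(2)] g]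
        boundary_at_tile_point_any[OF x right_tile_side(1)[OF 2(2)] g]
        boundary_at_edge_beside[OF x 2(2) g disjI1[OF refl]]
        boundary_at_edge_beside[OF x 2(2) g disjI2[OF refl]]
        by (simp add: algebra_simps)
    qed
  qed
qed

section \<open>Pattern-equivariance\<close>

lemma rot_move_arc:
  assumes \<phi>: "\<phi> \<in> star_transports T c c'" and p: "p \<in> off_cuts c"
  shows "rot_move \<phi> (c, arc c p) = (c', arc c' (snd \<phi> * p))" "snd \<phi> * p \<in> off_cuts c'"
proof -
  have n: "norm (snd \<phi>) = 1" using rot_part_norm star_transports_rigid[OF \<phi>] by blast
  show "rot_move \<phi> (c, arc c p) = (c', arc c' (snd \<phi> * p))"
    using arc_at_rotate[OF n p] cuts_move[OF \<phi>] star_transports_image[OF \<phi>] by (simp add: rot_move_def)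
  show "snd \<phi> * p \<in> off_cuts c'" using n p unfolding cuts_move[OF \<phi>] by (auto simp: norm_mult)
qed

lemma rot_move_beside:
  assumes \<phi>: "\<phi> \<in> star_transports T c c'" and c: "c \<in> cells T" and g: "norm g = 1" and \<sigma>: "\<sigma> = 1 \<or> \<sigma> = - 1"
  shows "rot_move \<phi> (c, arc_beside \<sigma> (cuts T c) g) = (c', arc_beside \<sigma> (cuts T c') (snd \<phi> * g))"
proof -
  have n: "norm (snd \<phi>) = 1" using rot_part_norm star_transports_rigid[OF \<phi>] by blast
  show ?thesis
    using arc_beside_rotate[OF n cuts_finite[OF c] g \<sigma>] cuts_move[OF \<phi>] star_transports_image[OF \<phi>]
    by (simp add: rot_move_def)
qed

lemma rot_move_point:
  assumes \<phi>: "\<phi> \<in> star_transports T c c'"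
  shows "rot_move \<phi> (c, {g}) = (c', {snd \<phi> * g})" "g \<in> cuts T c \<Longrightarrow> snd \<phi> * g \<in> cuts T c'"
  using star_transports_image[OF \<phi>] cuts_move[OF \<phi>] by (auto simp: rot_move_def)

lemma PE_chainsI:
  assumes "\<forall>z. z \<notin> rot_cells T n \<longrightarrow> \<psi> z = 0" "r > 0"
    "\<And>c1 c2 \<phi> z. c1 \<in> cells T \<Longrightarrow> c2 \<in> cells T \<Longrightarrow> \<phi> \<in> transports T c1 c2 r \<Longrightarrow>
      z \<in> rot_cells T n \<Longrightarrow> fst z = c1 \<Longrightarrow> \<psi> z = \<psi> (rot_move \<phi> z)"
  shows "\<psi> \<in> PE_chains T n"
proof -
  have "\<forall>c1\<in>cells T. \<forall>c2\<in>cells T. \<forall>\<phi>\<in>transports T c1 c2 r. \<forall>z\<in>rot_cells T n.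
      fst z = c1 \<longrightarrow> \<psi> z = \<psi> (rot_move \<phi> z)"
    by (intro ballI impI) (rule assms(3))
  then show ?thesis unfolding PE_chains_def using assms(1,2) by blast
qed

lemma PE_chainsE:
  assumes "\<psi> \<in> PE_chains T n"
  obtains r where "r > 0"
    "\<And>c1 c2 \<phi> z. c1 \<in> cells T \<Longrightarrow> c2 \<in> cells T \<Longrightarrow> \<phi> \<in> transports T c1 c2 r \<Longrightarrow>
      z \<in> rot_cells T n \<Longrightarrow> fst z = c1 \<Longrightarrow> \<psi> z = \<psi> (rot_move \<phi> z)"
  using assms unfolding PE_chains_def by blast

lemma PE_chains_outside: "\<psi> \<in> PE_chains T n \<Longrightarrow> \<forall>z. z \<notin> rot_cells T n \<longrightarrow> \<psi> z = 0"
  unfolding PE_chains_def by blast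

lemma ePE_chainsI:
  assumes "\<forall>c. c \<notin> kcells T k \<longrightarrow> \<sigma> c = 0" "r > 0"
    "\<And>c1 c2 \<phi>. c1 \<in> kcells T k \<Longrightarrow> c2 \<in> kcells T k \<Longrightarrow> \<phi> \<in> transports T c1 c2 r \<Longrightarrow> \<sigma> c1 = \<sigma> c2"
  shows "\<sigma> \<in> ePE_chains T k"
  using assms unfolding ePE_chains_def by blast

lemma ePE_chainsE:
  assumes "\<sigma> \<in> ePE_chains T k"
  obtains r where "r > 0"
    "\<And>c1 c2 \<phi>. c1 \<in> kcells T k \<Longrightarrow> c2 \<in> kcells T k \<Longrightarrow> \<phi> \<in> transports T c1 c2 r \<Longrightarrow> \<sigma> c1 = \<sigma> c2"
  using assms unfolding ePE_chains_def by blast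

lemma ePE_chains_outside: "\<sigma> \<in> ePE_chains T k \<Longrightarrow> \<forall>c. c \<notin> kcells T k \<longrightarrow> \<sigma> c = 0"
  unfolding ePE_chains_def by blast

lemma PE_boundary_3_PE:
  assumes x: "x \<in> PE_chains T 3"
  shows "PE_boundary T 3 x \<in> PE_chains T 2"
proof -
  note out = PE_chains_outside[OF x]
  obtain r where r: "r > 0" and inv: "\<And>c1 c2 \<phi> z. c1 \<in> cells T \<Longrightarrow> c2 \<in> cells T \<Longrightarrow> \<phi> \<in> transports T c1 c2 r \<Longrightarrow>
      z \<in> rot_cells T 3 \<Longrightarrow> fst z = c1 \<Longrightarrow> x z = x (rot_move \<phi> z)"
    by (rule PE_chainsE[OF x]) blast
  obtain D where D: "D > 0" "\<And>c. c \<in> cells T \<Longrightarrow> diameter c \<le> D" by (rule cell_diameter_bound) blast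
  have eq: "PE_boundary T 3 x z = PE_boundary T 3 x (rot_move \<phi> z)"
    if c: "c1 \<in> cells T" and \<phi>: "\<phi> \<in> transports T c1 c2 (D + r)"
      and z: "z \<in> rot_cells T 2" "fst z = c1" for c1 c2 \<phi> z
  proof -
    have st: "\<phi> \<in> star_transports T c1 c2" using transports_star[OF \<phi> c] D r by simp
    have n: "norm (snd \<phi>) = 1" using rot_part_norm star_transports_rigid[OF st] by blast
    have xt: "x (t, I) = x (rot_move \<phi> (t, I))" if t: "t \<in> tiles T" "c1 \<subseteq> t" and I: "I \<in> arcs T t" for t I
    proof -
      have "\<phi> \<in> transports T t (move \<phi> ` t) r"
        using transports_mono[OF \<phi> c kcells_cells[OF t(1)] t(2) r] D(2)[OF kcells_cells[OF t(1)]] by simp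
      moreover have "move \<phi> ` t \<in> tiles T" by (rule star_transports_cell[OF st t])
      moreover have "(t, I) \<in> rot_cells T 3" using t I by (simp add: rot_cells_iff)
      ultimately show ?thesis using inv[of t "move \<phi> ` t" \<phi> "(t, I)"] t kcells_cells by auto
    qed
    from z(1) show ?thesis
    proof (cases rule: rot_cells_2_cases)
      case (1 e p)
      then have e: "e = c1" using z by simp
      have e2: "c2 \<in> kcells T 1"
        using star_transports_cell(1)[OF st, of c1 1] star_transports_image[OF st] 1 e by simp
      have st': "\<phi> \<in> star_transports T e c2" using st e by simp
      note em = edge_move[OF st' 1(2) e2]
      have tm: "x (t, arc t p) = x (move \<phi> ` t, arc (move \<phi> ` t) (snd \<phi> * p)) \<and> turn T (move \<phi> ` t) = turn T t"
        if t: "t \<in> tiles T" "e \<subseteq> t" for t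
      proof -
        have p: "p \<in> off_cuts t" using 1(3) cuts_mono[OF t(2)] by auto
        have "\<phi> \<in> star_transports T t (move \<phi> ` t)" using star_transports_mono[OF st' kcells_cells[OF t(1)] t(2)] .
        from rot_move_arc(1)[OF this p] show ?thesis
          using xt[OF t(1) _ arc_in_arcs[OF p]] t e turn_move[OF st' t] by simp
      qed
      have "rot_move \<phi> z = (c2, arc c2 (snd \<phi> * p))" "snd \<phi> * p \<in> off_cuts c2"
        using rot_move_arc[OF st' 1(3)] 1(1) by auto
      then show ?thesis
        using boundary_at_edge_arc[OF out 1(2,3)] boundary_at_edge_arc[OF out e2, where p = "snd \<phi> * p"] 1(1) em
          tm[OF left_tile_side(1,2)[OF 1(2)]] tm[OF right_tile_side(1,2)[OF 1(2)]] by simp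
    next
      case (2 t g)
      then have t: "t = c1" using z by simp
      have t2: "c2 \<in> tiles T"
        using star_transports_cell(1)[OF st, of c1 2] star_transports_image[OF st] 2 t by simp
      have st': "\<phi> \<in> star_transports T t c2" using st t by simp
      have g: "norm g = 1" using 2(3) cuts_sphere by fastforce
      have "x (t, arc_beside \<sigma> (cuts T t) g) = x (c2, arc_beside \<sigma> (cuts T c2) (snd \<phi> * g))"
        if \<sigma>: "\<sigma> = 1 \<or> \<sigma> = - 1" for \<sigma> :: real
        using xt[OF 2(2) _ beside_in_arcs[OF kcells_cells[OF 2(2)] g \<sigma>]]
          rot_move_beside[OF st' kcells_cells[OF 2(2)] g \<sigma>] t by simp
      then show ?thesis
        using boundary_at_tile_point[OF out 2(2,3)] boundary_at_tile_point[OF out t2 rot_move_point(2)[OF st' 2(3)]]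
          rot_move_point(1)[OF st', of g] 2(1) by simp
    qed
  qed
  show ?thesis
  proof (rule PE_chainsI)
    show "\<forall>z. z \<notin> rot_cells T 2 \<longrightarrow> PE_boundary T 3 x z = 0" using PE_boundary_outside[of _ 3] by simp
    show "D + r > 0" using D r by simp
  qed (rule eq)
qed

lemma nu_chain_arc: "c \<in> kcells T k \<Longrightarrow> p \<in> off_cuts c \<Longrightarrow> nu_chain T k \<sigma> (c, arc c p) = \<sigma> c"
  by (simp add: nu_chain_def arc_in_arcs)

lemma nu_chain_beside:
  "c \<in> kcells T k \<Longrightarrow> norm g = 1 \<Longrightarrow> s = 1 \<or> s = - 1 \<Longrightarrow> nu_chain T k \<sigma> (c, arc_beside s (cuts T c) g) = \<sigma> c"
  by (simp add: nu_chain_def beside_in_arcs kcells_cells)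

lemma nu_chain_outside: "z \<notin> rot_cells T (k + 1) \<Longrightarrow> nu_chain T k \<sigma> z = 0"
  by (cases z) (auto simp: nu_chain_def rot_cells_iff)

lemma nu_chain_point: "nu_chain T k \<sigma> (c, {g}) = 0"
  using arcs_not_singleton[of c "{g}"] by (auto simp: nu_chain_def kcells_def)

text \<open>A motion of stars rotates the cuts of the fibre circle, so it permutes the arcs.\<close>

lemma star_transports_arcs_iff:
  assumes \<phi>: "\<phi> \<in> star_transports T c c'"
  shows "(*) (snd \<phi>) ` A \<in> arcs T c' \<longleftrightarrow> A \<in> arcs T c"
proof -
  have fwd: "(*) (snd \<phi>) ` A \<in> arcs T c'" if "\<phi> \<in> star_transports T c c'" "A \<in> arcs T c" for \<phi> c c' A
  proof -
    from that(2) obtain p where p: "p \<in> off_cuts c" "A = arc c p" by (rule arcsE)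
    then show ?thesis using rot_move_arc[OF that(1) p(1)] arc_in_arcs by (simp add: rot_move_def)
  qed
  have "norm (snd \<phi>) = 1" using rot_part_norm star_transports_rigid[OF \<phi>] by blast
  then have "snd \<phi> \<noteq> 0" by auto
  then have "(*) (snd (inverse_motion \<phi>)) ` (*) (snd \<phi>) ` A = A"
    by (simp add: image_image inverse_motion_def)
  then show ?thesis using fwd[OF \<phi>, of A] fwd[OF star_transports_inverse[OF \<phi>], of "(*) (snd \<phi>) ` A"] by auto
qed

lemma star_transports_kcells_iff:
  assumes "\<phi> \<in> star_transports T c c'" "c \<in> cells T" "c' \<in> cells T"
  shows "c' \<in> kcells T k \<longleftrightarrow> c \<in> kcells T k"
  using move_aff_dim[OF star_transports_rigid[OF assms(1)], of c] star_transports_image[OF assms(1)] assms(2,3)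
  by (simp add: kcells_def)

lemma nu_chain_PE_iff:
  assumes \<sigma>: "\<forall>c. c \<notin> kcells T k \<longrightarrow> \<sigma> c = 0"
  shows "nu_chain T k \<sigma> \<in> PE_chains T (k + 1) \<longleftrightarrow> \<sigma> \<in> ePE_chains T k"
proof
  assume "nu_chain T k \<sigma> \<in> PE_chains T (k + 1)"
  then obtain r where r: "r > 0" and inv: "\<And>c1 c2 \<phi> z. c1 \<in> cells T \<Longrightarrow> c2 \<in> cells T \<Longrightarrow> \<phi> \<in> transports T c1 c2 r \<Longrightarrow>
      z \<in> rot_cells T (k + 1) \<Longrightarrow> fst z = c1 \<Longrightarrow> nu_chain T k \<sigma> z = nu_chain T k \<sigma> (rot_move \<phi> z)"
    by (rule PE_chainsE) blast
  show "\<sigma> \<in> ePE_chains T k"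
  proof (rule ePE_chainsI[OF \<sigma> r])
    fix c1 c2 \<phi> assume c: "c1 \<in> kcells T k" "c2 \<in> kcells T k" and \<phi>: "\<phi> \<in> transports T c1 c2 r"
    obtain p where p: "p \<in> off_cuts c1" by (rule obtain_off_cuts[OF kcells_cells[OF c(1)]])
    have st: "\<phi> \<in> star_transports T c1 c2" by (rule transports_star[OF \<phi> kcells_cells[OF c(1)] r])
    have "(c1, arc c1 p) \<in> rot_cells T (k + 1)" using c arc_in_arcs[OF p] by (simp add: rot_cells_iff)
    then show "\<sigma> c1 = \<sigma> c2"
      using inv[OF kcells_cells[OF c(1)] kcells_cells[OF c(2)] \<phi>, of "(c1, arc c1 p)"]
        rot_move_arc[OF st p] nu_chain_arc c p by simp
  qed
next
  assume "\<sigma> \<in> ePE_chains T k"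
  then obtain r where r: "r > 0" and inv: "\<And>c1 c2 \<phi>. c1 \<in> kcells T k \<Longrightarrow> c2 \<in> kcells T k \<Longrightarrow> \<phi> \<in> transports T c1 c2 r \<Longrightarrow> \<sigma> c1 = \<sigma> c2"
    by (rule ePE_chainsE) blast
  show "nu_chain T k \<sigma> \<in> PE_chains T (k + 1)"
  proof (rule PE_chainsI)
    show "\<forall>z. z \<notin> rot_cells T (k + 1) \<longrightarrow> nu_chain T k \<sigma> z = 0" using nu_chain_outside by blast
    show "r > 0" by (rule r)
    fix c1 c2 \<phi> and z :: rot_cell
    assume c: "c1 \<in> cells T" "c2 \<in> cells T" and \<phi>: "\<phi> \<in> transports T c1 c2 r" and z: "fst z = c1"
    have st: "\<phi> \<in> star_transports T c1 c2" by (rule transports_star[OF \<phi> c(1) r])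
    obtain A where A: "z = (c1, A)" using z by (cases z) auto
    have rm: "rot_move \<phi> z = (c2, (*) (snd \<phi>) ` A)"
      using star_transports_image[OF st] A by (simp add: rot_move_def)
    show "nu_chain T k \<sigma> z = nu_chain T k \<sigma> (rot_move \<phi> z)"
      using inv[OF _ _ \<phi>] star_transports_kcells_iff[OF st c, of k] star_transports_arcs_iff[OF st, of A]
      unfolding rm unfolding A nu_chain_def by auto
  qed
qed

end

section \<open>Quotients of groups of chains\<close>

definition chain_group :: "('c \<Rightarrow> int) set \<Rightarrow> bool" where
  "chain_group Z \<longleftrightarrow> (\<lambda>_. 0) \<in> Z \<and> (\<forall>a\<in>Z. \<forall>b\<in>Z. (\<lambda>c. a c - b c) \<in> Z)"

lemma chain_groupI:
  "(\<lambda>_. 0) \<in> Z \<Longrightarrow> (\<And>a b. a \<in> Z \<Longrightarrow> b \<in> Z \<Longrightarrow> (\<lambda>c. a c - b c) \<in> Z) \<Longrightarrow> chain_group Z"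
  by (simp add: chain_group_def)

lemma chain_group_zero: "chain_group Z \<Longrightarrow> (\<lambda>_. 0) \<in> Z"
  by (simp add: chain_group_def)

lemma chain_group_diff: "chain_group Z \<Longrightarrow> a \<in> Z \<Longrightarrow> b \<in> Z \<Longrightarrow> (\<lambda>c. a c - b c) \<in> Z"
  by (simp add: chain_group_def)

lemma chain_group_minus: "chain_group Z \<Longrightarrow> a \<in> Z \<Longrightarrow> (\<lambda>c. - a c) \<in> Z"
  using chain_group_diff[of Z "\<lambda>_. 0" a] chain_group_zero[of Z] by simp

lemma chain_group_add: "chain_group Z \<Longrightarrow> a \<in> Z \<Longrightarrow> b \<in> Z \<Longrightarrow> (\<lambda>c. a c + b c) \<in> Z"
  using chain_group_diff[of Z a "\<lambda>c. - b c"] chain_group_minus[of Z b] by simp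

lemma chain_group_mult:
  assumes Z: "chain_group Z" and a: "a \<in> Z" shows "(\<lambda>c. n * a c) \<in> Z"
proof (induction n rule: int_induct[of _ 0])
  case base then show ?case using chain_group_zero[OF Z] by simp
next
  case (step1 i)
  then show ?case using chain_group_add[OF Z _ a, of "\<lambda>c. i * a c"] by (simp add: algebra_simps)
next
  case (step2 i)
  then show ?case using chain_group_diff[OF Z _ a, of "\<lambda>c. i * a c"] by (simp add: algebra_simps)
qed

abbreviation coset :: "('c \<Rightarrow> int) set \<Rightarrow> ('c \<Rightarrow> int) \<Rightarrow> ('c \<Rightarrow> int) set" where
  "coset B x \<equiv> B #>\<^bsub>int_chains\<^esub> x"

lemma chain_coset: "coset B x = {z. (\<lambda>c. z c - x c) \<in> B}"
proof (intro equalityI subsetI)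
  fix z assume "z \<in> coset B x"
  then obtain b where "b \<in> B" "z = (\<lambda>c. b c + x c)" by (auto simp: r_coset_def int_chains_def)
  then show "z \<in> {z. (\<lambda>c. z c - x c) \<in> B}" by simp
next
  fix z assume "z \<in> {z. (\<lambda>c. z c - x c) \<in> B}"
  then have "\<exists>b\<in>B. z = (\<lambda>c. b c + x c)" by (intro bexI[of _ "\<lambda>c. z c - x c"]) auto
  then show "z \<in> coset B x" by (auto simp: r_coset_def int_chains_def)
qed

lemma chain_set_mult:
  "H <#>\<^bsub>int_chains\<^esub> K = {z. \<exists>h\<in>H. \<exists>k\<in>K. z = (\<lambda>c. h c + k c)}"
  by (auto simp: set_mult_def int_chains_def)

lemma chain_coset_eq_iff:
  assumes B: "chain_group B"
  shows "coset B x = coset B y \<longleftrightarrow> (\<lambda>c. x c - y c) \<in> B"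
proof
  have "x \<in> coset B x" using chain_group_zero[OF B] by (simp add: chain_coset)
  also assume "coset B x = coset B y"
  finally show "(\<lambda>c. x c - y c) \<in> B" by (simp add: chain_coset)
next
  assume xy: "(\<lambda>c. x c - y c) \<in> B"
  show "coset B x = coset B y"
  proof (intro equalityI subsetI)
    fix z assume "z \<in> coset B x"
    then show "z \<in> coset B y"
      using chain_group_add[OF B _ xy, of "\<lambda>c. z c - x c"] by (simp add: chain_coset)
  next
    fix z assume "z \<in> coset B y"
    then show "z \<in> coset B x"
      using chain_group_diff[OF B _ xy, of "\<lambda>c. z c - y c"] by (simp add: chain_coset algebra_simps)
  qed
qed

lemma chain_coset_mult:
  assumes B: "chain_group B"
  shows "(coset B x) <#>\<^bsub>int_chains\<^esub> (coset B y) = coset B (\<lambda>c. x c + y c)"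
proof (intro equalityI subsetI)
  fix z assume "z \<in> (coset B x) <#>\<^bsub>int_chains\<^esub> (coset B y)"
  then obtain a b where ab: "(\<lambda>c. a c - x c) \<in> B" "(\<lambda>c. b c - y c) \<in> B" "z = (\<lambda>c. a c + b c)"
    unfolding chain_set_mult chain_coset by blast
  have "(\<lambda>c. (a c - x c) + (b c - y c)) \<in> B" by (rule chain_group_add[OF B ab(1,2)])
  then show "z \<in> coset B (\<lambda>c. x c + y c)" by (simp add: chain_coset ab(3) algebra_simps)
next
  fix z assume "z \<in> coset B (\<lambda>c. x c + y c)"
  then have "(\<lambda>c. (z c - y c) - x c) \<in> B" by (simp add: chain_coset algebra_simps)
  then have 1: "(\<lambda>c. z c - y c) \<in> coset B x" by (simp add: chain_coset)
  have 2: "y \<in> coset B y" using chain_group_zero[OF B] by (simp add: chain_coset)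
  show "z \<in> (coset B x) <#>\<^bsub>int_chains\<^esub> (coset B y)"
    unfolding chain_set_mult
    by (intro CollectI bexI[of _ "\<lambda>c. z c - y c"] bexI[of _ y]) (simp, rule 2, rule 1)
qed

locale chain_quotient =
  fixes Z B :: "('c \<Rightarrow> int) set"
  assumes Z: "chain_group Z" and B: "chain_group B" and BZ: "B \<subseteq> Z"
begin

abbreviation quotient_group :: "('c \<Rightarrow> int) set monoid" where
  "quotient_group \<equiv> int_chains\<lparr>carrier := Z\<rparr> Mod B"

lemma carrier_quotient: "carrier quotient_group = coset B ` Z"
  by (auto simp: FactGroup_def RCOSETS_def r_coset_def)

lemma coset_in_carrier: "x \<in> Z \<Longrightarrow> coset B x \<in> carrier quotient_group"
  by (simp add: carrier_quotient)

lemma mult_quotient: "coset B x \<otimes>\<^bsub>quotient_group\<^esub> coset B y = coset B (\<lambda>c. x c + y c)"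
proof -
  have "coset B x \<otimes>\<^bsub>quotient_group\<^esub> coset B y = coset B x <#>\<^bsub>int_chains\<^esub> coset B y"
    by (simp add: FactGroup_def set_mult_def)
  then show ?thesis by (simp add: chain_coset_mult[OF B])
qed

lemma group_quotient: "group quotient_group"
proof -
  let ?G = "int_chains\<lparr>carrier := Z\<rparr>"
  interpret G: comm_group ?G
  proof (rule comm_groupI)
    show "\<And>x. x \<in> carrier ?G \<Longrightarrow> \<exists>y\<in>carrier ?G. y \<otimes>\<^bsub>?G\<^esub> x = \<one>\<^bsub>?G\<^esub>"
    proof -
      fix x assume "x \<in> carrier ?G"
      then show "\<exists>y\<in>carrier ?G. y \<otimes>\<^bsub>?G\<^esub> x = \<one>\<^bsub>?G\<^esub>"
        using chain_group_minus[OF Z, of x] by (intro bexI[of _ "\<lambda>c. - x c"]) (auto simp: int_chains_def)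
    qed
  qed (use chain_group_zero[OF Z] chain_group_add[OF Z] in \<open>auto simp: int_chains_def algebra_simps\<close>)
  have inv: "inv\<^bsub>?G\<^esub> x = (\<lambda>c. - x c)" if "x \<in> Z" for x
    by (rule G.inv_equality) (use that chain_group_minus[OF Z that] in \<open>auto simp: int_chains_def\<close>)
  have "subgroup B ?G"
  proof (rule G.subgroupI)
    show "B \<noteq> {}" using chain_group_zero[OF B] by blast
    show "inv\<^bsub>?G\<^esub> a \<in> B" if "a \<in> B" for a using inv[of a] chain_group_minus[OF B that] BZ that by auto
    show "a \<otimes>\<^bsub>?G\<^esub> b \<in> B" if "a \<in> B" "b \<in> B" for a b
      using chain_group_add[OF B that] by (simp add: int_chains_def)
  qed (use BZ in simp)
  then have "B \<lhd> ?G" by (simp add: G.normal_iff_subgroup)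
  then show ?thesis by (rule normal.factorgroup_is_group)
qed

lemma infinite_cyclic:
  assumes x: "x \<in> Z" and surj: "\<And>z. z \<in> Z \<Longrightarrow> \<exists>n. (\<lambda>c. z c - n * x c) \<in> B"
    and inj: "\<And>n. (\<lambda>c. n * x c) \<in> B \<Longrightarrow> n = 0"
  shows "quotient_group \<cong> integer_group" "generate quotient_group {coset B x} = carrier quotient_group"
proof -
  interpret Q: group quotient_group by (rule group_quotient)
  define f where "f n = coset B (\<lambda>c. n * x c)" for n
  have f_in: "f n \<in> carrier quotient_group" for n
    unfolding f_def by (intro coset_in_carrier chain_group_mult Z x)
  have f_add: "f (m + n) = f m \<otimes>\<^bsub>quotient_group\<^esub> f n" for m n
    unfolding f_def mult_quotient by (simp add: distrib_right)
  have f_surj: "\<exists>n. X = f n" if X: "X \<in> carrier quotient_group" for X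
  proof -
    obtain z where z: "z \<in> Z" "X = coset B z" using X by (auto simp: carrier_quotient)
    then show ?thesis using surj[OF z(1)] by (auto simp: f_def chain_coset_eq_iff[OF B])
  qed
  have "f \<in> iso integer_group quotient_group"
    unfolding iso_def
  proof (intro CollectI conjI)
    show "f \<in> hom integer_group quotient_group" using f_in f_add by (auto simp: hom_def)
    show "bij_betw f (carrier integer_group) (carrier quotient_group)"
      unfolding bij_betw_def
    proof
      show "inj_on f (carrier integer_group)"
      proof (rule inj_onI)
        fix m n assume "f m = f n"
        then have "(\<lambda>c. m * x c - n * x c) \<in> B" by (simp add: f_def chain_coset_eq_iff[OF B])
        then have "(\<lambda>c. (m - n) * x c) \<in> B" by (simp add: left_diff_distrib)
        then show "m = n" using inj[of "m - n"] by simp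
      qed
      show "f ` carrier integer_group = carrier quotient_group" using f_in by (auto dest!: f_surj)
    qed
  qed
  then have "integer_group \<cong> quotient_group" by (rule is_isoI)
  then show "quotient_group \<cong> integer_group" by (rule group.iso_sym[OF group_integer_group])
  have f1: "f 1 = coset B x" by (simp add: f_def)
  have f0: "f 0 = \<one>\<^bsub>quotient_group\<^esub>"
    using f_add[of 0 0] Q.l_cancel_one'[OF f_in f_in, of 0 0] by simp
  have inv: "inv\<^bsub>quotient_group\<^esub> f 1 = f (- 1)"
    by (rule Q.inv_equality) (use f_add[of "- 1" 1] f0 f_in in auto)
  have gen: "f n \<in> generate quotient_group {coset B x}" for n
  proof (induction n rule: int_induct[of _ 0])
    case base then show ?case unfolding f0 by (rule generate.one)
  next
    case (step1 i)
    have "f 1 \<in> generate quotient_group {coset B x}" unfolding f1 by (rule generate.incl) simp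
    with step1(2) show ?case unfolding f_add by (rule generate.eng)
  next
    case (step2 i)
    have "f (- 1) \<in> generate quotient_group {coset B x}"
      unfolding inv[symmetric] f1 by (rule generate.inv) simp
    with step2(2) have "f i \<otimes>\<^bsub>quotient_group\<^esub> f (- 1) \<in> generate quotient_group {coset B x}" by (rule generate.eng)
    then show ?case using f_add[of i "- 1"] by simp
  qed
  show "generate quotient_group {coset B x} = carrier quotient_group"
  proof
    show "generate quotient_group {coset B x} \<subseteq> carrier quotient_group"
      by (rule Q.generate_incl) (use coset_in_carrier[OF x] in simp)
    show "carrier quotient_group \<subseteq> generate quotient_group {coset B x}"
    proof
      fix X assume "X \<in> carrier quotient_group"
      then obtain n where "X = f n" using f_surj by blast
      then show "X \<in> generate quotient_group {coset B x}" using gen by simp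
    qed
  qed
qed

end

text \<open>An isomorphism \<open>N\<close> of chain groups that matches the subgroups induces an isomorphism of the
  quotients; here it is read backwards, through an inverse \<open>M\<close> of \<open>N\<close>.\<close>

lemma induced_iso:
  fixes Z B :: "('c \<Rightarrow> int) set" and C D :: "('d \<Rightarrow> int) set"
  assumes ZB: "chain_quotient Z B" and CD: "chain_quotient C D"
    and N: "\<And>\<sigma>. \<sigma> \<in> C \<Longrightarrow> N \<sigma> \<in> Z" and surj: "\<And>z. z \<in> Z \<Longrightarrow> \<exists>\<sigma>\<in>C. z = N \<sigma>"
    and diff: "\<And>\<sigma> \<tau>. N (\<lambda>c. \<sigma> c - \<tau> c) = (\<lambda>c. N \<sigma> c - N \<tau> c)"
    and BD: "\<And>\<sigma>. \<sigma> \<in> C \<Longrightarrow> N \<sigma> \<in> B \<longleftrightarrow> \<sigma> \<in> D"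
    and M: "\<And>\<sigma>. \<sigma> \<in> C \<Longrightarrow> M (N \<sigma>) = \<sigma>"
  defines "F \<equiv> \<lambda>X. the_elem ((\<lambda>z. coset D (M z)) ` X)"
  shows "F \<in> iso (int_chains\<lparr>carrier := Z\<rparr> Mod B) (int_chains\<lparr>carrier := C\<rparr> Mod D)"
    "\<sigma> \<in> C \<Longrightarrow> F (coset B (N \<sigma>)) = coset D \<sigma>"
proof -
  interpret ZB: chain_quotient Z B by (rule ZB)
  interpret CD: chain_quotient C D by (rule CD)
  have F: "F (coset B (N \<sigma>)) = coset D \<sigma>" if \<sigma>: "\<sigma> \<in> C" for \<sigma>
  proof -
    have eq: "coset D (M z) = coset D (M (N \<sigma>))" if z: "z \<in> coset B (N \<sigma>)" for z
    proof -
      have b: "(\<lambda>c. z c - N \<sigma> c) \<in> B" using z by (simp add: chain_coset)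
      then have "(\<lambda>c. (z c - N \<sigma> c) + N \<sigma> c) \<in> Z"
        using ZB.BZ N[OF \<sigma>] by (intro chain_group_add[OF ZB.Z]) auto
      then obtain \<tau> where \<tau>: "\<tau> \<in> C" "z = N \<tau>" using surj[of z] by auto
      then have "N (\<lambda>c. \<tau> c - \<sigma> c) \<in> B" using b by (simp add: diff)
      then have "(\<lambda>c. \<tau> c - \<sigma> c) \<in> D" using BD[OF chain_group_diff[OF CD.Z \<tau>(1) \<sigma>]] by simp
      then show ?thesis by (simp add: \<tau>(2) M[OF \<tau>(1)] M[OF \<sigma>] chain_coset_eq_iff[OF CD.B])
    qed
    have "N \<sigma> \<in> coset B (N \<sigma>)" using chain_group_zero[OF ZB.B] by (simp add: chain_coset)
    then have "coset B (N \<sigma>) \<noteq> {}" by blast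
    then have "the_elem ((\<lambda>z. coset D (M z)) ` (coset B (N \<sigma>))) = coset D (M (N \<sigma>))"
      by (rule the_elem_image_unique) (rule eq)
    then show ?thesis by (simp add: F_def M[OF \<sigma>])
  qed
  then show "\<sigma> \<in> C \<Longrightarrow> F (coset B (N \<sigma>)) = coset D \<sigma>" .
  have add: "N (\<lambda>c. \<sigma> c + \<tau> c) = (\<lambda>c. N \<sigma> c + N \<tau> c)" for \<sigma> \<tau>
  proof -
    have "N (\<lambda>_. 0) = (\<lambda>_. 0)" using diff[of "\<lambda>_. 0" "\<lambda>_. 0"] by simp
    then have "N (\<lambda>c. - \<tau> c) = (\<lambda>c. - N \<tau> c)" using diff[of "\<lambda>_. 0" \<tau>] by simp
    then show ?thesis using diff[of \<sigma> "\<lambda>c. - \<tau> c"] by simp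
  qed
  have ex: "\<exists>\<sigma>\<in>C. X = coset B (N \<sigma>)" if "X \<in> carrier ZB.quotient_group" for X
    using that surj by (auto simp: ZB.carrier_quotient)
  show "F \<in> iso ZB.quotient_group CD.quotient_group"
    unfolding iso_def
  proof (intro CollectI conjI)
    show "F \<in> hom ZB.quotient_group CD.quotient_group"
    proof (rule homI)
      fix X assume "X \<in> carrier ZB.quotient_group"
      then obtain \<sigma> where "\<sigma> \<in> C" "X = coset B (N \<sigma>)" using ex by blast
      then show "F X \<in> carrier CD.quotient_group" using F CD.coset_in_carrier by simp
    next
      fix X Y assume "X \<in> carrier ZB.quotient_group" "Y \<in> carrier ZB.quotient_group"
      then obtain \<sigma> \<tau> where *: "\<sigma> \<in> C" "X = coset B (N \<sigma>)" "\<tau> \<in> C" "Y = coset B (N \<tau>)"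
        using ex by meson
      have "F (X \<otimes>\<^bsub>ZB.quotient_group\<^esub> Y) = F (coset B (N (\<lambda>c. \<sigma> c + \<tau> c)))"
        by (simp only: *(2,4) ZB.mult_quotient add)
      also have "\<dots> = coset D (\<lambda>c. \<sigma> c + \<tau> c)" by (rule F[OF chain_group_add[OF CD.Z *(1,3)]])
      also have "\<dots> = F X \<otimes>\<^bsub>CD.quotient_group\<^esub> F Y"
        by (simp only: *(2,4) F[OF *(1)] F[OF *(3)] CD.mult_quotient)
      finally show "F (X \<otimes>\<^bsub>ZB.quotient_group\<^esub> Y) = F X \<otimes>\<^bsub>CD.quotient_group\<^esub> F Y" .
    qed
    show "bij_betw F (carrier ZB.quotient_group) (carrier CD.quotient_group)"
      unfolding bij_betw_def
    proof
      show "inj_on F (carrier ZB.quotient_group)"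
      proof (rule inj_onI)
        fix X Y assume "X \<in> carrier ZB.quotient_group" "Y \<in> carrier ZB.quotient_group" and eq: "F X = F Y"
        then obtain \<sigma> \<tau> where *: "\<sigma> \<in> C" "X = coset B (N \<sigma>)" "\<tau> \<in> C" "Y = coset B (N \<tau>)"
          using ex by meson
        then have "(\<lambda>c. \<sigma> c - \<tau> c) \<in> D" using eq F by (simp add: chain_coset_eq_iff[OF CD.B])
        then have "N (\<lambda>c. \<sigma> c - \<tau> c) \<in> B" using BD[OF chain_group_diff[OF CD.Z *(1,3)]] by simp
        then show "X = Y" by (simp add: * diff chain_coset_eq_iff[OF ZB.B])
      qed
      show "F ` carrier ZB.quotient_group = carrier CD.quotient_group"
      proof (intro equalityI subsetI)
        fix Y assume "Y \<in> F ` carrier ZB.quotient_group"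
        then obtain \<sigma> where "\<sigma> \<in> C" "Y = F (coset B (N \<sigma>))" using ex by blast
        then show "Y \<in> carrier CD.quotient_group" using F CD.coset_in_carrier by simp
      next
        fix Y assume "Y \<in> carrier CD.quotient_group"
        then obtain \<sigma> where \<sigma>: "\<sigma> \<in> C" "Y = coset D \<sigma>" by (auto simp: CD.carrier_quotient)
        then have "Y = F (coset B (N \<sigma>))" using F by simp
        then show "Y \<in> F ` carrier ZB.quotient_group" using ZB.coset_in_carrier[OF N[OF \<sigma>(1)]] by blast
      qed
    qed
  qed
qed

lemma chain_group_set_mult:
  assumes "chain_group H" "chain_group K" shows "chain_group (H <#>\<^bsub>int_chains\<^esub> K)"
proof (rule chain_groupI)
  show "(\<lambda>_. 0) \<in> H <#>\<^bsub>int_chains\<^esub> K"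
    unfolding chain_set_mult using chain_group_zero[OF assms(1)] chain_group_zero[OF assms(2)] by force
  fix a b assume "a \<in> H <#>\<^bsub>int_chains\<^esub> K" "b \<in> H <#>\<^bsub>int_chains\<^esub> K"
  then obtain h k h' k' where *: "h \<in> H" "k \<in> K" "h' \<in> H" "k' \<in> K"
    "a = (\<lambda>c. h c + k c)" "b = (\<lambda>c. h' c + k' c)" unfolding chain_set_mult by blast
  have eq: "(\<lambda>c. a c - b c) = (\<lambda>c. (h c - h' c) + (k c - k' c))" by (simp add: * algebra_simps)
  show "(\<lambda>c. a c - b c) \<in> H <#>\<^bsub>int_chains\<^esub> K"
    unfolding chain_set_mult
    by (intro CollectI bexI[of _ "\<lambda>c. h c - h' c"] bexI[of _ "\<lambda>c. k c - k' c"])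
      (rule eq, rule chain_group_diff[OF assms(2) *(2,4)], rule chain_group_diff[OF assms(1) *(1,3)])
qed

lemma additive_zero:
  fixes d :: "('c \<Rightarrow> int) \<Rightarrow> 'd \<Rightarrow> int"
  assumes "\<And>a b. d (\<lambda>c. a c - b c) = (\<lambda>c. d a c - d b c)" shows "d (\<lambda>_. 0) = (\<lambda>_. 0)"
  using assms[of "\<lambda>_. 0" "\<lambda>_. 0"] by simp

lemma chain_group_image:
  fixes d :: "('c \<Rightarrow> int) \<Rightarrow> 'd \<Rightarrow> int"
  assumes d: "\<And>a b. d (\<lambda>c. a c - b c) = (\<lambda>c. d a c - d b c)" and Z: "chain_group Z"
  shows "chain_group (d ` Z)"
proof (rule chain_groupI)
  show "(\<lambda>_. 0) \<in> d ` Z" using chain_group_zero[OF Z] additive_zero[of d] d by force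
  fix a b assume "a \<in> d ` Z" "b \<in> d ` Z"
  then obtain x y where "x \<in> Z" "y \<in> Z" "a = d x" "b = d y" by blast
  then show "(\<lambda>c. a c - b c) \<in> d ` Z"
    using chain_group_diff[OF Z, of x y] by (intro image_eqI[of _ _ "\<lambda>c. x c - y c"]) (simp_all add: d)
qed

context
  fixes F :: "int \<Rightarrow> int \<Rightarrow> ('c \<Rightarrow> int) set" and d :: "int \<Rightarrow> ('c \<Rightarrow> int) \<Rightarrow> 'c \<Rightarrow> int"
  assumes F: "\<And>p n. chain_group (F p n)"
    and d: "\<And>n a b. d n (\<lambda>c. a c - b c) = (\<lambda>c. d n a c - d n b c)"
begin



lemma chain_group_ss_Z: "chain_group (ss_Z F d r p n)"
proof (rule chain_groupI)
  show "(\<lambda>_. 0) \<in> ss_Z F d r p n" using chain_group_zero[OF F] by (simp add: ss_Z_def additive_zero[of "d n", OF d])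
  fix a b assume "a \<in> ss_Z F d r p n" "b \<in> ss_Z F d r p n"
  then show "(\<lambda>c. a c - b c) \<in> ss_Z F d r p n" using chain_group_diff[OF F] by (simp add: ss_Z_def d)
qed

lemma chain_group_ss_B: "chain_group (ss_B F d r p n)"
  unfolding ss_B_def by (intro chain_group_set_mult chain_group_image chain_group_ss_Z d)

end

section \<open>Winding numbers over the edges\<close>

lemma cis_Arg2pi_unit: "norm z = 1 \<Longrightarrow> cis (Arg2pi z) = z"
  using complex_norm_eq_1_exp[of z] by (simp add: cis_conv_exp)

lemma Arg2pi_of_cis: "0 \<le> a \<Longrightarrow> a < 2 * pi \<Longrightarrow> Arg2pi (cis a) = a"
  by (rule Arg2pi_unique[of 1]) (auto simp: cis_conv_exp)

lemma unit_quotient_not_nonneg: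
  fixes u p :: complex
  assumes "norm u = 1" "norm p = 1" "u \<noteq> p" shows "u / p \<notin> \<real>\<^sub>\<ge>\<^sub>0"
proof
  assume "u / p \<in> \<real>\<^sub>\<ge>\<^sub>0"
  then obtain r where r: "u / p = of_real r" "r \<ge> 0" by (auto elim: nonneg_Reals_cases)
  have "norm (u / p) = 1" using assms by (simp add: norm_divide)
  then have "r = 1" using r by simp
  then show False using r assms by (auto simp: field_simps)
qed

lemma tendsto_Arg2pi_quotient:
  assumes "norm u = 1" "norm p = 1" "u \<noteq> p"
  shows "((\<lambda>q. Arg2pi (u / q)) \<longlongrightarrow> Arg2pi (u / p)) (at p within S)"
proof (rule isCont_tendsto_compose[OF continuous_at_Arg2pi[OF unit_quotient_not_nonneg[OF assms]]])
  have "p \<noteq> 0" using assms by auto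
  then show "((\<lambda>q. u / q) \<longlongrightarrow> u / p) (at p within S)" by (intro tendsto_intros)
qed

text \<open>As \<open>p\<close> passes \<open>u\<close> in the anticlockwise direction, the angle from \<open>p\<close> to \<open>u\<close> jumps from
  \<open>0\<close> to \<open>2\<pi>\<close>.\<close>

lemma tendsto_Arg2pi_beside:
  assumes u: "norm u = 1" and g: "norm g = 1" and \<sigma>: "\<sigma> = 1 \<or> \<sigma> = - 1"
  shows "((\<lambda>s. Arg2pi (u / (g * cis (\<sigma> * s)))) \<longlongrightarrow> Arg2pi (u / g) + (if u = g \<and> \<sigma> = 1 then 2 * pi else 0))
    (at_right 0)"
proof (cases "u = g")
  case False
  have g0: "g \<noteq> 0" using g by auto
  have "((\<lambda>s. u / (g * cis (\<sigma> * s))) \<longlongrightarrow> u / (g * cis (\<sigma> * 0))) (at_right (0::real))"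
    unfolding cis_conv_exp by (intro tendsto_intros) (simp add: g0)
  then have "((\<lambda>s. u / (g * cis (\<sigma> * s))) \<longlongrightarrow> u / g) (at_right (0::real))" by simp
  then have "((\<lambda>s. Arg2pi (u / (g * cis (\<sigma> * s)))) \<longlongrightarrow> Arg2pi (u / g)) (at_right 0)"
    by (rule isCont_tendsto_compose[OF continuous_at_Arg2pi[OF unit_quotient_not_nonneg[OF u g False]]])
  then show ?thesis using False by simp
next
  case True
  have g0: "g \<noteq> 0" using g by auto
  have a0: "Arg2pi (u / g) = 0" using True g0 Arg2pi_of_cis[of 0] by simp
  have ev: "\<forall>\<^sub>F s in at_right 0. (if \<sigma> = 1 then 2 * pi - s else s) = Arg2pi (u / (g * cis (\<sigma> * s)))"
  proof (rule eventually_at_rightI[of 0 "2 * pi"])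
    fix s :: real assume s: "s \<in> {0<..<2 * pi}"
    have "u / (g * cis (\<sigma> * s)) = 1 / cis (\<sigma> * s)" using True g0 by simp
    also have "\<dots> = cis (- (\<sigma> * s))" by (simp add: cis_inverse divide_inverse del: cis_cnj)
    also have "\<dots> = cis (if \<sigma> = 1 then 2 * pi - s else s)"
      using \<sigma> by (auto simp: cis_divide[symmetric] simp del: cis_cnj) (simp add: cis_inverse divide_inverse del: cis_cnj)
    finally show "(if \<sigma> = 1 then 2 * pi - s else s) = Arg2pi (u / (g * cis (\<sigma> * s)))"
      using Arg2pi_of_cis[of "if \<sigma> = 1 then 2 * pi - s else s"] s by auto
  qed simp
  have "((\<lambda>s. if \<sigma> = 1 then 2 * pi - s else s) \<longlongrightarrow> (if \<sigma> = 1 then 2 * pi - 0 else 0)) (at_right (0::real))"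
    by (cases "\<sigma> = 1") (auto intro!: tendsto_eq_intros)
  then have "((\<lambda>s. Arg2pi (u / (g * cis (\<sigma> * s)))) \<longlongrightarrow> (if \<sigma> = 1 then 2 * pi - 0 else 0)) (at_right (0::real))"
    by (rule Lim_transform_eventually[OF _ ev])
  moreover have "Arg2pi (u / g) + (if u = g \<and> \<sigma> = 1 then 2 * pi else 0) = (if \<sigma> = 1 then 2 * pi - 0 else 0)"
    using True a0 by simp
  ultimately show ?thesis by (simp only:)
qed

locale angled_tiling = marked_tiling T for T :: "'l marked_tiling" +
  fixes \<rho> :: "complex set \<Rightarrow> real"
  assumes angles: "edge_angles T \<rho>"
begin

lemma rho_move: "e \<in> kcells T 1 \<Longrightarrow> e' \<in> kcells T 1 \<Longrightarrow> \<phi> \<in> star_transports T e e' \<Longrightarrow> \<rho> e' = \<rho> e"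
  using angles unfolding edge_angles_def by blast

text \<open>The congruence \<open>\<rho> \<equiv> \<bar>\<tau>\<^sub>l\<bar> - \<bar>\<tau>\<^sub>r\<bar>\<close> is imposed on one representative of each class of edges. Written
  with rotations instead of angles it is invariant, because a motion rotates both tiles alike.\<close>

lemma tau_left_eq:
  assumes e': "e' \<in> kcells T 1"
  shows "tau T (left_tile T e') = cis (\<rho> e') * tau T (right_tile T e')"
proof -
  obtain e n where e: "e \<in> kcells T 1" "star_transports T e e' \<noteq> {}"
    and \<rho>: "\<rho> e = Arg2pi (tau T (left_tile T e)) - Arg2pi (tau T (right_tile T e)) + 2 * pi * of_int n"
    using angles e' unfolding edge_angles_def by blast
  obtain \<phi> where \<phi>: "\<phi> \<in> star_transports T e e'" using e by blast
  have l: "norm (tau T (left_tile T e)) = 1" and r: "norm (tau T (right_tile T e)) = 1"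
    using tau_norm left_tile_side(1)[OF e(1)] right_tile_side(1)[OF e(1)] by auto
  have "Arg2pi (tau T (left_tile T e)) + 2 * pi * of_int n = \<rho> e + Arg2pi (tau T (right_tile T e))"
    using \<rho> by simp
  then have "cis (Arg2pi (tau T (left_tile T e))) * cis (2 * pi * of_int n) = cis (\<rho> e) * cis (Arg2pi (tau T (right_tile T e)))"
    by (simp only: cis_mult)
  then have "tau T (left_tile T e) = cis (\<rho> e) * tau T (right_tile T e)"
    by (simp add: cis_Arg2pi_unit l r cis_multiple_2pi)
  then show ?thesis
    using edge_move[OF \<phi> e(1) e'] rho_move[OF e(1) e' \<phi>]
      tau_move[OF \<phi> left_tile_side(1,2)[OF e(1)]] tau_move[OF \<phi> right_tile_side(1,2)[OF e(1)]] by simp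
qed

text \<open>A path on the circle starts at \<open>\<tau>\<close> of the right tile and turns by the angle \<open>\<rho> e\<close>, so that
  it ends at \<open>\<tau>\<close> of the left tile. The number \<open>wind e p\<close> counts, with sign, how often it passes
  \<open>p\<close>.\<close>

definition wind :: "complex set \<Rightarrow> complex \<Rightarrow> int" where
  "wind e p = \<lfloor>(Arg2pi (tau T (right_tile T e) / p) + \<rho> e) / (2 * pi)\<rfloor>"

lemma wind_eq:
  assumes e: "e \<in> kcells T 1" and p: "norm p = 1"
  shows "2 * pi * of_int (wind e p) =
    \<rho> e + Arg2pi (tau T (right_tile T e) / p) - Arg2pi (tau T (left_tile T e) / p)"
proof -
  define a b where "a = Arg2pi (tau T (right_tile T e) / p)" and "b = Arg2pi (tau T (left_tile T e) / p)"
  have l: "norm (tau T (left_tile T e) / p) = 1" and r: "norm (tau T (right_tile T e) / p) = 1"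
    using tau_norm left_tile_side(1)[OF e] right_tile_side(1)[OF e] p by (auto simp: norm_divide)
  have "cis (a + \<rho> e) = tau T (right_tile T e) / p * cis (\<rho> e)"
    by (simp only: cis_mult[symmetric] a_def cis_Arg2pi_unit[OF r])
  also have "\<dots> = tau T (left_tile T e) / p" by (simp add: tau_left_eq[OF e])
  also have "\<dots> = cis b" by (simp only: b_def cis_Arg2pi_unit[OF l])
  finally have "cis (a + \<rho> e) = cis b" .
  then have "cos (a + \<rho> e) = cos b" "sin (a + \<rho> e) = sin b" by (auto simp: complex_eq_iff)
  then obtain n :: int where n: "a + \<rho> e = b + 2 * pi * of_int n" using sin_cos_eq_iff by metis
  have b: "0 \<le> b" "b < 2 * pi" using Arg2pi by (auto simp: b_def)
  have "(a + \<rho> e) / (2 * pi) = b / (2 * pi) + of_int n" by (simp add: n add_divide_distrib)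
  moreover have "0 \<le> b / (2 * pi)" "b / (2 * pi) < 1" using b by auto
  ultimately have "wind e p = n" unfolding wind_def a_def[symmetric] by (simp add: floor_eq_iff)
  then show ?thesis using n by (simp add: a_def b_def)
qed

text \<open>The right hand side of \<open>wind_eq\<close> is continuous off the cuts, and \<open>wind\<close> takes integer values.\<close>

lemma wind_constant:
  assumes e: "e \<in> kcells T 1" and p: "p \<in> off_cuts e" and q: "q \<in> arc e p"
  shows "wind e q = wind e p"
proof (rule connected_local_const[OF arc_at_connected q arc_at_refl[OF p]])
  show "\<forall>a\<in>arc e p. eventually (\<lambda>b. wind e a = wind e b) (at a within arc e p)"
  proof
    fix a assume "a \<in> arc e p"
    then have a: "a \<in> off_cuts e" using arc_at_subset by blast
    have ne: "tau T (left_tile T e) \<noteq> a" "tau T (right_tile T e) \<noteq> a" using a cuts_edge[OF e] by auto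
    have n: "norm (tau T (left_tile T e)) = 1" "norm (tau T (right_tile T e)) = 1" "norm a = 1"
      using tau_norm left_tile_side(1)[OF e] right_tile_side(1)[OF e] a by auto
    define \<beta> where "\<beta> b = \<rho> e + Arg2pi (tau T (right_tile T e) / b) - Arg2pi (tau T (left_tile T e) / b)" for b
    have "(\<beta> \<longlongrightarrow> \<beta> a) (at a within arc e p)"
      unfolding \<beta>_def using n ne by (intro tendsto_intros tendsto_Arg2pi_quotient) auto
    then have 1: "eventually (\<lambda>b. dist (\<beta> b) (\<beta> a) < 2 * pi) (at a within arc e p)"
      by (rule tendstoD) simp
    have 2: "eventually (\<lambda>b. b \<in> arc e p) (at a within arc e p)" by (simp add: eventually_at_filter)
    show "eventually (\<lambda>b. wind e a = wind e b) (at a within arc e p)" using 1 2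
    proof eventually_elim
      case (elim b)
      then have "norm b = 1" using arc_at_subset by fastforce
      then have "\<bar>2 * pi * of_int (wind e b) - 2 * pi * of_int (wind e a)\<bar> < 2 * pi"
        using elim(1) wind_eq[OF e] n(3) by (simp add: \<beta>_def dist_real_def)
      then have "2 * pi * \<bar>of_int (wind e b - wind e a)\<bar> < 2 * pi * 1"
        by (simp add: right_diff_distrib[symmetric] abs_mult)
      then have "\<bar>of_int (wind e b - wind e a) :: real\<bar> < 1" by (rule mult_left_less_imp_less) simp
      then show ?case by linarith
    qed
  qed
qed

lemma wind_on_arc: "e \<in> kcells T 1 \<Longrightarrow> p \<in> off_cuts e \<Longrightarrow> on_arc (wind e) (arc e p) = wind e p"
  by (rule on_arc_eq[OF arc_at_refl]) (metis wind_constant)+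

text \<open>So the winding numbers form a chain on the circle whose boundary is the end point minus the
  starting point of the path.\<close>

lemma wind_jump:
  assumes e: "e \<in> kcells T 1" and g: "norm g = 1"
  shows "on_arc (wind e) (arc_before e g) - on_arc (wind e) (arc_after e g)
    = of_bool (g = tau T (left_tile T e)) - of_bool (g = tau T (right_tile T e))"
proof -
  let ?l = "tau T (left_tile T e)" and ?r = "tau T (right_tile T e)"
  have n: "norm ?l = 1" "norm ?r = 1" using tau_norm left_tile_side(1)[OF e] right_tile_side(1)[OF e] by auto
  have W: "2 * pi * of_int (on_arc (wind e) (arc_beside \<sigma> (cuts T e) g)) =
      \<rho> e + (Arg2pi (?r / g) + (if ?r = g \<and> \<sigma> = 1 then 2 * pi else 0))
        - (Arg2pi (?l / g) + (if ?l = g \<and> \<sigma> = 1 then 2 * pi else 0))"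
    if \<sigma>: "\<sigma> = 1 \<or> \<sigma> = - 1" for \<sigma> :: real
  proof (rule tendsto_unique[OF trivial_limit_at_right_real])
    let ?f = "\<lambda>s. \<rho> e + Arg2pi (?r / (g * cis (\<sigma> * s))) - Arg2pi (?l / (g * cis (\<sigma> * s)))"
    show "(?f \<longlongrightarrow> \<rho> e + (Arg2pi (?r / g) + (if ?r = g \<and> \<sigma> = 1 then 2 * pi else 0))
        - (Arg2pi (?l / g) + (if ?l = g \<and> \<sigma> = 1 then 2 * pi else 0))) (at_right 0)"
      by (intro tendsto_intros tendsto_Arg2pi_beside n g \<sigma>)
    have "\<forall>\<^sub>F s in at_right 0. 2 * pi * of_int (on_arc (wind e) (arc_beside \<sigma> (cuts T e) g)) = ?f s"
      using eventually_arc_beside[OF cuts_finite[OF kcells_cells[OF e]] g \<sigma>]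
    proof eventually_elim
      case (elim s)
      then have "on_arc (wind e) (arc_beside \<sigma> (cuts T e) g) = wind e (g * cis (\<sigma> * s))"
        using wind_on_arc[OF e, of "g * cis (\<sigma> * s)"] by auto
      moreover have "norm (g * cis (\<sigma> * s)) = 1" using g by (simp add: norm_mult)
      ultimately show ?case using wind_eq[OF e] by simp
    qed
    then show "(?f \<longlongrightarrow> 2 * pi * of_int (on_arc (wind e) (arc_beside \<sigma> (cuts T e) g))) (at_right 0)"
      by (rule Lim_transform_eventually[OF tendsto_const])
  qed
  have "2 * pi * (of_int (on_arc (wind e) (arc_before e g)) - of_int (on_arc (wind e) (arc_after e g)))
      = 2 * pi * (of_bool (g = ?l) - of_bool (g = ?r))"
    using W[of "- 1"] W[of 1] by (auto simp: right_diff_distrib)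
  then have "(of_int (on_arc (wind e) (arc_before e g)) - of_int (on_arc (wind e) (arc_after e g)) :: real)
      = of_bool (g = ?l) - of_bool (g = ?r)" by simp
  then have "(of_int (on_arc (wind e) (arc_before e g) - on_arc (wind e) (arc_after e g)) :: real)
      = of_int (of_bool (g = ?l) - of_bool (g = ?r))" by simp
  then show ?thesis by (simp only: of_int_eq_iff)
qed

lemma wind_move:
  assumes \<phi>: "\<phi> \<in> star_transports T e e'" and e: "e \<in> kcells T 1" "e' \<in> kcells T 1"
  shows "wind e' (snd \<phi> * p) = wind e p"
proof -
  have "norm (snd \<phi>) = 1" using rot_part_norm star_transports_rigid[OF \<phi>] by blast
  then have "snd \<phi> \<noteq> 0" by auto
  then show ?thesis
    using edge_move[OF \<phi> e] rho_move[OF e \<phi>] tau_move[OF \<phi> right_tile_side(1,2)[OF e(1)]]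
    by (simp add: wind_def)
qed

text \<open>Around a vertex, the angles of the tiles at its edges telescope. What remains of the winding
  numbers is \<open>\<omega>\<close>, for every base point \<open>p\<close>.\<close>

lemma sum_wind_around_vertex:
  assumes v: "v \<in> kcells T 0" and p: "norm p = 1"
  shows "(\<Sum>e\<in>edges_at v. incidence T e v * wind e p) = - omega T \<rho> v"
proof -
  define S where "S = (\<Sum>e\<in>edges_at v. of_int (incidence T e v) * \<rho> e)"
  let ?a = "\<lambda>t. Arg2pi (tau T t / p)"
  have "2 * pi * of_int (\<Sum>e\<in>edges_at v. incidence T e v * wind e p)
      = (\<Sum>e\<in>edges_at v. of_int (incidence T e v) * (2 * pi * of_int (wind e p)))"
    by (simp add: sum_distrib_left mult_ac)
  also have "\<dots> = (\<Sum>e\<in>edges_at v. of_int (incidence T e v) * (\<rho> e + ?a (right_tile T e) - ?a (left_tile T e)))"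
    using wind_eq[OF _ p] by (intro sum.cong) auto
  also have "\<dots> = S - (\<Sum>e\<in>edges_at v. of_int (incidence T e v) * (?a (left_tile T e) - ?a (right_tile T e)))"
    by (simp add: S_def sum_subtractf[symmetric] algebra_simps)
  also have "\<dots> = S" using sum_around_vertex[OF v, of ?a] by simp
  finally have wS: "2 * pi * of_int (\<Sum>e\<in>edges_at v. incidence T e v * wind e p) = S" .
  obtain w where w: "v = {w}" using v by (rule vertex_point)
  have "(\<Sum>e\<in>edges_at v. (if tail T e \<in> v then 1 else - 1) * \<rho> e) = (\<Sum>e\<in>edges_at v. - (of_int (incidence T e v) * \<rho> e))"
  proof (rule sum.cong[OF refl])
    fix e assume e: "e \<in> edges_at v"
    then have "tail T e = w \<or> head T e = w" "tail T e \<noteq> head T e"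
      using edge_at_vertex[of e w] v edge_segment(2)[of e] by (auto simp: w)
    then show "(if tail T e \<in> v then 1 else - 1) * \<rho> e = - (of_int (incidence T e v) * \<rho> e)"
      using incidence_edge[of e v] e v by (auto simp: w)
  qed
  also have "\<dots> = - S" by (simp add: S_def sum_negf)
  finally have sum: "(\<Sum>e\<in>edges_at v. (if tail T e \<in> v then 1 else - 1) * \<rho> e) = - S" .
  have "1 / (2 * pi) * - S = of_int (- (\<Sum>e\<in>edges_at v. incidence T e v * wind e p))"
    unfolding wS[symmetric] by simp
  then have "omega T \<rho> v = - (\<Sum>e\<in>edges_at v. incidence T e v * wind e p)"
    using v unfolding omega_def sum by (simp only: if_True of_int_eq_iff the_eq_trivial)
  then show ?thesis by simp
qed

lemma omega_ePE: "omega T \<rho> \<in> ePE_chains T 0"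
proof (rule ePE_chainsI[OF _ zero_less_one])
  show "\<forall>v. v \<notin> kcells T 0 \<longrightarrow> omega T \<rho> v = 0" by (simp add: omega_def)
  fix v v' \<phi> assume v: "v \<in> kcells T 0" "v' \<in> kcells T 0" and \<phi>: "\<phi> \<in> transports T v v' 1"
  have st: "\<phi> \<in> star_transports T v v'" using transports_star[OF \<phi> kcells_cells[OF v(1)]] by simp
  have n: "norm (snd \<phi>) = 1" using rot_part_norm star_transports_rigid[OF st] by blast
  have "wind (move \<phi> ` e) (snd \<phi> * 1) = wind e 1" if e: "e \<in> edges_at v" for e
    using star_transports_mono[OF st, of e] star_transports_cell(1)[OF st, of e 1] e
    by (intro wind_move) (auto simp: kcells_def)
  then have "(\<Sum>e\<in>edges_at v. incidence T (move \<phi> ` e) v' * wind (move \<phi> ` e) (snd \<phi>))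
      = (\<Sum>e\<in>edges_at v. incidence T e v * wind e 1)"
    using incidence_move[OF st v] by simp
  moreover have "(\<Sum>e\<in>edges_at v. incidence T (move \<phi> ` e) v' * wind (move \<phi> ` e) (snd \<phi>))
      = (\<Sum>e\<in>edges_at v'. incidence T e v' * wind e (snd \<phi>))"
    by (rule sum.reindex_bij_betw[OF star_transports_bij[OF st, of 1]])
  ultimately show "omega T \<rho> v = omega T \<rho> v'"
    using sum_wind_around_vertex[OF v(1), of 1] sum_wind_around_vertex[OF v(2) n] by simp
qed

text \<open>A lift of the fundamental cycle of the plane. Each tile is placed at its rotation \<open>\<tau>\<close>; over an
  edge, the rotations of the two adjacent tiles are joined by the path that \<open>\<rho>\<close> prescribes. The
  signs are chosen such that the boundary becomes \<open>\<omega>\<close> and not \<open>- \<omega>\<close>.\<close>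

definition lifted_plane :: "rot_cell \<Rightarrow> int" where
  "lifted_plane z =
     (if fst z \<in> tiles T \<and> snd z = {tau T (fst z)} then - turn T (fst z)
      else if fst z \<in> kcells T 1 \<and> snd z \<in> arcs T (fst z) then - on_arc (wind (fst z)) (snd z)
      else 0)"

lemma lifted_plane_tile: "t \<in> tiles T \<Longrightarrow> lifted_plane (t, {g}) = - turn T t * of_bool (g = tau T t)"
  using kcells_eq[of t 2 1] by (auto simp: lifted_plane_def)

lemma lifted_plane_edge:
  "e \<in> kcells T 1 \<Longrightarrow> I \<in> arcs T e \<Longrightarrow> lifted_plane (e, I) = - on_arc (wind e) I"
  using kcells_eq[of e 2 1] by (auto simp: lifted_plane_def)

lemma lifted_plane_outside: "\<forall>z. z \<notin> rot_cells T 2 \<longrightarrow> lifted_plane z = 0"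
  by (auto simp: lifted_plane_def rot_cells_iff cuts_def)

lemma lifted_plane_PE: "lifted_plane \<in> PE_chains T 2"
proof (rule PE_chainsI[OF lifted_plane_outside zero_less_one])
  fix c1 c2 \<phi> z assume c: "c1 \<in> cells T" and \<phi>: "\<phi> \<in> transports T c1 c2 1"
    and z: "z \<in> rot_cells T 2" "fst z = c1"
  have st: "\<phi> \<in> star_transports T c1 c2" using transports_star[OF \<phi> c] by simp
  have n: "norm (snd \<phi>) = 1" using rot_part_norm star_transports_rigid[OF st] by blast
  then have n0: "snd \<phi> \<noteq> 0" by auto
  from z(1) show "lifted_plane z = lifted_plane (rot_move \<phi> z)"
  proof (cases rule: rot_cells_2_cases)
    case (1 e p)
    then have e: "e = c1" using z by simp
    have e2: "c2 \<in> kcells T 1"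
      using star_transports_cell(1)[OF st, of c1 1] star_transports_image[OF st] 1 e by simp
    have st': "\<phi> \<in> star_transports T e c2" using st e by simp
    show ?thesis
      unfolding 1(1) rot_move_arc(1)[OF st' 1(3)]
      using rot_move_arc(2)[OF st' 1(3)] 1(2,3) e2 wind_move[OF st' 1(2) e2, of p]
      by (simp add: lifted_plane_edge arc_in_arcs wind_on_arc)
  next
    case (2 t g)
    then have t: "t = c1" using z by simp
    have t2: "c2 \<in> tiles T" "move \<phi> ` t = c2"
      using star_transports_cell(1)[OF st, of c1 2] star_transports_image[OF st] 2 t by auto
    have st': "\<phi> \<in> star_transports T t c2" using st t by simp
    show ?thesis
      unfolding 2(1) rot_move_point(1)[OF st']
      using 2(2) t2 n0 tau_move[OF st' 2(2)] turn_move[OF st' 2(2)] by (simp add: lifted_plane_tile)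
  qed
qed

text \<open>Over an edge, the two adjacent tiles contribute the end points of the path and cancel against
  its boundary. Over a vertex, the winding numbers of the edges add up to \<open>\<omega>\<close>.\<close>

lemma boundary_lifted_plane: "PE_boundary T 2 lifted_plane = nu_chain T 0 (omega T \<rho>)"
proof
  fix z
  show "PE_boundary T 2 lifted_plane z = nu_chain T 0 (omega T \<rho>) z"
  proof (cases "z \<in> rot_cells T 1")
    case False
    then show ?thesis using PE_boundary_outside[of z 2] nu_chain_outside[of z 0] by simp
  next
    case True
    then show ?thesis
    proof (cases rule: rot_cells_1_cases)
      case (1 v p)
      have "lifted_plane (e, arc e p) = - wind e p" if "e \<in> edges_at v" for e
      proof -
        have "p \<in> off_cuts e" using 1(3) that cuts_mono[of v e] by auto
        then show ?thesis using that by (simp add: lifted_plane_edge arc_in_arcs wind_on_arc)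
      qed
      then have "PE_boundary T 2 lifted_plane z = (\<Sum>e\<in>edges_at v. incidence T e v * - wind e p)"
        using boundary_at_vertex_arc[OF lifted_plane_outside 1(2,3)] 1(1) by simp
      also have "\<dots> = omega T \<rho> v" using sum_wind_around_vertex[OF 1(2), of p] 1(3) by (simp add: sum_negf)
      finally show ?thesis using nu_chain_arc[OF 1(2,3)] 1(1) by simp
    next
      case (2 e g)
      have g: "norm g = 1" using 2(3) cuts_sphere by fastforce
      have "turn T t * turn T t = 1" if "t \<in> tiles T" for t using turn_sign[OF that] by auto
      then have "turn T t * lifted_plane (t, {g}) = - of_bool (g = tau T t)" if "t \<in> tiles T" for t
        using that by (simp add: lifted_plane_tile mult.assoc[symmetric])
      then show ?thesis
        unfolding 2(1) boundary_at_edge_point[OF lifted_plane_outside 2(2,3)] nu_chain_point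
        using wind_jump[OF 2(2) g] left_tile_side(1)[OF 2(2)] right_tile_side(1)[OF 2(2)]
        by (simp add: lifted_plane_edge[OF 2(2)] beside_in_arcs[OF kcells_cells[OF 2(2)] g])
    qed
  qed
qed

end

section \<open>The pages of the spectral sequence\<close>

context marked_tiling
begin

abbreviation PE_Z :: "int \<Rightarrow> int \<Rightarrow> int \<Rightarrow> (rot_cell \<Rightarrow> int) set" where
  "PE_Z \<equiv> ss_Z (PE_filtration T) (PE_boundary T)"

abbreviation PE_B :: "int \<Rightarrow> int \<Rightarrow> int \<Rightarrow> (rot_cell \<Rightarrow> int) set" where
  "PE_B \<equiv> ss_B (PE_filtration T) (PE_boundary T)"

lemma chain_group_PE_chains: "chain_group (PE_chains T n)"
proof (rule chain_groupI)
  show "(\<lambda>_. 0) \<in> PE_chains T n" by (rule PE_chainsI[OF _ zero_less_one]) auto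
  fix a b assume ab: "a \<in> PE_chains T n" "b \<in> PE_chains T n"
  obtain r where r: "r > 0" "\<And>c1 c2 \<phi> z. c1 \<in> cells T \<Longrightarrow> c2 \<in> cells T \<Longrightarrow> \<phi> \<in> transports T c1 c2 r \<Longrightarrow>
      z \<in> rot_cells T n \<Longrightarrow> fst z = c1 \<Longrightarrow> a z = a (rot_move \<phi> z)" by (rule PE_chainsE[OF ab(1)]) blast
  obtain s where s: "s > 0" "\<And>c1 c2 \<phi> z. c1 \<in> cells T \<Longrightarrow> c2 \<in> cells T \<Longrightarrow> \<phi> \<in> transports T c1 c2 s \<Longrightarrow>
      z \<in> rot_cells T n \<Longrightarrow> fst z = c1 \<Longrightarrow> b z = b (rot_move \<phi> z)" by (rule PE_chainsE[OF ab(2)]) blast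
  show "(\<lambda>c. a c - b c) \<in> PE_chains T n"
  proof (rule PE_chainsI)
    show "\<forall>z. z \<notin> rot_cells T n \<longrightarrow> a z - b z = 0" using PE_chains_outside[OF ab(1)] PE_chains_outside[OF ab(2)] by simp
    show "max r s > 0" using r by simp
    fix c1 c2 \<phi> z assume c: "c1 \<in> cells T" "c2 \<in> cells T" and \<phi>: "\<phi> \<in> transports T c1 c2 (max r s)"
      and z: "z \<in> rot_cells T n" "fst z = c1"
    show "a z - b z = a (rot_move \<phi> z) - b (rot_move \<phi> z)"
      using r(2)[OF c transports_antimono[OF \<phi>] z] s(2)[OF c transports_antimono[OF \<phi>] z] by simp
  qed
qed

lemma chain_group_ePE_chains: "chain_group (ePE_chains T k)"
proof (rule chain_groupI)
  show "(\<lambda>_. 0) \<in> ePE_chains T k" by (rule ePE_chainsI[OF _ zero_less_one]) auto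
  fix a b assume ab: "a \<in> ePE_chains T k" "b \<in> ePE_chains T k"
  obtain r where r: "r > 0" "\<And>c1 c2 \<phi>. c1 \<in> kcells T k \<Longrightarrow> c2 \<in> kcells T k \<Longrightarrow> \<phi> \<in> transports T c1 c2 r \<Longrightarrow> a c1 = a c2"
    by (rule ePE_chainsE[OF ab(1)]) blast
  obtain s where s: "s > 0" "\<And>c1 c2 \<phi>. c1 \<in> kcells T k \<Longrightarrow> c2 \<in> kcells T k \<Longrightarrow> \<phi> \<in> transports T c1 c2 s \<Longrightarrow> b c1 = b c2"
    by (rule ePE_chainsE[OF ab(2)]) blast
  show "(\<lambda>c. a c - b c) \<in> ePE_chains T k"
  proof (rule ePE_chainsI)
    show "\<forall>c. c \<notin> kcells T k \<longrightarrow> a c - b c = 0" using ePE_chains_outside[OF ab(1)] ePE_chains_outside[OF ab(2)] by simp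
    show "max r s > 0" using r by simp
    fix c1 c2 \<phi> assume c: "c1 \<in> kcells T k" "c2 \<in> kcells T k" and \<phi>: "\<phi> \<in> transports T c1 c2 (max r s)"
    show "a c1 - b c1 = a c2 - b c2"
      using r(2)[OF c transports_antimono[OF \<phi>]] s(2)[OF c transports_antimono[OF \<phi>]] by simp
  qed
qed

lemma chain_group_filtration: "chain_group (PE_filtration T p n)"
proof (rule chain_groupI)
  show "(\<lambda>_. 0) \<in> PE_filtration T p n"
    using chain_group_zero[OF chain_group_PE_chains] by (simp add: PE_filtration_def)
  fix a b assume ab: "a \<in> PE_filtration T p n" "b \<in> PE_filtration T p n"
  then have "(\<lambda>c. a c - b c) \<in> PE_chains T n"
    by (intro chain_group_diff[OF chain_group_PE_chains]) (auto simp: PE_filtration_def)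
  moreover have "aff_dim (fst z) \<le> p" if "a z - b z \<noteq> 0" for z
  proof -
    have "a z \<noteq> 0 \<or> b z \<noteq> 0" using that by auto
    then show ?thesis using ab unfolding PE_filtration_def by blast
  qed
  ultimately show "(\<lambda>c. a c - b c) \<in> PE_filtration T p n" unfolding PE_filtration_def by blast
qed

lemma filtration_outside: "x \<in> PE_filtration T p n \<Longrightarrow> \<forall>z. z \<notin> rot_cells T n \<longrightarrow> x z = 0"
  unfolding PE_filtration_def PE_chains_def by blast

lemma filtration_top: "x \<in> PE_filtration T p n \<longleftrightarrow> x \<in> PE_chains T n" if "p \<ge> 2"
proof -
  have "aff_dim c \<le> p" for c :: "complex set" using aff_dim_le_DIM[of c] that by simp
  then show ?thesis by (simp add: PE_filtration_def)
qed

lemma filtration_vanishes: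
  assumes x: "x \<in> PE_filtration T p n" and c: "c \<in> kcells T k" "p < k" shows "x (c, A) = 0"
proof (rule ccontr)
  assume "x (c, A) \<noteq> 0"
  then have "aff_dim (fst (c, A)) \<le> p" using x unfolding PE_filtration_def by blast
  then show False using c by (simp add: kcells_def)
qed

text \<open>A chain of degree \<open>n\<close> lives over cells of dimension \<open>n - 1\<close> and \<open>n\<close>.\<close>

lemma filtration_trivial:
  assumes "p < 0 \<or> p < n - 1" shows "PE_filtration T p n = {\<lambda>_. 0}"
proof (intro equalityI subsetI)
  fix x assume x: "x \<in> PE_filtration T p n"
  have "x z = 0" for z
  proof (rule ccontr)
    assume xz: "x z \<noteq> 0"
    then have "z \<in> rot_cells T n" using filtration_outside[OF x] by blast
    then have "fst z \<in> kcells T n \<or> fst z \<in> kcells T (n - 1)" by (cases z) (auto simp: rot_cells_iff)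
    then obtain k where k: "fst z \<in> kcells T k" "k = n \<or> k = n - 1" by blast
    then have "aff_dim (fst z) \<ge> n - 1" "aff_dim (fst z) \<ge> 0"
      using kcells_range[OF k(1)] by (auto simp: kcells_def)
    moreover have "aff_dim (fst z) \<le> p" using x xz unfolding PE_filtration_def by blast
    ultimately show False using assms by linarith
  qed
  then show "x \<in> {\<lambda>_. 0}" by auto
qed (use chain_group_zero[OF chain_group_filtration] in simp)

lemma nu_chain_diff: "nu_chain T k (\<lambda>c. \<sigma> c - \<tau> c) = (\<lambda>z. nu_chain T k \<sigma> z - nu_chain T k \<tau> z)"
  by (rule ext) (simp add: nu_chain_def)

lemma nu_chain_filtration:
  assumes \<sigma>: "\<forall>c. c \<notin> kcells T k \<longrightarrow> \<sigma> c = 0"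
  shows "nu_chain T k \<sigma> \<in> PE_filtration T k (k + 1) \<longleftrightarrow> \<sigma> \<in> ePE_chains T k"
proof -
  have "aff_dim (fst z) \<le> k" if "nu_chain T k \<sigma> z \<noteq> 0" for z
    using that by (auto simp: nu_chain_def kcells_def split: if_splits)
  moreover have "nu_chain T k \<sigma> \<in> PE_chains T (k + 1) \<longleftrightarrow> \<sigma> \<in> ePE_chains T k"
    by (rule nu_chain_PE_iff[OF \<sigma>])
  ultimately show ?thesis unfolding PE_filtration_def by blast
qed

lemma nu_chain_inject:
  assumes \<sigma>: "\<forall>c. c \<notin> kcells T k \<longrightarrow> \<sigma> c = 0" and \<tau>: "\<forall>c. c \<notin> kcells T k \<longrightarrow> \<tau> c = 0"
    and eq: "nu_chain T k \<sigma> = nu_chain T k \<tau>"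
  shows "\<sigma> = \<tau>"
proof
  fix c
  show "\<sigma> c = \<tau> c"
  proof (cases "c \<in> kcells T k")
    case True
    obtain p where p: "p \<in> off_cuts c" by (rule obtain_off_cuts[OF kcells_cells[OF True]])
    then show ?thesis using nu_chain_arc[OF True p] eq by metis
  qed (use \<sigma> \<tau> in simp)
qed

lemma eventually_beside_cut:
  assumes c: "c \<in> cells T" and g: "g \<in> cuts T c" and \<sigma>: "\<sigma> = 1 \<or> \<sigma> = - 1"
  shows "\<forall>\<^sub>F s in at_right 0. x (c, arc c (g * cis (\<sigma> * s))) = x (c, arc_beside \<sigma> (cuts T c) g)"
proof -
  have n: "norm g = 1" using g cuts_sphere by fastforce
  show ?thesis using eventually_arc_beside[OF cuts_finite[OF c] n \<sigma>] by eventually_elim auto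
qed

text \<open>On each fibre circle, the coefficients of the arcs form a piecewise constant function, and it
  does not jump at the cuts.\<close>

lemma nu_chain_if_no_jumps:
  assumes x: "\<And>c A. x (c, A) \<noteq> 0 \<Longrightarrow> c \<in> kcells T k \<and> A \<in> arcs T c"
    and jump: "\<And>c g. c \<in> kcells T k \<Longrightarrow> g \<in> cuts T c \<Longrightarrow> x (c, arc_before c g) = x (c, arc_after c g)"
  obtains \<sigma> where "\<forall>c. c \<notin> kcells T k \<longrightarrow> \<sigma> c = 0" "x = nu_chain T k \<sigma>"
proof -
  define \<sigma> where "\<sigma> c = (if c \<in> kcells T k then x (c, SOME A. A \<in> arcs T c) else 0)" for c
  have "x (c, A) = nu_chain T k \<sigma> (c, A)" for c A
  proof (cases "c \<in> kcells T k \<and> A \<in> arcs T c")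
    case True
    then have c: "c \<in> cells T" by (auto simp: kcells_def)
    have "(SOME A. A \<in> arcs T c) \<in> arcs T c" by (rule someI_ex) (use True in blast)
    then obtain q where q: "q \<in> off_cuts c" "(SOME A. A \<in> arcs T c) = arc c q" by (rule arcsE)
    from True obtain p where p: "p \<in> off_cuts c" "A = arc c p" by (auto elim: arcsE)
    have side: "\<forall>\<^sub>F s in at_right 0. x (c, arc c (g * cis (\<sigma> * s))) = x (c, arc_after c g)"
      if g: "g \<in> cuts T c" and \<sigma>: "\<sigma> = 1 \<or> \<sigma> = - 1" for g and \<sigma> :: real
      using eventually_beside_cut[OF c g \<sigma>, of x] jump[of c g] g True \<sigma> by auto
    have "x (c, arc c p) = x (c, arc c q)"
    proof (rule constant_if_no_jumps[OF cuts_finite[OF c] _ _ _ p(1) q(1), where f = "\<lambda>p. x (c, arc c p)"])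
      show "\<And>p q. p \<in> off_cuts c \<Longrightarrow> q \<in> arc c p \<Longrightarrow> x (c, arc c q) = x (c, arc c p)" by (simp add: arc_at_eq)
      show "\<And>g. g \<in> cuts T c \<Longrightarrow> \<forall>\<^sub>F s in at_right 0. x (c, arc c (g * cis s)) = x (c, arc_after c g)"
        using side[of _ 1] by simp
      show "\<And>g. g \<in> cuts T c \<Longrightarrow> \<forall>\<^sub>F s in at_right 0. x (c, arc c (g * cis (- s))) = x (c, arc_after c g)"
        using side[of _ "- 1"] by (simp del: cis_cnj)
    qed
    then show ?thesis using True p q by (simp add: nu_chain_def \<sigma>_def)
  next
    case False
    then show ?thesis using x[of c A] by (auto simp: nu_chain_def)
  qed
  then have "x = nu_chain T k \<sigma>" by auto
  moreover have "\<sigma> c = 0" if "c \<notin> kcells T k" for c using that by (simp add: \<sigma>_def)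
  ultimately show ?thesis using that by blast
qed

lemma ePE_boundary_vertex:
  assumes \<sigma>: "\<forall>c. c \<notin> kcells T 1 \<longrightarrow> \<sigma> c = 0" and v: "v \<in> kcells T 0"
  shows "ePE_boundary T 1 \<sigma> v = (\<Sum>e\<in>edges_at v. incidence T e v * \<sigma> e)"
  unfolding ePE_boundary_def
proof (rule cellular_boundary_sum)
  show "v \<in> kcells T (1 - 1)" using v by simp
  show "finite (edges_at v)" by (rule finite_cofaces[OF kcells_cells[OF v]])
  show "\<forall>z. z \<notin> kcells T 1 \<longrightarrow> \<sigma> z = 0" using \<sigma> by blast
qed (use incidence_coface[OF v kcells_cells] in simp)

lemma ePE_boundary_outside: "c \<notin> kcells T (k - 1) \<Longrightarrow> ePE_boundary T k \<sigma> c = 0"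
  by (simp add: ePE_boundary_def cellular_boundary_outside)

lemma ePE_boundary_1_ePE:
  assumes \<sigma>: "\<sigma> \<in> ePE_chains T 1" shows "ePE_boundary T 1 \<sigma> \<in> ePE_chains T 0"
proof -
  obtain r where r: "r > 0" "\<And>c1 c2 \<phi>. c1 \<in> kcells T 1 \<Longrightarrow> c2 \<in> kcells T 1 \<Longrightarrow> \<phi> \<in> transports T c1 c2 r \<Longrightarrow> \<sigma> c1 = \<sigma> c2"
    by (rule ePE_chainsE[OF \<sigma>]) blast
  obtain D where D: "D > 0" "\<And>c. c \<in> cells T \<Longrightarrow> diameter c \<le> D" by (rule cell_diameter_bound) blast
  show ?thesis
  proof (rule ePE_chainsI)
    show "\<forall>c. c \<notin> kcells T 0 \<longrightarrow> ePE_boundary T 1 \<sigma> c = 0" using ePE_boundary_outside[of _ 1] by simp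
    show "D + r > 0" using D r by simp
    fix v v' \<phi> assume v: "v \<in> kcells T 0" "v' \<in> kcells T 0" and \<phi>: "\<phi> \<in> transports T v v' (D + r)"
    have st: "\<phi> \<in> star_transports T v v'" using transports_star[OF \<phi> kcells_cells[OF v(1)]] D r by simp
    have inv: "\<sigma> (move \<phi> ` e) = \<sigma> e" if e: "e \<in> edges_at v" for e
    proof -
      have ec: "e \<in> cells T" using e by (auto simp: kcells_def)
      have "\<phi> \<in> transports T e (move \<phi> ` e) r"
        using transports_mono[OF \<phi> kcells_cells[OF v(1)] ec _ r(1)] e D(2)[OF ec] by simp
      moreover have "move \<phi> ` e \<in> kcells T 1" using star_transports_cell(1)[OF st] e by simp
      ultimately have "\<sigma> e = \<sigma> (move \<phi> ` e)" using e by (intro r(2)) auto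
      then show ?thesis by simp
    qed
    have "(\<Sum>e\<in>edges_at v'. incidence T e v' * \<sigma> e) = (\<Sum>e\<in>edges_at v. incidence T (move \<phi> ` e) v' * \<sigma> (move \<phi> ` e))"
      by (rule sum.reindex_bij_betw[OF star_transports_bij[OF st, of 1], symmetric])
    also have "\<dots> = (\<Sum>e\<in>edges_at v. incidence T e v * \<sigma> e)" using incidence_move[OF st v] inv by simp
    finally show "ePE_boundary T 1 \<sigma> v = ePE_boundary T 1 \<sigma> v'"
      using ePE_boundary_vertex[OF ePE_chains_outside[OF \<sigma>]] v by simp
  qed
qed

text \<open>Each arc over a vertex lies in one arc over every edge at the vertex, and full circles have no
  boundary in the fibres. So \<open>\<nu>\<close> commutes with the boundaries.\<close>

lemma boundary_nu_1:
  assumes \<sigma>: "\<forall>c. c \<notin> kcells T 1 \<longrightarrow> \<sigma> c = 0"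
  shows "PE_boundary T 2 (nu_chain T 1 \<sigma>) = nu_chain T 0 (ePE_boundary T 1 \<sigma>)"
proof
  fix z
  have out: "\<forall>z. z \<notin> rot_cells T 2 \<longrightarrow> nu_chain T 1 \<sigma> z = 0" using nu_chain_outside[of _ 1] by simp
  show "PE_boundary T 2 (nu_chain T 1 \<sigma>) z = nu_chain T 0 (ePE_boundary T 1 \<sigma>) z"
  proof (cases "z \<in> rot_cells T 1")
    case False
    then show ?thesis using PE_boundary_outside[of z 2] nu_chain_outside[of z 0] by simp
  next
    case True
    then show ?thesis
    proof (cases rule: rot_cells_1_cases)
      case (1 v p)
      have "nu_chain T 1 \<sigma> (e, arc e p) = \<sigma> e" if "e \<in> edges_at v" for e
        using that 1(3) cuts_mono[of v e] by (intro nu_chain_arc) auto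
      then show ?thesis
        unfolding 1(1) boundary_at_vertex_arc[OF out 1(2,3)] nu_chain_arc[OF 1(2,3)] ePE_boundary_vertex[OF \<sigma> 1(2)]
        by simp
    next
      case (2 e g)
      have g: "norm g = 1" using 2(3) cuts_sphere by fastforce
      show ?thesis
        unfolding 2(1) boundary_at_edge_point[OF out 2(2,3)] nu_chain_point
        using nu_chain_beside[OF 2(2) g, of 1 \<sigma>] nu_chain_beside[OF 2(2) g, of "- 1" \<sigma>] by simp
    qed
  qed
qed

text \<open>The chains that represent classes in \<open>E\<^sup>1\<^bsub>1,1\<^esub>\<close> are the \<open>\<nu>\<close>-chains of edges.\<close>

lemma filtration_1_cycles:
  "{x \<in> PE_filtration T 1 2. PE_boundary T 2 x \<in> PE_filtration T 0 1} = nu_chain T 1 ` ePE_chains T 1"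
proof (intro equalityI subsetI)
  fix x assume "x \<in> {x \<in> PE_filtration T 1 2. PE_boundary T 2 x \<in> PE_filtration T 0 1}"
  then have x: "x \<in> PE_filtration T 1 2" and dx: "PE_boundary T 2 x \<in> PE_filtration T 0 1" by auto
  note out = filtration_outside[OF x]
  have tile: "x (t, A) = 0" if "t \<in> tiles T" for t A using filtration_vanishes[OF x that] by simp
  have supp: "c \<in> kcells T 1 \<and> A \<in> arcs T c" if "x (c, A) \<noteq> 0" for c A
  proof -
    have "(c, A) \<in> rot_cells T 2" using out that by blast
    moreover have "c \<notin> tiles T" using tile that by blast
    ultimately show ?thesis by (simp add: rot_cells_iff)
  qed
  have jump: "x (e, arc_before e g) = x (e, arc_after e g)" if e: "e \<in> kcells T 1" and g: "g \<in> cuts T e" for e g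
    using boundary_at_edge_point[OF out e g] filtration_vanishes[OF dx e]
      tile[OF left_tile_side(1)[OF e]] tile[OF right_tile_side(1)[OF e]] by simp
  obtain \<sigma> where \<sigma>: "\<forall>c. c \<notin> kcells T 1 \<longrightarrow> \<sigma> c = 0" "x = nu_chain T 1 \<sigma>"
    by (rule nu_chain_if_no_jumps[of x 1, OF supp jump])
  then have "\<sigma> \<in> ePE_chains T 1" using x nu_chain_filtration[of 1 \<sigma>] by auto
  then show "x \<in> nu_chain T 1 ` ePE_chains T 1" using \<sigma> by blast
next
  fix x assume "x \<in> nu_chain T 1 ` ePE_chains T 1"
  then obtain \<sigma> where \<sigma>: "\<sigma> \<in> ePE_chains T 1" "x = nu_chain T 1 \<sigma>" by blast
  have "x \<in> PE_filtration T 1 2" using nu_chain_filtration[OF ePE_chains_outside[OF \<sigma>(1)]] \<sigma> by simp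
  moreover have "PE_boundary T 2 x \<in> PE_filtration T 0 1"
    using boundary_nu_1[OF ePE_chains_outside[OF \<sigma>(1)]] ePE_boundary_1_ePE[OF \<sigma>(1)]
      nu_chain_filtration[OF ePE_chains_outside[OF ePE_boundary_1_ePE[OF \<sigma>(1)]]] \<sigma>(2) by simp
  ultimately show "x \<in> {x \<in> PE_filtration T 1 2. PE_boundary T 2 x \<in> PE_filtration T 0 1}" by simp
qed

lemma boundary_nu_0: "PE_boundary T 1 (nu_chain T 0 \<sigma>) = (\<lambda>_. 0)"
proof
  fix z
  have out: "\<forall>z. z \<notin> rot_cells T 1 \<longrightarrow> nu_chain T 0 \<sigma> z = 0" using nu_chain_outside[of _ 0] by simp
  show "PE_boundary T 1 (nu_chain T 0 \<sigma>) z = 0"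
  proof (cases "z \<in> rot_cells T 0")
    case False
    then show ?thesis using PE_boundary_outside[of z 1] by simp
  next
    case True
    have "kcells T (0 - 1) = {}" using kcells_range[of _ "0 - 1"] by fastforce
    then obtain v g where z: "z = (v, {g})" "v \<in> kcells T 0" "g \<in> cuts T v"
      using True by (cases z) (auto simp: rot_cells_iff)
    have g: "norm g = 1" using z(3) cuts_sphere by fastforce
    show ?thesis
      unfolding z(1) using boundary_at_vertex_point[OF out nu_chain_point z(2,3)]
        nu_chain_beside[OF z(2) g, of 1 \<sigma>] nu_chain_beside[OF z(2) g, of "- 1" \<sigma>] by simp
  qed
qed

lemma filtration_0_cycles:
  "{x \<in> PE_filtration T 0 1. PE_boundary T 1 x = (\<lambda>_. 0)} = nu_chain T 0 ` ePE_chains T 0"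
proof (intro equalityI subsetI)
  fix x assume "x \<in> {x \<in> PE_filtration T 0 1. PE_boundary T 1 x = (\<lambda>_. 0)}"
  then have x: "x \<in> PE_filtration T 0 1" and dx: "PE_boundary T 1 x = (\<lambda>_. 0)" by auto
  note out = filtration_outside[OF x]
  have edge: "x (e, A) = 0" if "e \<in> kcells T 1" for e A using filtration_vanishes[OF x that] by simp
  have supp: "c \<in> kcells T 0 \<and> A \<in> arcs T c" if "x (c, A) \<noteq> 0" for c A
  proof -
    have "(c, A) \<in> rot_cells T 1" using out that by blast
    moreover have "c \<notin> kcells T 1" using edge that by blast
    ultimately show ?thesis by (simp add: rot_cells_iff)
  qed
  have jump: "x (v, arc_before v g) = x (v, arc_after v g)" if v: "v \<in> kcells T 0" and g: "g \<in> cuts T v" for v g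
    using boundary_at_vertex_point[OF out edge v g] dx by simp
  obtain \<sigma> where \<sigma>: "\<forall>c. c \<notin> kcells T 0 \<longrightarrow> \<sigma> c = 0" "x = nu_chain T 0 \<sigma>"
    by (rule nu_chain_if_no_jumps[of x 0, OF supp jump])
  then have "\<sigma> \<in> ePE_chains T 0" using x nu_chain_filtration[of 0 \<sigma>] by auto
  then show "x \<in> nu_chain T 0 ` ePE_chains T 0" using \<sigma> by blast
next
  fix x assume "x \<in> nu_chain T 0 ` ePE_chains T 0"
  then obtain \<sigma> where \<sigma>: "\<sigma> \<in> ePE_chains T 0" "x = nu_chain T 0 \<sigma>" by blast
  have "x \<in> PE_filtration T 0 1" using nu_chain_filtration[OF ePE_chains_outside[OF \<sigma>(1)]] \<sigma> by simp
  then show "x \<in> {x \<in> PE_filtration T 0 1. PE_boundary T 1 x = (\<lambda>_. 0)}"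
    using boundary_nu_0 \<sigma>(2) by simp
qed

subsection \<open>The term \<open>E\<^sup>2\<^bsub>0,1\<^esub>\<close>\<close>

abbreviation Z_0_1 :: "(rot_cell \<Rightarrow> int) set" where
  "Z_0_1 \<equiv> PE_Z 2 0 1"

abbreviation B_0_1 :: "(rot_cell \<Rightarrow> int) set" where
  "B_0_1 \<equiv> PE_B 2 0 1"

lemma Z_0_1_eq: "Z_0_1 = nu_chain T 0 ` ePE_chains T 0"
  using filtration_0_cycles by (simp add: ss_Z_def filtration_trivial)

lemma zero_set_mult: "{\<lambda>_. 0} <#>\<^bsub>int_chains\<^esub> K = K"
  by (auto simp: chain_set_mult)

lemma B_0_1_eq: "B_0_1 = nu_chain T 0 ` ePE_boundary T 1 ` ePE_chains T 1"
proof -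
  have d0: "PE_boundary T 1 (\<lambda>_. 0) = (\<lambda>_. 0)" using PE_boundary_diff[of 1 "\<lambda>_. 0" "\<lambda>_. 0"] by simp
  have 1: "PE_Z 1 (- 1) 1 = {\<lambda>_. 0}"
    by (auto simp: ss_Z_def filtration_trivial d0)
  have 2: "PE_Z 1 1 2 = nu_chain T 1 ` ePE_chains T 1"
    using filtration_1_cycles by (simp add: ss_Z_def)
  have "B_0_1 = PE_boundary T 2 ` nu_chain T 1 ` ePE_chains T 1"
    by (simp add: ss_B_def 1 2 zero_set_mult)
  also have "\<dots> = nu_chain T 0 ` ePE_boundary T 1 ` ePE_chains T 1"
    unfolding image_image using boundary_nu_1 ePE_chains_outside by (intro image_cong) auto
  finally show ?thesis .
qed

lemma E1_class_0_1: "E_class T 1 0 1 z = {z}"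
proof -
  have d0: "PE_boundary T n (\<lambda>_. 0) = (\<lambda>_. 0)" for n using PE_boundary_diff[of n "\<lambda>_. 0" "\<lambda>_. 0"] by simp
  have 1: "PE_Z 0 (- 1) 1 = {\<lambda>_. 0}"
    by (auto simp: ss_Z_def filtration_trivial d0)
  have 2: "PE_Z 0 0 2 = {\<lambda>_. 0}"
    using chain_group_zero[OF chain_group_filtration] by (auto simp: ss_Z_def filtration_trivial d0)
  have "PE_B 1 0 1 = {\<lambda>_. 0}"
    by (simp add: ss_B_def 1 2 zero_set_mult d0)
  then show ?thesis by (auto simp: ss_class_def chain_coset fun_eq_iff)
qed

text \<open>The classes of \<open>E\<^sup>1\<^bsub>0,1\<^esub>\<close> are single chains, so \<open>F\<^sub>1\<close> just reads off the coefficients of a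
  \<open>\<nu>\<close>-chain.\<close>

lemma F1_nu: "\<sigma> \<in> ePE_chains T 0 \<Longrightarrow> F1 T 0 (E_class T 1 0 1 (nu_chain T 0 \<sigma>)) = \<sigma>"
  unfolding F1_def E1_class_0_1
  using nu_chain_inject[OF ePE_chains_outside ePE_chains_outside] by (intro the_equality) auto

lemma homology_0: "ePE_homology T 0 = int_chains\<lparr>carrier := ePE_chains T 0\<rparr> Mod (ePE_boundary T 1 ` ePE_chains T 1)"
proof -
  have "ePE_boundary T 0 \<sigma> = (\<lambda>_. 0)" for \<sigma>
  proof
    fix c have "c \<notin> kcells T (0 - 1)" using kcells_range[of c "0 - 1"] by auto
    then show "ePE_boundary T 0 \<sigma> c = 0" by (rule ePE_boundary_outside)
  qed
  then show ?thesis by (simp add: homology_def int_chains_def)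
qed

lemma ePE_quotient: "chain_quotient (ePE_chains T 0) (ePE_boundary T 1 ` ePE_chains T 1)"
proof
  show "chain_group (ePE_boundary T 1 ` ePE_chains T 1)"
    by (rule chain_group_image[OF _ chain_group_ePE_chains])
       (simp add: ePE_boundary_def cellular_boundary_diff)
qed (use chain_group_ePE_chains ePE_boundary_1_ePE in auto)

lemma quotient_0_1: "chain_quotient Z_0_1 B_0_1"
proof
  show "B_0_1 \<subseteq> Z_0_1" unfolding Z_0_1_eq B_0_1_eq using ePE_boundary_1_ePE by blast
qed (intro chain_group_ss_Z chain_group_ss_B chain_group_filtration PE_boundary_diff)+

lemma F1_induced_iso:
  "F1_induced T 0 \<in> iso (E_page T 2 0 1) (ePE_homology T 0)"
  "\<sigma> \<in> ePE_chains T 0 \<Longrightarrow> F1_induced T 0 (E_class T 2 0 1 (nu_chain T 0 \<sigma>)) = ePE_class T 0 \<sigma>"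
proof -
  let ?D = "ePE_boundary T 1 ` ePE_chains T 1"
  have F: "F1_induced T 0 = (\<lambda>X. the_elem ((\<lambda>z. coset ?D (F1 T 0 (E_class T 1 0 1 z))) ` X))"
    by (rule ext) (simp add: F1_induced_def homology_class_def)
  have BD: "nu_chain T 0 \<sigma> \<in> B_0_1 \<longleftrightarrow> \<sigma> \<in> ?D" if \<sigma>: "\<sigma> \<in> ePE_chains T 0" for \<sigma>
  proof
    assume "nu_chain T 0 \<sigma> \<in> B_0_1"
    then obtain \<tau> where \<tau>: "\<tau> \<in> ePE_chains T 1" "nu_chain T 0 \<sigma> = nu_chain T 0 (ePE_boundary T 1 \<tau>)"
      unfolding B_0_1_eq by blast
    then have "\<sigma> = ePE_boundary T 1 \<tau>"
      by (intro nu_chain_inject[OF ePE_chains_outside[OF \<sigma>] ePE_chains_outside[OF ePE_boundary_1_ePE]])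
    then show "\<sigma> \<in> ?D" using \<tau> by blast
  qed (simp add: B_0_1_eq)
  note ind = induced_iso[OF quotient_0_1 ePE_quotient,
      where N = "nu_chain T 0" and M = "\<lambda>z. F1 T 0 (E_class T 1 0 1 z)"]
  have iso: "F1_induced T 0 \<in> iso (int_chains\<lparr>carrier := Z_0_1\<rparr> Mod B_0_1) (int_chains\<lparr>carrier := ePE_chains T 0\<rparr> Mod ?D)"
    unfolding F by (rule ind(1)) (use BD F1_nu in \<open>auto simp: Z_0_1_eq nu_chain_diff\<close>)
  then show "F1_induced T 0 \<in> iso (E_page T 2 0 1) (ePE_homology T 0)"
    by (simp add: homology_0 ss_page_def)
  assume \<sigma>: "\<sigma> \<in> ePE_chains T 0"
  have "F1_induced T 0 (coset B_0_1 (nu_chain T 0 \<sigma>)) = coset ?D \<sigma>"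
    unfolding F by (rule ind(2)) (use BD F1_nu \<sigma> in \<open>auto simp: Z_0_1_eq nu_chain_diff\<close>)
  then show "F1_induced T 0 (E_class T 2 0 1 (nu_chain T 0 \<sigma>)) = ePE_class T 0 \<sigma>"
    by (simp add: ss_class_def homology_class_def)
qed

subsection \<open>The term \<open>E\<^sup>2\<^bsub>2,0\<^esub>\<close>\<close>

abbreviation Z_2_0 :: "(rot_cell \<Rightarrow> int) set" where
  "Z_2_0 \<equiv> PE_Z 2 2 2"

abbreviation B_2_0 :: "(rot_cell \<Rightarrow> int) set" where
  "B_2_0 \<equiv> PE_B 2 2 2"

lemma Z_2_0_iff: "x \<in> Z_2_0 \<longleftrightarrow> x \<in> PE_chains T 2 \<and> PE_boundary T 2 x \<in> PE_filtration T 0 1"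
  by (simp add: ss_Z_def filtration_top)

lemma B_2_0_iff:
  "b \<in> B_2_0 \<longleftrightarrow> (\<exists>h y. h \<in> PE_filtration T 1 2 \<and> PE_boundary T 2 h \<in> PE_filtration T 0 1 \<and> y \<in> PE_chains T 3 \<and>
      b = (\<lambda>z. h z + PE_boundary T 3 y z))"
proof -
  have 1: "h \<in> PE_Z 1 1 2 \<longleftrightarrow>
      h \<in> PE_filtration T 1 2 \<and> PE_boundary T 2 h \<in> PE_filtration T 0 1" for h
    by (simp add: ss_Z_def)
  have 2: "y \<in> PE_Z 1 3 3 \<longleftrightarrow> y \<in> PE_chains T 3" for y
    using PE_boundary_3_PE[of y] by (auto simp: ss_Z_def filtration_top)
  have "B_2_0 = PE_Z 1 1 2 <#>\<^bsub>int_chains\<^esub>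
      PE_boundary T 3 ` PE_Z 1 3 3" by (simp add: ss_B_def)
  then have "b \<in> B_2_0 \<longleftrightarrow> (\<exists>h\<in>PE_Z 1 1 2.
      \<exists>y\<in>PE_Z 1 3 3. b = (\<lambda>z. h z + PE_boundary T 3 y z))"
    by (simp add: chain_set_mult)
  then show ?thesis unfolding Bex_def 1 2 by blast
qed

lemma PE_boundary_add:
  "PE_boundary T n (\<lambda>z. a z + b z) = (\<lambda>z. PE_boundary T n a z + PE_boundary T n b z)"
proof -
  have "PE_boundary T n (\<lambda>z. - b z) = (\<lambda>z. - PE_boundary T n b z)"
    using PE_boundary_diff[of n "\<lambda>_. 0" "\<lambda>_. 0"] PE_boundary_diff[of n "\<lambda>_. 0" b] by simp
  then show ?thesis using PE_boundary_diff[of n a "\<lambda>z. - b z"] by simp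
qed

lemma boundary_B_2_0: "b \<in> B_2_0 \<Longrightarrow> PE_boundary T 2 b \<in> B_0_1"
proof -
  assume "b \<in> B_2_0"
  then obtain h y where h: "h \<in> PE_filtration T 1 2" "PE_boundary T 2 h \<in> PE_filtration T 0 1"
    and y: "y \<in> PE_chains T 3" "b = (\<lambda>z. h z + PE_boundary T 3 y z)" unfolding B_2_0_iff by blast
  have "PE_boundary T 2 b = PE_boundary T 2 h"
    unfolding y(2) PE_boundary_add using boundary_boundary_3[OF PE_chains_outside[OF y(1)]] by simp
  moreover have "h \<in> nu_chain T 1 ` ePE_chains T 1" using h filtration_1_cycles by blast
  then obtain \<sigma> where "\<sigma> \<in> ePE_chains T 1" "h = nu_chain T 1 \<sigma>" by blast
  ultimately show ?thesis unfolding B_0_1_eq using boundary_nu_1[OF ePE_chains_outside, of \<sigma>] by auto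
qed

lemma quotient_2_0: "chain_quotient Z_2_0 B_2_0"
proof
  show "B_2_0 \<subseteq> Z_2_0"
  proof
    fix b assume b: "b \<in> B_2_0"
    then obtain h y where hy: "h \<in> PE_filtration T 1 2" "y \<in> PE_chains T 3" "b = (\<lambda>z. h z + PE_boundary T 3 y z)"
      unfolding B_2_0_iff by blast
    then have "b \<in> PE_chains T 2"
      using chain_group_add[OF chain_group_PE_chains _ PE_boundary_3_PE[OF hy(2)], of h] by (simp add: PE_filtration_def)
    moreover have "PE_boundary T 2 b \<in> PE_filtration T 0 1"
      using boundary_B_2_0[OF b] filtration_0_cycles ePE_boundary_1_ePE unfolding B_0_1_eq by blast
    ultimately show "b \<in> Z_2_0" by (simp add: Z_2_0_iff)
  qed
qed (intro chain_group_ss_Z chain_group_ss_B chain_group_filtration PE_boundary_diff)+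

text \<open>Representatives of a class differ by chains over edges and by boundaries. The former change the
  boundary by an element of the group that is divided out, the latter not at all.\<close>

lemma E_diff_2_0:
  assumes x: "x \<in> Z_2_0"
  shows "E_diff T 2 2 0 (E_class T 2 2 0 x) = E_class T 2 0 1 (PE_boundary T 2 x)"
proof -
  interpret Q: chain_quotient Z_0_1 B_0_1 by (rule quotient_0_1)
  have B: "chain_group B_2_0" using quotient_2_0 by (simp add: chain_quotient_def)
  have eq: "coset B_0_1 (PE_boundary T 2 z) = coset B_0_1 (PE_boundary T 2 x)"
    if "z \<in> coset B_2_0 x" for z
  proof -
    have "(\<lambda>c. z c - x c) \<in> B_2_0" using that by (simp add: chain_coset)
    then have "PE_boundary T 2 (\<lambda>c. z c - x c) \<in> B_0_1" by (rule boundary_B_2_0)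
    then show ?thesis unfolding chain_coset_eq_iff[OF Q.B] by (simp add: PE_boundary_diff)
  qed
  have "x \<in> coset B_2_0 x" using chain_group_zero[OF B] by (simp add: chain_coset)
  then have "coset B_2_0 x \<noteq> {}" by blast
  then have "the_elem ((\<lambda>z. coset B_0_1 (PE_boundary T 2 z)) ` (coset B_2_0 x)) =
      coset B_0_1 (PE_boundary T 2 x)" by (rule the_elem_image_unique) (rule eq)
  then show ?thesis by (simp add: ss_diff_def ss_class_def)
qed

lemma sum_fibre_jumps:
  fixes x :: "rot_cell \<Rightarrow> int"
  assumes c: "c \<in> cells T"
  shows "(\<Sum>g\<in>cuts T c. x (c, arc_before c g) - x (c, arc_after c g)) = 0"
proof -
  have "(\<Sum>g\<in>cuts T c. x (c, arc_after c g) - x (c, arc_before c g)) = 0"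
  proof (rule sum_jumps_circle[OF cuts_finite[OF c] cuts_sphere, where f = "\<lambda>p. x (c, arc c p)"])
    show "\<And>p q. p \<in> off_cuts c \<Longrightarrow> q \<in> arc c p \<Longrightarrow> x (c, arc c q) = x (c, arc c p)" by (simp add: arc_at_eq)
    show "\<And>g. g \<in> cuts T c \<Longrightarrow> \<forall>\<^sub>F s in at_right 0. x (c, arc c (g * cis s)) = x (c, arc_after c g)"
      using eventually_beside_cut[OF c, of _ 1 x] by simp
    show "\<And>g. g \<in> cuts T c \<Longrightarrow> \<forall>\<^sub>F s in at_right 0. x (c, arc c (g * cis (- s))) = x (c, arc_before c g)"
      using eventually_beside_cut[OF c, of _ "- 1" x] by (simp del: cis_cnj)
  qed
  then show ?thesis by (simp add: sum_subtractf)
qed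

text \<open>The total weight of a chain over a tile is all that survives in the homology of the fibre
  circle.\<close>

definition weight :: "(rot_cell \<Rightarrow> int) \<Rightarrow> complex set \<Rightarrow> int" where
  "weight x t = x (t, {tau T t}) + x (t, {- tau T t})"

lemma weight_cuts:
  assumes t: "t \<in> tiles T" shows "weight x t = (\<Sum>g\<in>cuts T t. x (t, {g}))"
proof -
  have "tau T t \<noteq> - tau T t" using tau_norm[OF t] by auto
  then show ?thesis by (simp add: cuts_tile[OF t] weight_def)
qed

text \<open>A cycle modulo the vertex fibres projects to a cellular \<open>2\<close>-cycle of the plane, which is a
  multiple of the fundamental cycle.\<close>

lemma weight_constant:
  assumes x: "x \<in> Z_2_0" and t: "t \<in> tiles T" "t' \<in> tiles T"
  shows "turn T t * weight x t = turn T t' * weight x t'"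
proof (rule constant_across_edges[OF _ t])
  fix e assume e: "e \<in> kcells T 1"
  have xP: "x \<in> PE_chains T 2" and dx: "PE_boundary T 2 x \<in> PE_filtration T 0 1" using x by (auto simp: Z_2_0_iff)
  note out = PE_chains_outside[OF xP]
  have ext: "weight x s = (\<Sum>g\<in>cuts T e. x (s, {g}))" if s: "s \<in> tiles T" "e \<subseteq> s" for s
  proof -
    have "x (s, {g}) = 0" if "g \<notin> cuts T s" for g
      using out that by (simp add: rot_cell_point_iff)
    then show ?thesis unfolding weight_cuts[OF s(1)]
      using cuts_mono[OF s(2)] cuts_finite[OF kcells_cells[OF e]] by (intro sum.mono_neutral_left) auto
  qed
  have "0 = (\<Sum>g\<in>cuts T e. PE_boundary T 2 x (e, {g}))"
    using filtration_vanishes[OF dx e] by simp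
  also have "\<dots> = (\<Sum>g\<in>cuts T e. turn T (left_tile T e) * x (left_tile T e, {g}) - turn T (right_tile T e) * x (right_tile T e, {g})
    - (x (e, arc_before e g) - x (e, arc_after e g)))"
    by (rule sum.cong[OF refl]) (rule boundary_at_edge_point[OF out e])
  also have "\<dots> = turn T (left_tile T e) * weight x (left_tile T e) - turn T (right_tile T e) * weight x (right_tile T e)"
    using sum_fibre_jumps[OF kcells_cells[OF e], of x]
    by (simp add: sum_subtractf ext left_tile_side[OF e] right_tile_side[OF e] sum_distrib_left)
  finally show "turn T (left_tile T e) * weight x (left_tile T e) = turn T (right_tile T e) * weight x (right_tile T e)"
    by simp
qed

lemma weight_boundary:
  assumes y: "y \<in> PE_chains T 3" and t: "t \<in> tiles T"
  shows "weight (PE_boundary T 3 y) t = 0"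
  unfolding weight_cuts[OF t]
  using sum_fibre_jumps[OF kcells_cells[OF t], of y]
  by (simp add: boundary_at_tile_point[OF PE_chains_outside[OF y] t])

text \<open>If the weight vanishes, the coefficient at \<open>\<tau>\<close> is moved along the half circle from
  \<open>\<tau>\<close> to \<open>-\<tau>\<close>, where it cancels.\<close>

lemma weightless_fibre_boundary:
  assumes x: "x \<in> PE_chains T 2" and w: "\<And>t. t \<in> tiles T \<Longrightarrow> weight x t = 0"
  obtains y where "y \<in> PE_chains T 3" "\<And>t A. t \<in> tiles T \<Longrightarrow> PE_boundary T 3 y (t, A) = x (t, A)"
proof -
  define h where "h t p = (if Im (p / tau T t) > 0 then - x (t, {tau T t}) else 0)" for t p
  define y where "y z = (if fst z \<in> tiles T \<and> snd z \<in> arcs T (fst z) then on_arc (h (fst z)) (snd z) else 0)" for z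
  have tau0: "tau T t \<noteq> 0" if "t \<in> tiles T" for t using tau_norm[OF that] by auto
  have hc: "h t q = h t p" if t: "t \<in> tiles T" and p: "p \<in> off_cuts t" and q: "q \<in> arc t p" for t p q
  proof (rule connected_local_const[OF arc_at_connected q arc_at_refl[OF p]])
    show "\<forall>a\<in>arc t p. eventually (\<lambda>b. h t a = h t b) (at a within arc t p)"
    proof
      fix a assume "a \<in> arc t p"
      then have a: "a \<in> off_cuts t" using arc_at_subset by blast
      have im: "Im (a / tau T t) \<noteq> 0"
      proof
        assume 0: "Im (a / tau T t) = 0"
        have "norm (a / tau T t) = 1" using a tau_norm[OF t] by (simp add: norm_divide)
        then have "\<bar>Re (a / tau T t)\<bar> = 1" using 0 by (simp add: cmod_def)
        then have "Re (a / tau T t) = 1 \<or> Re (a / tau T t) = - 1" by linarith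
        then have "a / tau T t = 1 \<or> a / tau T t = - 1" using 0 by (auto simp: complex_eq_iff)
        then have "a = tau T t \<or> a = - tau T t" using tau0[OF t] by (auto simp: field_simps)
        then show False using a cuts_tile[OF t] by auto
      qed
      have lim: "((\<lambda>b. Im (b / tau T t)) \<longlongrightarrow> Im (a / tau T t)) (at a within arc t p)"
        by (intro tendsto_intros tau0[OF t])
      show "eventually (\<lambda>b. h t a = h t b) (at a within arc t p)"
      proof (cases "Im (a / tau T t) > 0")
        case True
        from order_tendstoD(1)[OF lim True] show ?thesis by eventually_elim (use True in \<open>simp add: h_def\<close>)
      next
        case False
        then have "Im (a / tau T t) < 0" using im by linarith
        from order_tendstoD(2)[OF lim this] show ?thesis by eventually_elim (use False in \<open>simp add: h_def\<close>)
      qed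
    qed
  qed
  have y_arc: "y (t, arc t p) = h t p" if t: "t \<in> tiles T" and p: "p \<in> off_cuts t" for t p
  proof -
    have "on_arc (h t) (arc t p) = h t p"
      by (rule on_arc_eq[OF arc_at_refl[OF p]]) (metis hc[OF t p])
    then show ?thesis using t arc_in_arcs[OF p] by (simp add: y_def)
  qed
  have y_out: "\<forall>z. z \<notin> rot_cells T 3 \<longrightarrow> y z = 0" by (auto simp: y_def rot_cells_iff)
  have y_side: "y (t, arc_beside \<sigma> (cuts T t) (\<epsilon> * tau T t)) = (if of_real \<sigma> = \<epsilon> then - x (t, {tau T t}) else 0)"
    if t: "t \<in> tiles T" and \<sigma>: "\<sigma> = 1 \<or> \<sigma> = - 1" and \<epsilon>: "\<epsilon> = 1 \<or> \<epsilon> = - 1" for t \<sigma> \<epsilon>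
  proof -
    have n: "norm (\<epsilon> * tau T t) = 1" using \<epsilon> tau_norm[OF t] by (auto simp: norm_mult)
    have "\<forall>\<^sub>F s in at_right 0. s < pi" by (intro eventually_at_rightI[of 0 pi]) auto
    from obtain_beside[OF cuts_finite[OF kcells_cells[OF t]] n \<sigma> this]
    obtain s where s: "\<epsilon> * tau T t * cis (\<sigma> * s) \<in> off_cuts t"
      "arc t (\<epsilon> * tau T t * cis (\<sigma> * s)) = arc_beside \<sigma> (cuts T t) (\<epsilon> * tau T t)" "0 < s" "s < pi" by metis
    have "\<epsilon> * tau T t * cis (\<sigma> * s) / tau T t = \<epsilon> * cis (\<sigma> * s)" using tau0[OF t] by simp
    moreover have "sin s > 0" using s by (simp add: sin_gt_zero)
    ultimately have "h t (\<epsilon> * tau T t * cis (\<sigma> * s)) = (if of_real \<sigma> = \<epsilon> then - x (t, {tau T t}) else 0)"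
      using \<sigma> \<epsilon> by (auto simp: h_def)
    then show ?thesis using y_arc[OF t s(1)] s(2) by simp
  qed
  have y_PE: "y \<in> PE_chains T 3"
  proof -
    obtain r where r: "r > 0" and inv: "\<And>c1 c2 \<phi> z. c1 \<in> cells T \<Longrightarrow> c2 \<in> cells T \<Longrightarrow> \<phi> \<in> transports T c1 c2 r \<Longrightarrow>
        z \<in> rot_cells T 2 \<Longrightarrow> fst z = c1 \<Longrightarrow> x z = x (rot_move \<phi> z)"
      by (rule PE_chainsE[OF x]) blast
    show ?thesis
    proof (rule PE_chainsI[OF y_out r])
      fix c1 c2 \<phi> z assume c: "c1 \<in> cells T" "c2 \<in> cells T" and \<phi>: "\<phi> \<in> transports T c1 c2 r"
        and z: "z \<in> rot_cells T 3" "fst z = c1"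
      have st: "\<phi> \<in> star_transports T c1 c2" by (rule transports_star[OF \<phi> c(1) r])
      have "kcells T 3 = {}" using kcells_range[of _ 3] by fastforce
      then obtain p where t: "c1 \<in> tiles T" and p: "p \<in> off_cuts c1" "z = (c1, arc c1 p)"
        using z by (cases z) (auto simp: rot_cells_iff elim!: arcsE)
      have t2: "c2 \<in> tiles T" using star_transports_kcells_iff[OF st c] t by blast
      have tm: "tau T c2 = snd \<phi> * tau T c1"
        using tau_move[OF st t order_refl] star_transports_image[OF st] by simp
      have "(c1, {tau T c1}) \<in> rot_cells T 2" using t by (simp add: rot_cell_point_iff cuts_tile)
      then have "x (c1, {tau T c1}) = x (c2, {tau T c2})"
        using inv[OF c \<phi>, of "(c1, {tau T c1})"] rot_move_point(1)[OF st] tm by simp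
      moreover have "snd \<phi> \<noteq> 0" using rot_part_norm[OF star_transports_rigid[OF st]] by auto
      ultimately have "h c2 (snd \<phi> * p) = h c1 p" by (simp add: h_def tm)
      then show "y z = y (rot_move \<phi> z)"
        using y_arc[OF t p(1)] rot_move_arc[OF st p(1)] y_arc[OF t2, of "snd \<phi> * p"] p(2) by simp
    qed
  qed
  have "PE_boundary T 3 y (t, A) = x (t, A)" if t: "t \<in> tiles T" for t A
  proof (cases "(t, A) \<in> rot_cells T 2")
    case False
    then show ?thesis using PE_boundary_outside[of "(t, A)" 3 y] PE_chains_outside[OF x] by simp
  next
    case True
    then have "t \<notin> kcells T 1" using kcells_eq[OF t, of 1] by auto
    then obtain g where A: "A = {g}" "g \<in> cuts T t" using True by (auto simp: rot_cells_iff)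
    then have "PE_boundary T 3 y (t, A) = y (t, arc_before t g) - y (t, arc_after t g)"
      using boundary_at_tile_point[OF y_out t] by simp
    moreover have "g = 1 * tau T t \<or> g = - 1 * tau T t" using A cuts_tile[OF t] by auto
    ultimately show ?thesis
      using y_side[OF t, of 1 1] y_side[OF t, of "- 1" 1] y_side[OF t, of 1 "- 1"] y_side[OF t, of "- 1" "- 1"]
        w[OF t] A(1) by (auto simp: weight_def)
  qed
  with y_PE show ?thesis using that by blast
qed

text \<open>After the fibres over the tiles have been cleared by a boundary, only chains over edges are left.\<close>

lemma weightless_in_B_2_0:
  assumes x: "x \<in> Z_2_0" and w: "\<And>t. t \<in> tiles T \<Longrightarrow> weight x t = 0"
  shows "x \<in> B_2_0"
proof -
  have xP: "x \<in> PE_chains T 2" and dx: "PE_boundary T 2 x \<in> PE_filtration T 0 1" using x by (auto simp: Z_2_0_iff)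
  obtain y where y: "y \<in> PE_chains T 3" "\<And>t A. t \<in> tiles T \<Longrightarrow> PE_boundary T 3 y (t, A) = x (t, A)"
    using weightless_fibre_boundary[OF xP w] by blast
  define h where "h z = x z - PE_boundary T 3 y z" for z
  have hP: "h \<in> PE_chains T 2"
    unfolding h_def by (rule chain_group_diff[OF chain_group_PE_chains xP PE_boundary_3_PE[OF y(1)]])
  have "aff_dim (fst z) \<le> 1" if "h z \<noteq> 0" for z
  proof -
    obtain c A where z: "z = (c, A)" by (cases z)
    have "(c, A) \<in> rot_cells T 2" using PE_chains_outside[OF hP] that z by blast
    moreover have "c \<notin> tiles T" using y(2)[of c A] that z by (auto simp: h_def)
    ultimately show ?thesis using z by (auto simp: rot_cells_iff kcells_def)
  qed
  then have "h \<in> PE_filtration T 1 2" using hP unfolding PE_filtration_def by blast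
  moreover have "PE_boundary T 2 h \<in> PE_filtration T 0 1"
    using dx boundary_boundary_3[OF PE_chains_outside[OF y(1)]] by (simp add: h_def[abs_def] PE_boundary_diff)
  moreover have "x = (\<lambda>z. h z + PE_boundary T 3 y z)" by (simp add: h_def)
  ultimately show ?thesis unfolding B_2_0_iff using y(1) by blast
qed

end

context angled_tiling
begin

lemma lifted_plane_Z: "lifted_plane \<in> Z_2_0"
  using lifted_plane_PE nu_chain_filtration[OF ePE_chains_outside[OF omega_ePE]] omega_ePE
  by (simp add: Z_2_0_iff boundary_lifted_plane)

lemma weight_lifted_plane: "t \<in> tiles T \<Longrightarrow> weight lifted_plane t = - turn T t"
  using tau_norm[of t] by (auto simp: weight_def lifted_plane_tile)

text \<open>A cycle is determined up to boundaries by its multiplicity on one tile.\<close>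

lemma lifted_plane_generates:
  "E_page T 2 2 0 \<cong> integer_group"
  "generate (E_page T 2 2 0) {E_class T 2 2 0 lifted_plane} = carrier (E_page T 2 2 0)"
proof -
  interpret Q: chain_quotient Z_2_0 B_2_0 by (rule quotient_2_0)
  obtain t where t: "t \<in> tiles T" by (rule tile_at)
  have sq: "turn T t * turn T t = 1" if "t \<in> tiles T" for t using turn_sign[OF that] by auto
  have surj: "\<exists>n. (\<lambda>c. z c - n * lifted_plane c) \<in> B_2_0" if z: "z \<in> Z_2_0" for z
  proof -
    \<comment> \<open>the weight of \<open>lifted_plane\<close> at \<open>t\<close> is \<open>- turn T t\<close>, a sign\<close>
    define n where "n = - (turn T t * weight z t)"
    have "weight (\<lambda>c. z c - n * lifted_plane c) s = 0" if s: "s \<in> tiles T" for s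
    proof -
      have "turn T s * n = - (turn T s * (turn T s * weight z s))"
        unfolding n_def weight_constant[OF z t s] by simp
      then have "turn T s * n = - weight z s" using sq[OF s] by (simp add: mult.assoc[symmetric])
      moreover have "weight (\<lambda>c. z c - n * lifted_plane c) s = weight z s - n * weight lifted_plane s"
        by (simp add: weight_def algebra_simps)
      ultimately show ?thesis using weight_lifted_plane[OF s] by (simp add: mult.commute)
    qed
    moreover have "(\<lambda>c. z c - n * lifted_plane c) \<in> Z_2_0"
      by (intro chain_group_diff chain_group_mult Q.Z z lifted_plane_Z)
    ultimately show ?thesis using weightless_in_B_2_0 by blast
  qed
  have inj: "n = 0" if b: "(\<lambda>c. n * lifted_plane c) \<in> B_2_0" for n
  proof -
    obtain h y where hy: "h \<in> PE_filtration T 1 2" "y \<in> PE_chains T 3"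
        "(\<lambda>c. n * lifted_plane c) = (\<lambda>z. h z + PE_boundary T 3 y z)"
      using b unfolding B_2_0_iff by blast
    have "n * weight lifted_plane t = weight (\<lambda>c. n * lifted_plane c) t" by (simp add: weight_def algebra_simps)
    also have "\<dots> = weight (PE_boundary T 3 y) t"
      unfolding hy(3) using filtration_vanishes[OF hy(1) t] by (simp add: weight_def)
    also have "\<dots> = 0" by (rule weight_boundary[OF hy(2) t])
    finally show "n = 0" using weight_lifted_plane[OF t] turn_sign[OF t] by auto
  qed
  show "E_page T 2 2 0 \<cong> integer_group"
    using Q.infinite_cyclic(1)[OF lifted_plane_Z surj inj] by (simp add: ss_page_def)
  show "generate (E_page T 2 2 0) {E_class T 2 2 0 lifted_plane} = carrier (E_page T 2 2 0)"
    using Q.infinite_cyclic(2)[OF lifted_plane_Z surj inj] by (simp add: ss_page_def ss_class_def)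
qed

lemma d2_lifted_plane:
  "F1_induced T 0 (E_diff T 2 2 0 (E_class T 2 2 0 lifted_plane)) = ePE_class T 0 (omega T \<rho>)"
  unfolding E_diff_2_0[OF lifted_plane_Z] boundary_lifted_plane by (rule F1_induced_iso(2)[OF omega_ePE])

lemma lifted_plane_class: "E_class T 2 2 0 lifted_plane \<in> carrier (E_page T 2 2 0)"
proof -
  interpret Q: chain_quotient Z_2_0 B_2_0 by (rule quotient_2_0)
  show ?thesis using Q.coset_in_carrier[OF lifted_plane_Z] by (simp add: ss_page_def ss_class_def)
qed

end

theorem theorem2p2:
  fixes T :: "'l marked_tiling" and \<rho> :: "complex set \<Rightarrow> real"
  assumes "polytopal_tiling T"
    and "eFLC T"
    and "trivial_cell_isotropy T"
    and "trivial_star_isotropy T"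
    and "consistently_oriented T"
    and "prototiles_chosen T"
    and "edge_angles T \<rho>"
  shows "E_page T 2 2 0 \<cong> integer_group \<and>
         F1_induced T 0 \<in> iso (E_page T 2 0 1) (ePE_homology T 0) \<and>
         (\<exists>\<Gamma>\<in>carrier (E_page T 2 2 0).
            generate (E_page T 2 2 0) {\<Gamma>} = carrier (E_page T 2 2 0) \<and>
            F1_induced T 0 (E_diff T 2 2 0 \<Gamma>) = ePE_class T 0 (omega T \<rho>))"
proof -
  interpret angled_tiling T \<rho>
    using assms by unfold_locales
  show ?thesis
    using lifted_plane_generates F1_induced_iso(1) lifted_plane_class d2_lifted_plane by blast
qed

end
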